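(* Let $\mathfrak M$ be a Hilbert space and $\mathcal E:=\mathbb C\setminus\{(-\infty,-1]\cup[1,+\infty)\}$. 1) The mapping $\mathbf\Phi$ of $\mathcal{RS}(\mathfrak M)$ into itself given by $\mathbf\Phi(\Omega)(z)=(zI-\Omega(z))(I-z\Omega(z))^{-1}$, $z\in\mathcal E$, has a unique fixed point $$\Omega_0(z)=\frac{zI_{\mathfrak M}}{1+\sqrt{1-z^2}},\quad\text{with}\quad \Omega_0(i)=\frac{iI_{\mathfrak M}}{1+\sqrt2}.$$ 2) The mapping $\mathbf\Gamma$ of $\mathbf N^0_{\mathfrak M}[-1,1]$ into itself given by $\mathbf\Gamma(M)(\xi)=\dfrac{M^{-1}(\xi)}{\xi^2-1}$, $\xi\in\mathbb C\setminus[-1,1]$, has a unique fixed point $$M_0(\xi)=-\frac{I_{\mathfrak M}}{\sqrt{\xi^2-1}},\quad\text{with}\quad M_0(i)=\frac{iI_{\mathfrak M}}{\sqrt2}.$$ 3) Let $\rho_0(t)=\frac1\pi\frac1{\sqrt{1-t^2}}$, $t\in(-1,1)$, and let $$\mathfrak H_0:=L_2([-1,1],\mathfrak M,\rho_0(t))=\left\{f(t):\int_{-1}^1\frac{\|f(t)\|^2_{\mathfrak M}}{\sqrt{1-t^2}}\,dt<\infty\right\}$$ be the Hilbert space with the inner product $$(f,g)_{\mathfrak H_0}=\int_{-1}^1(f(t),g(t))_{\mathfrak M}\,\rho_0(t)\,dt=\frac1\pi\int_{-1}^1\frac{(f(t),g(t))_{\mathfrak M}}{\sqrt{1-t^2}}\,dt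 .$$ Identify $\mathfrak M$ with the subspace of $\mathfrak H_0$ of constant vector-functions $\{f(t)\equiv f,\ f\in\mathfrak M\}$, let $$\mathcal K_0:=\mathfrak H_0\ominus\mathfrak M=\left\{f\in\mathfrak H_0:\int_{-1}^1\frac{(f(t),h)_{\mathfrak M}}{\sqrt{1-t^2}}\,dt=0\ \ \forall h\in\mathfrak M\right\},$$ and define in $\mathfrak H_0$ the multiplication operator $(T_0f)(t)=tf(t)$, $f\in\mathfrak H_0$. Then $\Omega_0$ is the transfer function of the simple passive selfadjoint system $\tau_0=\{T_0;\mathfrak M,\mathfrak M,\mathcal K_0\}$, while $$M_0(\xi)=P_{\mathfrak M}(T_0-\xi I)^{-1}\upharpoonright\mathfrak M .$$
   Context: Hilbert spaces are complex and separable. A $\mathbf B(\mathfrak M)$-valued function $M$ is a Nevanlinna function if it is holomorphic outside the real axis, $M(\lambda)^*=M(\bar\lambda)$, and $\operatorname{Im}\lambda\,\operatorname{Im}M(\lambda)\ge0$ for all $\lambda\in\mathbb C\setminus\mathbb R$. The class $\mathcal{RS}(\mathfrak M)$ consists of all $\mathbf B(\mathfrak M)$-valued Nevanlinna functions $\Omega$ which are holomorphic on $\mathcal E$ and satisfy $-I\le\Omega(x)\le I$ for all $x\in(-1,1)$. The class $\mathbf N^0_{\mathfrak M}[-1,1]$ consists of all $\mathbf B(\mathfrak M)$-valued Nevanlinna functions $M$ which are holomorphic outside $[-1,1]$ and satisfy $\lim_{\xi\to\infty}\xi M(\xi)=-I_{\mathfrak M}$. It is known that $\mathbf\Phi$ maps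 $\mathcal{RS}(\mathfrak M)$ into itself and $\mathbf\Gamma$ maps $\mathbf N^0_{\mathfrak M}[-1,1]$ into itself. The branches of the square roots are the holomorphic ones on $\mathcal E$, resp. $\mathbb C\setminus[-1,1]$, fixed by the displayed values at $i$. A passive selfadjoint system $\{T;\mathfrak M,\mathfrak M,\mathcal K\}$ is given by a selfadjoint contraction $T=\begin{bmatrix}D&C\\C^*&F\end{bmatrix}$ in $\mathfrak M\oplus\mathcal K$; its transfer function is $D+zC(I-zF)^{-1}C^*$, $z\in\mathcal E$; it is simple if $\overline{\mathrm{span}}\{F^nC^*\mathfrak M:\ n\in\mathbb N_0\}=\mathcal K$. *)

theory Defs
  imports "HOL-Analysis.Analysis"
begin

section \<open>Complex Hilbert spaces\<close>

class scaleC = scaleR +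
  fixes scaleC :: "complex \<Rightarrow> 'a \<Rightarrow> 'a"  (infixr \<open>*\<^sub>C\<close> 75)

text \<open>
  The complex inner product is linear in its first argument. Its real part is the real inner
  product of the class \<^class>\<open>real_inner\<close>, so that the norm, metric and topology are
  the ones of that class, with \<open>norm x = sqrt (Re (cinner x x))\<close>.
\<close>

class complex_inner = scaleC + real_inner +
  fixes cinner :: "'a \<Rightarrow> 'a \<Rightarrow> complex"
  assumes scaleC_add_right: "a *\<^sub>C (x + y) = a *\<^sub>C x + a *\<^sub>C y"
    and scaleC_add_left: "(a + b) *\<^sub>C x = a *\<^sub>C x + b *\<^sub>C x"
    and scaleC_scaleC: "a *\<^sub>C (b *\<^sub>C x) = (a * b) *\<^sub>C x"
    and scaleR_scaleC: "r *\<^sub>R x = complex_of_real r *\<^sub>C x"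
    and cinner_commute: "cinner x y = cnj (cinner y x)"
    and cinner_add_left: "cinner (x + y) z = cinner x z + cinner y z"
    and cinner_scaleC_left: "cinner (a *\<^sub>C x) y = a * cinner x y"
    and inner_eq_Re_cinner: "inner x y = Re (cinner x y)"

class chilbert_space = complex_inner + complete_space

instance chilbert_space \<subseteq> banach ..

text \<open>For metric spaces, second countability is separability.\<close>

class separable_chilbert_space = chilbert_space + second_countable_topology

lemma cinner_add_right: "cinner x (y + z) = cinner x y + cinner x z"
  by (metis cinner_add_left cinner_commute complex_cnj_add)

lemma cinner_scaleC_right: "cinner x (a *\<^sub>C y) = cnj a * cinner x y"
  by (metis cinner_commute cinner_scaleC_left complex_cnj_mult)

lemma cinner_scaleR_left: "cinner (r *\<^sub>R x) y = complex_of_real r * cinner x y"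
  by (simp add: scaleR_scaleC cinner_scaleC_left)

lemma cinner_scaleR_right: "cinner x (r *\<^sub>R y) = complex_of_real r * cinner x y"
  by (simp add: scaleR_scaleC cinner_scaleC_right)

lemma cinner_self: "cinner x x = complex_of_real ((norm x)\<^sup>2)"
proof -
  have "Im (cinner x x) = 0"
    using arg_cong[OF cinner_commute[of x x], of Im] by simp
  then show ?thesis
    by (simp add: complex_eq_iff power2_norm_eq_inner inner_eq_Re_cinner)
qed

lemma norm_scaleC: "norm (a *\<^sub>C x) = cmod a * norm x" for x :: "'a::complex_inner"
proof -
  have "complex_of_real ((norm (a *\<^sub>C x))\<^sup>2) = complex_of_real ((cmod a * norm x)\<^sup>2)"
    unfolding cinner_self[symmetric] cinner_scaleC_left cinner_scaleC_right
    by (simp add: cinner_self power_mult_distrib complex_norm_square del: of_real_power)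
  then show ?thesis
    by (simp only: of_real_eq_iff) (simp add: power2_eq_iff_nonneg)
qed

lemma Im_cinner: "Im (cinner x y) = inner x (\<i> *\<^sub>C y)"
  by (simp add: inner_eq_Re_cinner cinner_scaleC_right)

lemma cmod_cinner_le: "cmod (cinner x y) \<le> 2 * (norm x * norm y)"
proof -
  have "\<bar>Re (cinner x y)\<bar> \<le> norm x * norm y"
    using Cauchy_Schwarz_ineq2[of x y] by (simp add: inner_eq_Re_cinner)
  moreover have "\<bar>Im (cinner x y)\<bar> \<le> norm x * norm y"
    using Cauchy_Schwarz_ineq2[of x "\<i> *\<^sub>C y"] by (simp add: Im_cinner norm_scaleC)
  ultimately show ?thesis
    using cmod_le[of "cinner x y"] by linarith
qed

lemma bounded_bilinear_cinner: "bounded_bilinear (cinner :: 'a::complex_inner \<Rightarrow> _)"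
proof
  show "\<exists>K. \<forall>a b::'a. norm (cinner a b) \<le> norm a * norm b * K"
    by (intro exI[of _ 2] allI order_trans[OF cmod_cinner_le]) simp
qed (simp_all add: cinner_add_left cinner_add_right cinner_scaleR_left cinner_scaleR_right scaleR_conv_of_real)

lemma bounded_linear_scaleC_right: "bounded_linear (\<lambda>x::'a::complex_inner. a *\<^sub>C x)"
proof (rule bounded_linear_intro[where K = "cmod a"])
  show "a *\<^sub>C (r *\<^sub>R x) = r *\<^sub>R (a *\<^sub>C x)" for r and x :: 'a
    by (simp add: scaleR_scaleC scaleC_scaleC mult.commute)
qed (simp_all add: scaleC_add_right norm_scaleC mult.commute)

instantiation prod :: (complex_inner, complex_inner) complex_inner
begin

definition scaleC_prod :: "complex \<Rightarrow> 'a \<times> 'b \<Rightarrow> 'a \<times> 'b"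
  where "a *\<^sub>C p = (a *\<^sub>C fst p, a *\<^sub>C snd p)"

definition cinner_prod :: "'a \<times> 'b \<Rightarrow> 'a \<times> 'b \<Rightarrow> complex"
  where "cinner p q = cinner (fst p) (fst q) + cinner (snd p) (snd q)"

instance
proof
  fix a b :: complex and r :: real and x y z :: "'a \<times> 'b"
  show "a *\<^sub>C (x + y) = a *\<^sub>C x + a *\<^sub>C y" "(a + b) *\<^sub>C x = a *\<^sub>C x + b *\<^sub>C x"
    "a *\<^sub>C (b *\<^sub>C x) = (a * b) *\<^sub>C x" "r *\<^sub>R x = complex_of_real r *\<^sub>C x"
    by (simp_all add: scaleC_prod_def prod_eq_iff scaleC_add_right scaleC_add_left scaleC_scaleC
        scaleR_scaleC)
  show "cinner x y = cnj (cinner y x)"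
    unfolding cinner_prod_def complex_cnj_add by (metis cinner_commute)
  show "cinner (x + y) z = cinner x z + cinner y z" "cinner (a *\<^sub>C x) y = a * cinner x y"
    "inner x y = Re (cinner x y)"
    by (simp_all add: cinner_prod_def scaleC_prod_def cinner_add_left cinner_scaleC_left
        algebra_simps inner_prod_def inner_eq_Re_cinner)
qed

end

instance prod :: (chilbert_space, chilbert_space) chilbert_space ..


section \<open>Bounded operators\<close>

text \<open>
  Bounded operators are the elements of \<open>'a \<Rightarrow>\<^sub>L 'b\<close> (bounded \<^emph>\<open>real\<close>-linear maps with the operator
  norm) that are complex linear.
\<close>

definition clinear_op :: "('a::complex_inner \<Rightarrow>\<^sub>L 'b::complex_inner) \<Rightarrow> bool"
  where "clinear_op A \<longleftrightarrow> (\<forall>a x. A (a *\<^sub>C x) = a *\<^sub>C A x)"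

instantiation blinfun :: (real_normed_vector, complex_inner) scaleC
begin

lift_definition scaleC_blinfun :: "complex \<Rightarrow> 'a \<Rightarrow>\<^sub>L 'b \<Rightarrow> 'a \<Rightarrow>\<^sub>L 'b" is "\<lambda>a A x. a *\<^sub>C A x"
  by (rule bounded_linear_compose[OF bounded_linear_scaleC_right])

instance ..

end

definition op_invertible :: "('a::real_normed_vector \<Rightarrow>\<^sub>L 'a) \<Rightarrow> bool"
  where "op_invertible A \<longleftrightarrow> (\<exists>B. B o\<^sub>L A = id_blinfun \<and> A o\<^sub>L B = id_blinfun)"

definition op_inv :: "('a::real_normed_vector \<Rightarrow>\<^sub>L 'a) \<Rightarrow> 'a \<Rightarrow>\<^sub>L 'a"
  where "op_inv A = (THE B. B o\<^sub>L A = id_blinfun \<and> A o\<^sub>L B = id_blinfun)"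

text \<open>The description is proper for complex linear \<open>A\<close>, by Riesz representation.\<close>

definition cadjoint :: "('a::chilbert_space \<Rightarrow>\<^sub>L 'b::chilbert_space) \<Rightarrow> 'b \<Rightarrow>\<^sub>L 'a"
  where "cadjoint A = (THE B :: 'b \<Rightarrow>\<^sub>L 'a. \<forall>x y. cinner (A x) y = cinner x (B y))"

definition op_Im :: "('a::chilbert_space \<Rightarrow>\<^sub>L 'a) \<Rightarrow> 'a \<Rightarrow>\<^sub>L 'a"
  where "op_Im A = (1 / (2 * \<i>)) *\<^sub>C (A - cadjoint A)"

text \<open>\<open>\<real>\<^sub>\<ge>\<^sub>0\<close> consists of complex numbers here: the quadratic form has to be real and nonnegative.\<close>

definition positive_op :: "('a::chilbert_space \<Rightarrow>\<^sub>L 'a) \<Rightarrow> bool"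
  where "positive_op A \<longleftrightarrow> (\<forall>x. cinner (A x) x \<in> \<real>\<^sub>\<ge>\<^sub>0)"

definition op_le :: "('a::chilbert_space \<Rightarrow>\<^sub>L 'a) \<Rightarrow> ('a \<Rightarrow>\<^sub>L 'a) \<Rightarrow> bool"
  where "op_le A B \<longleftrightarrow> positive_op (B - A)"

definition op_holomorphic_on ::
    "(complex \<Rightarrow> 'a::complex_inner \<Rightarrow>\<^sub>L 'b::complex_inner) \<Rightarrow> complex set \<Rightarrow> bool"
  where "op_holomorphic_on F S \<longleftrightarrow>
    (\<forall>z\<in>S. \<exists>D. ((\<lambda>w. (1 / (w - z)) *\<^sub>C (F w - F z)) \<longlongrightarrow> D) (at z within S))"

definition csubspace :: "'a::complex_inner set \<Rightarrow> bool"
  where "csubspace V \<longleftrightarrow> subspace V \<and> (\<forall>a. \<forall>x\<in>V. a *\<^sub>C x \<in> V)"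

definition ortho_proj :: "'a::complex_inner set \<Rightarrow> 'a \<Rightarrow> 'a"
  where "ortho_proj V x = (THE y. y \<in> V \<and> (\<forall>v\<in>V. cinner (x - y) v = 0))"


section \<open>The function classes and the two transformations\<close>

text \<open>
  Functions on \<open>\<E>\<close> or on \<open>\<complex> - [-1,1]\<close> are represented by functions on \<open>\<complex>\<close> that are \<open>extensional\<close>,
  that is, have the value \<open>undefined\<close> off that domain. So two of them are equal iff they agree on
  the domain.
\<close>

definition nevanlinna :: "(complex \<Rightarrow> 'a::chilbert_space \<Rightarrow>\<^sub>L 'a) \<Rightarrow> bool"
  where "nevanlinna M \<longleftrightarrow>
    op_holomorphic_on M (- \<real>) \<and>
    (\<forall>z\<in>- \<real>. clinear_op (M z) \<and> cadjoint (M z) = M (cnj z) \<and>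
      positive_op (Im z *\<^sub>R op_Im (M z)))"

definition slit_plane :: "complex set"  (\<open>\<E>\<close>)
  where "\<E> = - complex_of_real ` ({..-1} \<union> {1..})"

definition cut_plane :: "complex set"
  where "cut_plane = - complex_of_real ` {-1..1}"

definition RS :: "(complex \<Rightarrow> 'a::chilbert_space \<Rightarrow>\<^sub>L 'a) set"
  where "RS = {\<Omega> \<in> extensional \<E>.
    (\<forall>z\<in>\<E>. clinear_op (\<Omega> z)) \<and> nevanlinna \<Omega> \<and> op_holomorphic_on \<Omega> \<E> \<and>
    (\<forall>x\<in>{-1<..<1}. op_le (- id_blinfun) (\<Omega> (complex_of_real x)) \<and>
      op_le (\<Omega> (complex_of_real x)) id_blinfun)}"

definition N0 :: "(complex \<Rightarrow> 'a::chilbert_space \<Rightarrow>\<^sub>L 'a) set"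
  where "N0 = {M \<in> extensional cut_plane.
    (\<forall>\<xi>\<in>cut_plane. clinear_op (M \<xi>)) \<and> nevanlinna M \<and> op_holomorphic_on M cut_plane \<and>
    ((\<lambda>\<xi>. \<xi> *\<^sub>C M \<xi>) \<longlongrightarrow> - id_blinfun) at_infinity}"

definition Phi :: "(complex \<Rightarrow> 'a::chilbert_space \<Rightarrow>\<^sub>L 'a) \<Rightarrow> complex \<Rightarrow> 'a \<Rightarrow>\<^sub>L 'a"
  where "Phi \<Omega> =
    (\<lambda>z\<in>\<E>. (z *\<^sub>C id_blinfun - \<Omega> z) o\<^sub>L op_inv (id_blinfun - z *\<^sub>C \<Omega> z))"

definition Gam :: "(complex \<Rightarrow> 'a::chilbert_space \<Rightarrow>\<^sub>L 'a) \<Rightarrow> complex \<Rightarrow> 'a \<Rightarrow>\<^sub>L 'a"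
  where "Gam M = (\<lambda>\<xi>\<in>cut_plane. (1 / (\<xi>\<^sup>2 - 1)) *\<^sub>C op_inv (M \<xi>))"

text \<open>
  The branches of \<open>sqrt (1 - z\<^sup>2)\<close> on \<open>\<E>\<close> with value \<open>sqrt 2\<close> at \<open>\<i>\<close>, and of \<open>sqrt (\<xi>\<^sup>2 - 1)\<close> off
  \<open>[-1,1]\<close> with value \<open>\<i> * sqrt 2\<close> at \<open>\<i>\<close>, expressed by the principal root \<^const>\<open>csqrt\<close>. Holomorphy,
  the square and the value at \<open>\<i>\<close>, which determine each branch, are proved below.
\<close>

definition sqrt_slit :: "complex \<Rightarrow> complex"
  where "sqrt_slit z = csqrt (1 - z\<^sup>2)"

definition sqrt_cut :: "complex \<Rightarrow> complex"
  where "sqrt_cut \<xi> = \<xi> * csqrt (1 - 1 / \<xi>\<^sup>2)"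

lemma sq_real_ge_imp_real:
  assumes "w\<^sup>2 = complex_of_real r" "r \<ge> 0"
  shows "w \<in> complex_of_real ` {- sqrt r, sqrt r}"
proof -
  have "w\<^sup>2 = (complex_of_real (sqrt r))\<^sup>2"
    using assms by (metis of_real_power real_sqrt_pow2)
  then show ?thesis
    unfolding power2_eq_iff by auto
qed

lemma slit_not_nonpos:
  assumes "z \<in> \<E>"
  shows "1 - z\<^sup>2 \<notin> \<real>\<^sub>\<le>\<^sub>0"
proof
  assume "1 - z\<^sup>2 \<in> \<real>\<^sub>\<le>\<^sub>0"
  then obtain r where r: "1 - z\<^sup>2 = complex_of_real r" "r \<le> 0"
    by (auto elim: nonpos_Reals_cases)
  then have "z\<^sup>2 = complex_of_real (1 - r)"
    by (simp add: algebra_simps)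
  then have "z \<in> complex_of_real ` {- sqrt (1 - r), sqrt (1 - r)}"
    using r(2) by (intro sq_real_ge_imp_real) auto
  moreover have "sqrt (1 - r) \<ge> 1"
    using r(2) by simp
  ultimately show False
    using assms by (auto simp: slit_plane_def image_iff)
qed

lemma cut_nonzero: "\<xi> \<in> cut_plane \<Longrightarrow> \<xi> \<noteq> 0"
  by (force simp: cut_plane_def image_iff)

lemma cut_not_nonpos:
  assumes "\<xi> \<in> cut_plane"
  shows "1 - 1 / \<xi>\<^sup>2 \<notin> \<real>\<^sub>\<le>\<^sub>0"
proof
  assume "1 - 1 / \<xi>\<^sup>2 \<in> \<real>\<^sub>\<le>\<^sub>0"
  then obtain r where r: "1 - 1 / \<xi>\<^sup>2 = complex_of_real r" "r \<le> 0"
    by (auto elim: nonpos_Reals_cases)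
  then have "1 / \<xi>\<^sup>2 = complex_of_real (1 - r)"
    by (simp add: algebra_simps)
  then have "\<xi>\<^sup>2 = complex_of_real (1 / (1 - r))"
    using cut_nonzero[OF assms] r(2)
    by (metis of_real_1 of_real_divide div_by_1 divide_divide_eq_right mult_1)
  then have "\<xi> \<in> complex_of_real ` {- sqrt (1 / (1 - r)), sqrt (1 / (1 - r))}"
    using r(2) by (intro sq_real_ge_imp_real) auto
  moreover have "{- s, s} \<subseteq> {-1..1}" if "0 \<le> s" "s \<le> 1" for s :: real
    using that by auto
  then have "{- sqrt (1 / (1 - r)), sqrt (1 / (1 - r))} \<subseteq> {-1..1}"
    by this (use r(2) in simp_all)
  ultimately show False
    using assms unfolding cut_plane_def by blast
qed

lemma sqrt_slit_square: "(sqrt_slit z)\<^sup>2 = 1 - z\<^sup>2"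
  by (simp add: sqrt_slit_def)

lemma sqrt_slit_holomorphic: "sqrt_slit holomorphic_on \<E>"
  unfolding sqrt_slit_def[abs_def] using slit_not_nonpos by (intro holomorphic_intros) auto

lemma sqrt_slit_i: "sqrt_slit \<i> = complex_of_real (sqrt 2)"
  by (simp add: sqrt_slit_def)

lemma sqrt_cut_square: "\<xi> \<in> cut_plane \<Longrightarrow> (sqrt_cut \<xi>)\<^sup>2 = \<xi>\<^sup>2 - 1"
  using cut_nonzero[of \<xi>] by (simp add: sqrt_cut_def power_mult_distrib field_simps)

lemma sqrt_cut_holomorphic: "sqrt_cut holomorphic_on cut_plane"
  unfolding sqrt_cut_def[abs_def] using cut_not_nonpos cut_nonzero
  by (intro holomorphic_intros) auto

lemma sqrt_cut_i: "sqrt_cut \<i> = \<i> * complex_of_real (sqrt 2)"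
  by (simp add: sqrt_cut_def)

definition Omega0 :: "complex \<Rightarrow> 'a::chilbert_space \<Rightarrow>\<^sub>L 'a"
  where "Omega0 = (\<lambda>z\<in>\<E>. (z / (1 + sqrt_slit z)) *\<^sub>C id_blinfun)"

definition M0 :: "complex \<Rightarrow> 'a::chilbert_space \<Rightarrow>\<^sub>L 'a"
  where "M0 = (\<lambda>\<xi>\<in>cut_plane. - ((1 / sqrt_cut \<xi>) *\<^sub>C id_blinfun))"


section \<open>Passive selfadjoint systems\<close>

text \<open>
  The system operator \<open>T\<close> acts in the orthogonal sum \<open>'m \<times> 'k\<close>. For selfadjoint \<open>T\<close> its lower left
  entry is \<open>cadjoint (op_C T)\<close>, so \<open>op_D T\<close>, \<open>op_C T\<close> and \<open>op_F T\<close> determine it.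
\<close>

definition passive_selfadjoint ::
    "(('m::chilbert_space \<times> 'k::chilbert_space) \<Rightarrow>\<^sub>L ('m \<times> 'k)) \<Rightarrow> bool"
  where "passive_selfadjoint T \<longleftrightarrow> clinear_op T \<and> cadjoint T = T \<and> norm T \<le> 1"

lift_definition inl_blinfun :: "'a::real_normed_vector \<Rightarrow>\<^sub>L ('a \<times> 'b::real_normed_vector)"
  is "\<lambda>x. (x, 0)"
  by (intro bounded_linear_Pair bounded_linear_ident bounded_linear_zero)

lift_definition inr_blinfun :: "'b::real_normed_vector \<Rightarrow>\<^sub>L ('a::real_normed_vector \<times> 'b)"
  is "\<lambda>x. (0, x)"
  by (intro bounded_linear_Pair bounded_linear_ident bounded_linear_zero)

definition op_D :: "(('m::chilbert_space \<times> 'k::chilbert_space) \<Rightarrow>\<^sub>L ('m \<times> 'k)) \<Rightarrow> 'm \<Rightarrow>\<^sub>L 'm"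
  where "op_D T = fst_blinfun o\<^sub>L T o\<^sub>L inl_blinfun"

definition op_C :: "(('m::chilbert_space \<times> 'k::chilbert_space) \<Rightarrow>\<^sub>L ('m \<times> 'k)) \<Rightarrow> 'k \<Rightarrow>\<^sub>L 'm"
  where "op_C T = fst_blinfun o\<^sub>L T o\<^sub>L inr_blinfun"

definition op_F :: "(('m::chilbert_space \<times> 'k::chilbert_space) \<Rightarrow>\<^sub>L ('m \<times> 'k)) \<Rightarrow> 'k \<Rightarrow>\<^sub>L 'k"
  where "op_F T = snd_blinfun o\<^sub>L T o\<^sub>L inr_blinfun"

definition transfer_function ::
    "(('m::chilbert_space \<times> 'k::chilbert_space) \<Rightarrow>\<^sub>L ('m \<times> 'k)) \<Rightarrow> complex \<Rightarrow> 'm \<Rightarrow>\<^sub>L 'm"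
  where "transfer_function T =
    (\<lambda>z\<in>\<E>. op_D T +
      z *\<^sub>C (op_C T o\<^sub>L op_inv (id_blinfun - z *\<^sub>C op_F T) o\<^sub>L cadjoint (op_C T)))"

definition simple_system ::
    "(('m::chilbert_space \<times> 'k::chilbert_space) \<Rightarrow>\<^sub>L ('m \<times> 'k)) \<Rightarrow> bool"
  where "simple_system T \<longleftrightarrow>
    closure (csubspace hull
      (\<Union>n. range (\<lambda>f. (blinfun_apply (op_F T) ^^ n) (cadjoint (op_C T) f)))) = UNIV"


section \<open>The model space and the model system\<close>

definition rho0 :: "real \<Rightarrow> real"
  where "rho0 t = 1 / pi * (1 / sqrt (1 - t\<^sup>2))"

text \<open>
  At the end points \<open>rho0\<close> has the value \<open>0\<close> by the convention for division; they form a null set.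
\<close>

definition mu0 :: "real measure"
  where "mu0 = density (restrict_space lborel {-1..1}) (\<lambda>t. ennreal (rho0 t))"

lemma space_mu0: "space mu0 = {-1..1}"
  by (simp add: mu0_def space_restrict_space)

lemma rho0_nonneg: "t \<in> {-1..1} \<Longrightarrow> 0 \<le> rho0 t"
  by (auto simp: rho0_def abs_square_le_1[unfolded abs_le_iff] abs_le_iff intro!: divide_nonneg_nonneg)

lemma rho0_measurable [measurable]: "rho0 \<in> borel_measurable borel"
  unfolding rho0_def[abs_def] by measurable

lemma rho0_integral:
  "set_integrable lborel {-1<..<1} rho0" "(LBINT t:{-1<..<1}. rho0 t) = 1"
proof -
  have ei: "einterval (ereal (-1)) (ereal 1) = {-1<..<1}"
    by (auto simp: einterval_def)
  have D: "((\<lambda>x. arcsin x / pi) has_real_derivative rho0 x) (at x)" if "ereal (-1) < ereal x" "ereal x < ereal 1" for x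
  proof -
    have "(arcsin has_real_derivative inverse (sqrt (1 - x\<^sup>2))) (at x)"
      using that by (intro DERIV_arcsin) auto
    from DERIV_cdivide[OF this, of pi] show ?thesis
      by (simp add: rho0_def field_simps)
  qed
  have C: "isCont rho0 x" if "ereal (-1) < ereal x" "ereal x < ereal 1" for x
  proof -
    have "x\<^sup>2 < 1"
      using that by (simp add: abs_square_less_1)
    then show ?thesis
      unfolding rho0_def[abs_def] by (intro continuous_intros) auto
  qed
  have L: "(((\<lambda>x. arcsin x / pi) \<circ> real_of_ereal) \<longlongrightarrow> - 1/2) (at_right (ereal (-1)))"
  proof -
    have "((\<lambda>x. arcsin x / pi) \<longlongrightarrow> arcsin (-1) / pi) (at_right (-1))"
    proof -
      have "(arcsin \<longlongrightarrow> arcsin (-1)) (at (-1) within {-1..1})"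
        using continuous_on_arcsin' unfolding continuous_on_def by (rule bspec) simp
      then have "(arcsin \<longlongrightarrow> arcsin (-1)) (at_right (-1))"
        by (simp add: at_within_Icc_at_right)
      then show ?thesis
        by (intro tendsto_intros) auto
    qed
    then show ?thesis
      unfolding comp_def ereal_tendsto_simps[symmetric] by (simp add: comp_def)
  qed
  have R: "(((\<lambda>x. arcsin x / pi) \<circ> real_of_ereal) \<longlongrightarrow> 1/2) (at_left (ereal 1))"
  proof -
    have "((\<lambda>x. arcsin x / pi) \<longlongrightarrow> arcsin 1 / pi) (at_left 1)"
    proof -
      have "(arcsin \<longlongrightarrow> arcsin 1) (at 1 within {-1..1})"
        using continuous_on_arcsin' unfolding continuous_on_def by (rule bspec) simp
      then have "(arcsin \<longlongrightarrow> arcsin 1) (at_left 1)"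
        by (simp add: at_within_Icc_at_left)
      then show ?thesis
        by (intro tendsto_intros) auto
    qed
    then show ?thesis
      unfolding comp_def ereal_tendsto_simps[symmetric] by (simp add: comp_def)
  qed
  have N: "AE x in lborel. ereal (-1) < ereal x \<longrightarrow> ereal x < ereal 1 \<longrightarrow> 0 \<le> rho0 x"
    by (intro AE_I2) (auto intro: rho0_nonneg)
  note FTC = interval_integral_FTC_nonneg[OF _ D C N L R]
  show "set_integrable lborel {-1<..<1} rho0"
    using FTC(1) ei by simp
  show "(LBINT t:{-1<..<1}. rho0 t) = 1"
    using FTC(2) ei by (simp add: interval_lebesgue_integral_def)
qed

lemma emeasure_mu0: "emeasure mu0 (space mu0) = 1"
proof -
  have "emeasure mu0 (space mu0) = (\<integral>\<^sup>+t. ennreal (rho0 t) \<partial>restrict_space lborel {-1..1})"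
    unfolding mu0_def space_density
    by (subst emeasure_density) (auto intro!: nn_integral_cong measurable_restrict_space1 sets.top[of "restrict_space lborel {-1..1}", unfolded space_restrict_space, simplified])
  also have "\<dots> = (\<integral>\<^sup>+t. ennreal (indicator {-1<..<1} t *\<^sub>R rho0 t) \<partial>lborel)"
    by (subst nn_integral_restrict_space)
      (auto intro!: nn_integral_cong simp: indicator_def rho0_def)
  also have "\<dots> = ennreal (LBINT t:{-1<..<1}. rho0 t)"
    using rho0_integral(1) unfolding set_integrable_def set_lebesgue_integral_def
    by (intro nn_integral_eq_integral AE_I2) (auto simp: indicator_def intro!: rho0_nonneg)
  finally show ?thesis
    by (simp add: rho0_integral(2))
qed

interpretation mu0: finite_measure mu0
  by (rule finite_measureI) (simp add: emeasure_mu0)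

lemma measure_mu0: "measure mu0 (space mu0) = 1"
  by (simp add: measure_def emeasure_mu0)

definition L2_fun :: "(real \<Rightarrow> 'a::separable_chilbert_space) \<Rightarrow> bool"
  where "L2_fun f \<longleftrightarrow> f \<in> borel_measurable mu0 \<and> integrable mu0 (\<lambda>t. (norm (f t))\<^sup>2)"

lemma L2_fun_measurable: "L2_fun f \<Longrightarrow> f \<in> borel_measurable mu0"
  by (simp add: L2_fun_def)

lemma L2_funI:
  assumes "f \<in> borel_measurable mu0" "integrable mu0 g" "AE t in mu0. (norm (f t))\<^sup>2 \<le> g t"
  shows "L2_fun f"
  unfolding L2_fun_def
proof
  have [measurable]: "f \<in> borel_measurable mu0" by fact
  show "integrable mu0 (\<lambda>t. (norm (f t))\<^sup>2)"
    by (rule Bochner_Integration.integrable_bound[OF assms(2)]) (use assms(3) in auto)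
qed fact

lemma L2_fun_const: "L2_fun (\<lambda>t. c)"
  by (simp add: L2_fun_def)

lemma sum_square_le: "(a + b)\<^sup>2 \<le> 2 * a\<^sup>2 + 2 * b\<^sup>2" for a b :: real
  using sum_squares_bound[of a b] by (simp add: power2_sum)

lemma L2_fun_add:
  assumes "L2_fun f" "L2_fun g"
  shows "L2_fun (\<lambda>t. f t + g t)"
proof (rule L2_funI)
  note [measurable] = L2_fun_measurable[OF assms(1)] L2_fun_measurable[OF assms(2)]
  show "(\<lambda>t. f t + g t) \<in> borel_measurable mu0"
    by measurable
  show "integrable mu0 (\<lambda>t. 2 * (norm (f t))\<^sup>2 + 2 * (norm (g t))\<^sup>2)"
    using assms by (auto simp: L2_fun_def)
  show "AE t in mu0. (norm (f t + g t))\<^sup>2 \<le> 2 * (norm (f t))\<^sup>2 + 2 * (norm (g t))\<^sup>2"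
    by (intro AE_I2 order_trans[OF power_mono[OF norm_triangle_ineq] sum_square_le]) simp
qed

lemma continuous_scaleC [continuous_intros]:
  "continuous_on S f \<Longrightarrow> continuous_on S (\<lambda>x. a *\<^sub>C f x)" for f :: "_ \<Rightarrow> 'a::complex_inner"
  by (rule bounded_linear.continuous_on[OF bounded_linear_scaleC_right])

lemma scaleC_measurable [measurable]:
  "f \<in> borel_measurable M \<Longrightarrow> (\<lambda>x. a *\<^sub>C f x) \<in> borel_measurable M"
  for f :: "_ \<Rightarrow> 'a::complex_inner"
  by (rule borel_measurable_continuous_on[where f = "\<lambda>x. a *\<^sub>C x"]) (auto intro!: continuous_intros)

lemma cinner_measurable [measurable]:
  fixes f g :: "_ \<Rightarrow> 'a::separable_chilbert_space"
  assumes "f \<in> borel_measurable M" "g \<in> borel_measurable M"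
  shows "(\<lambda>x. cinner (f x) (g x)) \<in> borel_measurable M"
  using assms
  by (rule borel_measurable_continuous_Pair)
    (intro bounded_bilinear.continuous_on[OF bounded_bilinear_cinner] continuous_intros)

lemma L2_fun_scaleC: "L2_fun f \<Longrightarrow> L2_fun (\<lambda>t. a *\<^sub>C f t)"
  by (auto simp: L2_fun_def norm_scaleC power_mult_distrib)

lemma L2_fun_scaleR: "L2_fun f \<Longrightarrow> L2_fun (\<lambda>t. r *\<^sub>R f t)"
  by (simp add: scaleR_scaleC L2_fun_scaleC)

lemma L2_fun_uminus: "L2_fun f \<Longrightarrow> L2_fun (\<lambda>t. - f t)"
  by (auto simp: L2_fun_def)

lemma L2_fun_diff: "L2_fun f \<Longrightarrow> L2_fun g \<Longrightarrow> L2_fun (\<lambda>t. f t - g t)"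
  using L2_fun_add[of f "\<lambda>t. - g t"] by (simp add: L2_fun_uminus)

lemma L2_fun_cinner:
  assumes "L2_fun f" "L2_fun g"
  shows "integrable mu0 (\<lambda>t. cinner (f t) (g t))"
proof (rule Bochner_Integration.integrable_bound)
  note [measurable] = L2_fun_measurable[OF assms(1)] L2_fun_measurable[OF assms(2)]
  show "(\<lambda>t. cinner (f t) (g t)) \<in> borel_measurable mu0"
    by measurable
  show "integrable mu0 (\<lambda>t. (norm (f t))\<^sup>2 + (norm (g t))\<^sup>2)"
    using assms by (auto simp: L2_fun_def)
  show "AE t in mu0. norm (cinner (f t) (g t)) \<le> norm ((norm (f t))\<^sup>2 + (norm (g t))\<^sup>2)"
    by (intro AE_I2 order_trans[OF cmod_cinner_le]) (use sum_squares_bound in \<open>simp add: mult.assoc\<close>)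
qed

text \<open>
  The space \<open>L\<^sub>2([-1,1], 'a, \<rho>\<^sub>0)\<close>: square integrable functions modulo equality almost everywhere with
  respect to \<^const>\<open>mu0\<close>. Values outside \<open>[-1,1]\<close>, the space of \<^const>\<open>mu0\<close>, play no role.
\<close>

quotient_type (overloaded) 'a H0 = "real \<Rightarrow> 'a::separable_chilbert_space" / partial:
  "\<lambda>f g. L2_fun f \<and> L2_fun g \<and> (AE t in mu0. f t = g t)"
proof (rule part_equivpI)
  show "\<exists>f::real \<Rightarrow> 'a. L2_fun f \<and> L2_fun f \<and> (AE t in mu0. f t = f t)"
    using L2_fun_const by auto
  show "symp (\<lambda>f g::real \<Rightarrow> 'a. L2_fun f \<and> L2_fun g \<and> (AE t in mu0. f t = g t))"
    by (auto intro!: sympI simp: eq_commute)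
  show "transp (\<lambda>f g::real \<Rightarrow> 'a. L2_fun f \<and> L2_fun g \<and> (AE t in mu0. f t = g t))"
    by (rule transpI) (auto elim: AE_mp)
qed

instantiation H0 :: (separable_chilbert_space) complex_inner
begin

lift_definition zero_H0 :: "'a H0" is "\<lambda>t. 0"
  by (simp add: L2_fun_const)

lift_definition plus_H0 :: "'a H0 \<Rightarrow> 'a H0 \<Rightarrow> 'a H0" is "\<lambda>f g t. f t + g t"
  by (auto simp: L2_fun_add)

lift_definition minus_H0 :: "'a H0 \<Rightarrow> 'a H0 \<Rightarrow> 'a H0" is "\<lambda>f g t. f t - g t"
  by (auto simp: L2_fun_diff)

lift_definition uminus_H0 :: "'a H0 \<Rightarrow> 'a H0" is "\<lambda>f t. - f t"
  by (auto simp: L2_fun_uminus)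

lift_definition scaleR_H0 :: "real \<Rightarrow> 'a H0 \<Rightarrow> 'a H0" is "\<lambda>r f t. r *\<^sub>R f t"
  by (auto simp: L2_fun_scaleR)

lift_definition scaleC_H0 :: "complex \<Rightarrow> 'a H0 \<Rightarrow> 'a H0" is "\<lambda>a f t. a *\<^sub>C f t"
  by (auto simp: L2_fun_scaleC)

lift_definition cinner_H0 :: "'a H0 \<Rightarrow> 'a H0 \<Rightarrow> complex"
  is "\<lambda>f g. LINT t|mu0. cinner (f t) (g t)"
  by (intro integral_cong_AE cinner_measurable) (auto simp: L2_fun_measurable)

definition inner_H0 :: "'a H0 \<Rightarrow> 'a H0 \<Rightarrow> real"
  where "inner_H0 f g = Re (cinner f g)"

definition norm_H0 :: "'a H0 \<Rightarrow> real"
  where "norm_H0 f = sqrt (inner f f)"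

definition dist_H0 :: "'a H0 \<Rightarrow> 'a H0 \<Rightarrow> real"
  where "dist_H0 f g = norm (f - g)"

definition sgn_H0 :: "'a H0 \<Rightarrow> 'a H0"
  where "sgn_H0 f = inverse (norm f) *\<^sub>R f"

definition uniformity_H0 :: "('a H0 \<times> 'a H0) filter"
  where "uniformity_H0 = (INF e\<in>{0<..}. principal {(f, g). dist f g < e})"

definition open_H0 :: "'a H0 set \<Rightarrow> bool"
  where "open_H0 U \<longleftrightarrow> (\<forall>f\<in>U. eventually (\<lambda>(f', g). f' = f \<longrightarrow> g \<in> U) uniformity)"

instance
proof
  fix f g h :: "'a H0" and a b :: complex and r s :: real
  show "f + g + h = f + (g + h)" "f + g = g + f" "0 + f = f" "- f + f = 0" "f - g = f + - g"
    by (transfer; auto simp: L2_fun_add L2_fun_diff L2_fun_uminus L2_fun_const algebra_simps)+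
  show "r *\<^sub>R (f + g) = r *\<^sub>R f + r *\<^sub>R g" "(r + s) *\<^sub>R f = r *\<^sub>R f + s *\<^sub>R f"
    "r *\<^sub>R s *\<^sub>R f = (r * s) *\<^sub>R f" "1 *\<^sub>R f = f"
    by (transfer; auto simp: L2_fun_add L2_fun_scaleR algebra_simps)+
  show "a *\<^sub>C (f + g) = a *\<^sub>C f + a *\<^sub>C g" "(a + b) *\<^sub>C f = a *\<^sub>C f + b *\<^sub>C f"
    "a *\<^sub>C b *\<^sub>C f = (a * b) *\<^sub>C f"
    by (transfer; auto simp: L2_fun_add L2_fun_scaleC scaleC_add_left scaleC_add_right scaleC_scaleC)+
  show "r *\<^sub>R f = complex_of_real r *\<^sub>C f"
    by (transfer; auto simp: L2_fun_scaleR L2_fun_scaleC scaleR_scaleC)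
  have com: "cinner f g = cnj (cinner g f)" for f g :: "'a H0"
  proof (transfer, goal_cases)
    case (1 f g)
    have "(\<lambda>t. cinner (f t) (g t)) = (\<lambda>t. cnj (cinner (g t) (f t)))"
      by (rule ext) (rule cinner_commute)
    then show ?case
      by (simp only: Bochner_Integration.integral_cnj)
  qed
  have add: "cinner (f + g) h = cinner f h + cinner g h" for f g h :: "'a H0"
    by (transfer; simp add: cinner_add_left L2_fun_cinner)
  have scC: "cinner (a *\<^sub>C f) g = a * cinner f g" for f g :: "'a H0" and a
    by (transfer; simp add: cinner_scaleC_left)
  have sc: "cinner (r *\<^sub>R f) g = complex_of_real r * cinner f g" for f g :: "'a H0" and r
    by (transfer; simp add: cinner_scaleR_left)
  have self: "cinner f f = complex_of_real (LINT t|mu0. (norm (rep_H0 f t))\<^sup>2)" for f :: "'a H0"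
    by (simp add: cinner_H0_def cinner_self flip: integral_complex_of_real)
  have zero: "cinner f f = 0 \<longleftrightarrow> f = 0" for f :: "'a H0"
  proof (transfer, goal_cases)
    case (1 f)
    then have "(LINT t|mu0. (norm (f t))\<^sup>2) = 0 \<longleftrightarrow> (AE t in mu0. (norm (f t))\<^sup>2 = 0)"
      by (intro integral_nonneg_eq_0_iff_AE) (auto simp: L2_fun_def)
    with 1 show ?case
      by (simp add: cinner_self L2_fun_const del: of_real_power)
  qed
  show "cinner f g = cnj (cinner g f)" by (rule com)
  show "cinner (f + g) h = cinner f h + cinner g h" by (rule add)
  show "cinner (a *\<^sub>C f) g = a * cinner f g" by (rule scC)
  show "inner f g = Re (cinner f g)" by (rule inner_H0_def)
  show "inner f g = inner g f"
    unfolding inner_H0_def by (subst com) simp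
  show "inner (f + g) h = inner f h + inner g h" "inner (r *\<^sub>R f) g = r * inner f g"
    by (simp_all add: inner_H0_def add sc)
  show "0 \<le> inner f f"
    by (simp add: inner_H0_def self)
  show "inner f f = 0 \<longleftrightarrow> f = 0"
    using zero[of f] by (simp add: inner_H0_def self)
  show "norm f = sqrt (inner f f)" by (rule norm_H0_def)
  show "dist f g = norm (f - g)" by (rule dist_H0_def)
  show "sgn f = inverse (norm f) *\<^sub>R f" by (rule sgn_H0_def)
  show "uniformity = (INF e\<in>{0<..}. principal {(f::'a H0, g). dist f g < e})"
    by (rule uniformity_H0_def)
  show "open U \<longleftrightarrow> (\<forall>f\<in>U. eventually (\<lambda>(f', g). f' = f \<longrightarrow> g \<in> U) uniformity)" for U :: "'a H0 set"
    by (rule open_H0_def)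
qed

end


lemma H0_norm_Abs:
  assumes "L2_fun f"
  shows "(norm (abs_H0 f))\<^sup>2 = (LINT t|mu0. (norm (f t))\<^sup>2)"
proof -
  have "cinner (abs_H0 f) (abs_H0 f) = (LINT t|mu0. cinner (f t) (f t))"
    using assms by (simp add: cinner_H0.abs_eq)
  then have "complex_of_real ((norm (abs_H0 f))\<^sup>2) = complex_of_real (LINT t|mu0. (norm (f t))\<^sup>2)"
    by (simp add: cinner_self flip: integral_complex_of_real)
  then show ?thesis
    by (simp only: of_real_eq_iff)
qed

lemma L2_fun_rep: "L2_fun (rep_H0 f)"
  using Quotient_rep_reflp[OF Quotient_H0] by simp

lemma abs_rep_H0: "abs_H0 (rep_H0 f) = f"
  by (rule Quotient_abs_rep[OF Quotient_H0])

lemma abs_H0_diff: "L2_fun f \<Longrightarrow> L2_fun g \<Longrightarrow> abs_H0 f - abs_H0 g = abs_H0 (\<lambda>t. f t - g t)"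
  by (simp add: minus_H0.abs_eq)

lemma L1_le_L2:
  assumes "L2_fun f" "(LINT t|mu0. (norm (f t))\<^sup>2) \<le> e\<^sup>2" "e > 0"
  shows "(\<integral>\<^sup>+t. ennreal (norm (f t)) \<partial>mu0) \<le> ennreal e"
proof -
  note [measurable] = L2_fun_measurable[OF assms(1)]
  have int: "integrable mu0 (\<lambda>t. (norm (f t))\<^sup>2)"
    using assms(1) by (simp add: L2_fun_def)
  have bd: "norm (f t) \<le> (norm (f t))\<^sup>2 / (2 * e) + e / 2" for t
    using sum_squares_bound[of "norm (f t)" e] \<open>e > 0\<close> by (simp add: field_simps power2_eq_square)
  have "(\<integral>\<^sup>+t. ennreal (norm (f t)) \<partial>mu0) \<le> (\<integral>\<^sup>+t. ennreal ((norm (f t))\<^sup>2 / (2 * e) + e / 2) \<partial>mu0)"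
    by (intro nn_integral_mono ennreal_leI bd)
  also have "\<dots> = ennreal (LINT t|mu0. (norm (f t))\<^sup>2 / (2 * e) + e / 2)"
    using int \<open>e > 0\<close> by (intro nn_integral_eq_integral) auto
  also have "(LINT t|mu0. (norm (f t))\<^sup>2 / (2 * e) + e / 2) = (LINT t|mu0. (norm (f t))\<^sup>2) / (2 * e) + e / 2"
    using int by (subst Bochner_Integration.integral_add) (auto simp: measure_mu0)
  also have "\<dots> \<le> e"
    using assms(2,3) by (simp add: field_simps power2_eq_square)
  finally show ?thesis
    by (simp add: ennreal_leI)
qed

instance H0 :: (separable_chilbert_space) chilbert_space
proof
  fix X :: "nat \<Rightarrow> 'a H0"
  assume "Cauchy X"
  have "\<exists>N. \<forall>m\<ge>N. \<forall>n\<ge>N. norm (X m - X n) < (1/2) ^ k" for k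
    using CauchyD[OF \<open>Cauchy X\<close>, of "(1/2) ^ k"] by simp
  then obtain N where N: "\<And>k m n. m \<ge> N k \<Longrightarrow> n \<ge> N k \<Longrightarrow> norm (X m - X n) < (1/2) ^ k"
    by metis
  define r where "r k = (\<Sum>j\<le>k. N j)" for k
  have rN: "N j \<le> r k" if "j \<le> k" for j k
    unfolding r_def using that by (intro member_le_sum) auto
  define f where "f k = rep_H0 (X (r k))" for k
  have L2f: "L2_fun (f k)" for k
    by (simp add: f_def L2_fun_rep)
  note [measurable] = L2_fun_measurable[OF L2f]
  have dist: "(LINT t|mu0. (norm (f j t - f k t))\<^sup>2) \<le> ((1/2) ^ i)\<^sup>2" if "i \<le> j" "i \<le> k" for i j k
  proof -
    have "(LINT t|mu0. (norm (f j t - f k t))\<^sup>2) = (norm (X (r j) - X (r k)))\<^sup>2"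
      using H0_norm_Abs[OF L2_fun_diff[OF L2f L2f], of j k]
        abs_H0_diff[OF L2f L2f, of j k] by (simp add: f_def abs_rep_H0)
    also have "\<dots> \<le> ((1/2) ^ i)\<^sup>2"
      using N[OF rN[OF that(1)] rN[OF that(2)]] by (intro power_mono) auto
    finally show ?thesis .
  qed
  have "(\<integral>\<^sup>+t. (\<Sum>k. ennreal (norm (f (Suc k) t - f k t))) \<partial>mu0)
      = (\<Sum>k. \<integral>\<^sup>+t. ennreal (norm (f (Suc k) t - f k t)) \<partial>mu0)"
    by (intro nn_integral_suminf) measurable
  also have "\<dots> \<le> (\<Sum>k. ennreal ((1/2) ^ k))"
    by (intro suminf_le L1_le_L2 L2_fun_diff L2f dist) auto
  also have "\<dots> < \<infinity>"
    by (simp add: suminf_ennreal_eq[OF _ geometric_sums])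
  finally have fin: "(\<integral>\<^sup>+t. (\<Sum>k. ennreal (norm (f (Suc k) t - f k t))) \<partial>mu0) \<noteq> \<infinity>"
    by simp
  have "AE t in mu0. (\<Sum>k. ennreal (norm (f (Suc k) t - f k t))) \<noteq> \<infinity>"
    by (rule nn_integral_PInf_AE[OF _ fin]) measurable
  then have AEconv: "AE t in mu0. convergent (\<lambda>k. f k t)"
  proof (rule AE_mp, intro AE_I2 impI)
    fix t assume "(\<Sum>k. ennreal (norm (f (Suc k) t - f k t))) \<noteq> \<infinity>"
    then have "summable (\<lambda>k. norm (f (Suc k) t - f k t))"
      by (intro summable_suminf_not_top) auto
    then have "summable (\<lambda>k. f (Suc k) t - f k t)"
      by (rule summable_norm_cancel)
    then have "convergent (\<lambda>n. f n t - f 0 t)"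
      using sum_lessThan_telescope[of "\<lambda>k. f k t"] by (simp add: summable_iff_convergent)
    then show "convergent (\<lambda>k. f k t)"
      by (simp add: convergent_diff_const_right_iff)
  qed
  define g where "g t = lim (\<lambda>k. f k t)" for t
  have [measurable]: "g \<in> borel_measurable mu0"
    unfolding g_def[abs_def] by measurable
  have AElim: "AE t in mu0. (\<lambda>k. f k t) \<longlonglongrightarrow> g t"
    using AEconv unfolding g_def convergent_LIMSEQ_iff .
  have bd: "(\<integral>\<^sup>+t. ennreal ((norm (g t - f k t))\<^sup>2) \<partial>mu0) \<le> ennreal (((1/2) ^ k)\<^sup>2)" for k
  proof -
    have "(\<integral>\<^sup>+t. ennreal ((norm (g t - f k t))\<^sup>2) \<partial>mu0)
        = (\<integral>\<^sup>+t. liminf (\<lambda>j. ennreal ((norm (f j t - f k t))\<^sup>2)) \<partial>mu0)"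
    proof (rule nn_integral_cong_AE, rule AE_mp[OF AElim], intro AE_I2 impI)
      fix t assume "(\<lambda>j. f j t) \<longlonglongrightarrow> g t"
      then have "(\<lambda>j. ennreal ((norm (f j t - f k t))\<^sup>2)) \<longlonglongrightarrow> ennreal ((norm (g t - f k t))\<^sup>2)"
        by (intro tendsto_intros)
      from lim_imp_Liminf[OF sequentially_bot this]
      show "ennreal ((norm (g t - f k t))\<^sup>2) = liminf (\<lambda>j. ennreal ((norm (f j t - f k t))\<^sup>2))" ..
    qed
    also have "\<dots> \<le> liminf (\<lambda>j. \<integral>\<^sup>+t. ennreal ((norm (f j t - f k t))\<^sup>2) \<partial>mu0)"
      by (rule nn_integral_liminf) measurable
    also have "\<dots> \<le> liminf (\<lambda>j. ennreal (((1/2) ^ k)\<^sup>2))"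
    proof (rule Liminf_mono, rule eventually_sequentiallyI[of k])
      fix j assume "k \<le> j"
      have "(\<integral>\<^sup>+t. ennreal ((norm (f j t - f k t))\<^sup>2) \<partial>mu0) = ennreal (LINT t|mu0. (norm (f j t - f k t))\<^sup>2)"
        using L2_fun_diff[OF L2f L2f, of j k] by (intro nn_integral_eq_integral) (auto simp: L2_fun_def)
      also have "\<dots> \<le> ennreal (((1/2) ^ k)\<^sup>2)"
        by (intro ennreal_leI dist) (use \<open>k \<le> j\<close> in auto)
      finally show "(\<integral>\<^sup>+t. ennreal ((norm (f j t - f k t))\<^sup>2) \<partial>mu0) \<le> ennreal (((1/2) ^ k)\<^sup>2)" .
    qed
    also have "\<dots> = ennreal (((1/2) ^ k)\<^sup>2)"
      by (simp add: Liminf_const)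
    finally show ?thesis .
  qed
  have L2d: "L2_fun (\<lambda>t. g t - f k t)" for k
    unfolding L2_fun_def using le_less_trans[OF bd ennreal_less_top]
    by (auto intro!: integrableI_nonneg)
  have "L2_fun (\<lambda>t. (g t - f 0 t) + f 0 t)"
    by (rule L2_fun_add[OF L2d L2f])
  then have L2g: "L2_fun g"
    by simp
  have lim: "norm (abs_H0 g - X (r k)) \<le> (1/2) ^ k" for k
  proof -
    have "ennreal ((norm (abs_H0 g - X (r k)))\<^sup>2) = ennreal (LINT t|mu0. (norm (g t - f k t))\<^sup>2)"
      using H0_norm_Abs[OF L2d, of k] abs_H0_diff[OF L2g L2f, of k] by (simp add: f_def abs_rep_H0)
    also have "\<dots> = (\<integral>\<^sup>+t. ennreal ((norm (g t - f k t))\<^sup>2) \<partial>mu0)"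
      using L2d[of k] by (intro nn_integral_eq_integral[symmetric]) (auto simp: L2_fun_def)
    also have "\<dots> \<le> ennreal (((1/2) ^ k)\<^sup>2)"
      by (rule bd)
    finally show ?thesis
      by (simp add: power_mono_iff del: power_divide)
  qed
  have "X \<longlonglongrightarrow> abs_H0 g"
  proof (rule LIMSEQ_I)
    fix e :: real assume "e > 0"
    then obtain k where k: "(1/2) ^ k < e / 2"
      using real_arch_pow_inv[of "e / 2" "1/2"] by auto
    have "norm (X n - abs_H0 g) < e" if "n \<ge> r k" for n
    proof -
      have "norm (X n - X (r k)) < (1/2) ^ k"
        using rN[of k k] that by (intro N) auto
      then show ?thesis
        using lim[of k] k norm_triangle_ineq[of "X n - X (r k)" "X (r k) - abs_H0 g"]
        by (simp add: norm_minus_commute)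
    qed
    then show "\<exists>m. \<forall>n\<ge>m. norm (X n - abs_H0 g) < e"
      by blast
  qed
  then show "convergent X"
    by (auto simp: convergent_def)
qed


lift_definition const_H0 :: "'m::separable_chilbert_space \<Rightarrow> 'm H0" is "\<lambda>h t. h"
  by (simp add: L2_fun_const)

lemma bounded_linear_mult_H0_aux:
  "L2_fun f \<Longrightarrow> L2_fun (\<lambda>t. t *\<^sub>R f t)"
  "L2_fun f \<Longrightarrow> (LINT t|mu0. (norm (t *\<^sub>R f t))\<^sup>2) \<le> (LINT t|mu0. (norm (f t))\<^sup>2)"
proof -
  assume L2: "L2_fun f"
  note [measurable] = L2_fun_measurable[OF L2]
  have [measurable]: "(\<lambda>t. t) \<in> borel_measurable mu0"
    by (auto simp: mu0_def intro!: measurable_restrict_space1)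
  have bd: "(norm (t *\<^sub>R f t))\<^sup>2 \<le> (norm (f t))\<^sup>2" if "t \<in> space mu0" for t
    using that mult_right_mono[of "\<bar>t\<bar>" 1 "norm (f t)"]
    by (intro power_mono) (auto simp: space_mu0 abs_le_iff)
  show *: "L2_fun (\<lambda>t. t *\<^sub>R f t)"
    by (rule L2_funI[where g = "\<lambda>t. (norm (f t))\<^sup>2"]) (use L2 bd in \<open>auto simp: L2_fun_def\<close>)
  show "(LINT t|mu0. (norm (t *\<^sub>R f t))\<^sup>2) \<le> (LINT t|mu0. (norm (f t))\<^sup>2)"
    using L2 * bd by (intro integral_mono) (auto simp: L2_fun_def)
qed

lift_definition mult_H0 :: "'m::separable_chilbert_space H0 \<Rightarrow> 'm H0" is "\<lambda>f t. t *\<^sub>R f t"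
  by (auto simp: bounded_linear_mult_H0_aux)

lemma norm_mult_H0: "norm (mult_H0 f) \<le> norm f"
proof -
  have "(norm (mult_H0 f))\<^sup>2 \<le> (norm f)\<^sup>2"
    using H0_norm_Abs[OF bounded_linear_mult_H0_aux(1)[OF L2_fun_rep], of f]
      H0_norm_Abs[OF L2_fun_rep, of f] bounded_linear_mult_H0_aux(2)[OF L2_fun_rep, of f]
    by (simp add: mult_H0_def abs_rep_H0)
  then show ?thesis
    by (simp add: power_mono_iff)
qed

lift_definition T0 :: "'m::separable_chilbert_space H0 \<Rightarrow>\<^sub>L 'm H0" is mult_H0
proof (rule bounded_linear_intro[where K = 1])
  show "mult_H0 (f + g) = mult_H0 f + mult_H0 g" for f g :: "'m H0"
    by (transfer; auto simp: L2_fun_add bounded_linear_mult_H0_aux scaleR_add_right)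
  show "mult_H0 (r *\<^sub>R f) = r *\<^sub>R mult_H0 f" for r and f :: "'m H0"
    by (transfer; auto simp: L2_fun_scaleR bounded_linear_mult_H0_aux scaleR_left_commute simp del: scaleR_scaleR)
qed (simp add: norm_mult_H0)

text \<open>
  The orthogonal complement of the constant functions: \<open>cinner f (const_H0 h)\<close> is the integral of
  \<open>cinner (f t) h\<close> with respect to \<^const>\<open>mu0\<close>.
\<close>

typedef (overloaded) 'm K0 = "{f :: 'm::separable_chilbert_space H0. \<forall>h. cinner f (const_H0 h) = 0}"
  morphisms of_K0 to_K0
proof
  show "0 \<in> {f :: 'm H0. \<forall>h. cinner f (const_H0 h) = 0}"
    using bounded_bilinear.zero_left[OF bounded_bilinear_cinner] by auto
qed

setup_lifting type_definition_K0

lemma of_K0_orth: "cinner (of_K0 k) (const_H0 h) = 0"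
  using of_K0 by blast

interpretation cinner: bounded_bilinear "cinner :: 'a::complex_inner \<Rightarrow> _"
  by (rule bounded_bilinear_cinner)

instantiation K0 :: (separable_chilbert_space) complex_inner
begin

lift_definition zero_K0 :: "'a K0" is 0
  by (simp add: cinner.zero_left)

lift_definition plus_K0 :: "'a K0 \<Rightarrow> 'a K0 \<Rightarrow> 'a K0" is "(+)"
  by (simp add: cinner_add_left)

lift_definition minus_K0 :: "'a K0 \<Rightarrow> 'a K0 \<Rightarrow> 'a K0" is "(-)"
  by (simp add: cinner.diff_left)

lift_definition uminus_K0 :: "'a K0 \<Rightarrow> 'a K0" is uminus
  by (simp add: cinner.minus_left)

lift_definition scaleR_K0 :: "real \<Rightarrow> 'a K0 \<Rightarrow> 'a K0" is "scaleR"
  by (simp add: cinner_scaleR_left)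

lift_definition scaleC_K0 :: "complex \<Rightarrow> 'a K0 \<Rightarrow> 'a K0" is "scaleC"
  by (simp add: cinner_scaleC_left)

lift_definition cinner_K0 :: "'a K0 \<Rightarrow> 'a K0 \<Rightarrow> complex" is cinner .

lift_definition inner_K0 :: "'a K0 \<Rightarrow> 'a K0 \<Rightarrow> real" is inner .

lift_definition norm_K0 :: "'a K0 \<Rightarrow> real" is norm .

lift_definition dist_K0 :: "'a K0 \<Rightarrow> 'a K0 \<Rightarrow> real" is dist .

lift_definition sgn_K0 :: "'a K0 \<Rightarrow> 'a K0" is sgn
  by (simp add: sgn_div_norm cinner_scaleR_left)

definition uniformity_K0 :: "('a K0 \<times> 'a K0) filter"
  where "uniformity_K0 = (INF e\<in>{0<..}. principal {(f, g). dist f g < e})"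

definition open_K0 :: "'a K0 set \<Rightarrow> bool"
  where "open_K0 U \<longleftrightarrow> (\<forall>f\<in>U. eventually (\<lambda>(f', g). f' = f \<longrightarrow> g \<in> U) uniformity)"

instance
proof
  fix f g h :: "'a K0" and a b :: complex and r s :: real
  show "f + g + h = f + (g + h)" "f + g = g + f" "0 + f = f" "- f + f = 0" "f - g = f + - g"
    by (transfer; simp add: algebra_simps)+
  show "r *\<^sub>R (f + g) = r *\<^sub>R f + r *\<^sub>R g" "(r + s) *\<^sub>R f = r *\<^sub>R f + s *\<^sub>R f"
    "r *\<^sub>R s *\<^sub>R f = (r * s) *\<^sub>R f" "1 *\<^sub>R f = f"
    by (transfer; simp add: algebra_simps)+
  show "a *\<^sub>C (f + g) = a *\<^sub>C f + a *\<^sub>C g" "(a + b) *\<^sub>C f = a *\<^sub>C f + b *\<^sub>C f"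
    "a *\<^sub>C b *\<^sub>C f = (a * b) *\<^sub>C f" "r *\<^sub>R f = complex_of_real r *\<^sub>C f"
    by (transfer; simp add: scaleC_add_left scaleC_add_right scaleC_scaleC scaleR_scaleC)+
  show "cinner f g = cnj (cinner g f)"
    by (transfer; rule cinner_commute)
  show "cinner (f + g) h = cinner f h + cinner g h" "cinner (a *\<^sub>C f) g = a * cinner f g"
    "inner f g = Re (cinner f g)"
    by (transfer; simp add: cinner_add_left cinner_scaleC_left inner_eq_Re_cinner)+
  show "inner f g = inner g f"
    by (transfer; rule inner_commute)
  show "inner (f + g) h = inner f h + inner g h" "inner (r *\<^sub>R f) g = r * inner f g"
    "0 \<le> inner f f" "inner f f = 0 \<longleftrightarrow> f = 0"
    by (transfer; simp add: inner_add_left)+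
  show "norm f = sqrt (inner f f)"
    by (transfer; rule norm_eq_sqrt_inner)
  show "dist f g = norm (f - g)"
    by (transfer; rule dist_norm)
  show "sgn f = inverse (norm f) *\<^sub>R f"
    by (transfer; rule sgn_div_norm)
  show "uniformity = (INF e\<in>{0<..}. principal {(f::'a K0, g). dist f g < e})"
    by (rule uniformity_K0_def)
  show "open U \<longleftrightarrow> (\<forall>f\<in>U. eventually (\<lambda>(f', g). f' = f \<longrightarrow> g \<in> U) uniformity)" for U :: "'a K0 set"
    by (rule open_K0_def)
qed

end

instance K0 :: (separable_chilbert_space) chilbert_space
proof
  fix X :: "nat \<Rightarrow> 'a K0"
  assume "Cauchy X"
  then have "Cauchy (\<lambda>n. of_K0 (X n))"
    by (simp add: Cauchy_def dist_K0.rep_eq)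
  then obtain f where f: "(\<lambda>n. of_K0 (X n)) \<longlonglongrightarrow> f"
    by (auto simp: Cauchy_convergent_iff convergent_def)
  have "cinner f (const_H0 h) = 0" for h
    using cinner.tendsto[OF f tendsto_const, of "const_H0 h"]
    by (simp add: of_K0_orth LIMSEQ_const_iff)
  then have "of_K0 (to_K0 f) = f"
    by (simp add: to_K0_inverse)
  then have "X \<longlonglongrightarrow> to_K0 f"
    using f by (simp add: tendsto_iff dist_K0.rep_eq)
  then show "convergent X"
    by (auto simp: convergent_def)
qed

text \<open>
  The identification of the orthogonal sum \<open>'m \<times> 'm K0\<close> with \<open>'m H0\<close>, where \<open>'m\<close> is embedded as the
  constant functions; \<open>tau0\<close> is the operator \<^const>\<open>T0\<close> read as a block operator on that sum.
\<close>

definition join_H0 :: "'m::separable_chilbert_space \<times> 'm K0 \<Rightarrow> 'm H0"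
  where "join_H0 p = const_H0 (fst p) + of_K0 (snd p)"

lemma cinner_const_H0: "cinner (const_H0 f) (const_H0 g) = cinner f g"
  by transfer (simp add: measure_mu0)

lemma const_H0_add: "const_H0 (f + g) = const_H0 f + const_H0 g"
  by transfer (simp add: L2_fun_const)

lemma const_H0_scaleR: "const_H0 (r *\<^sub>R f) = r *\<^sub>R const_H0 f"
  by transfer (simp add: L2_fun_const)

lemma cinner_join_H0: "cinner (join_H0 p) (join_H0 q) = cinner p q"
proof -
  have "cinner (const_H0 (fst p)) (of_K0 (snd q)) = 0"
    by (subst cinner_commute) (simp add: of_K0_orth)
  then show ?thesis
    by (simp add: join_H0_def cinner_prod_def cinner_add_left cinner_add_right cinner_const_H0
        of_K0_orth cinner_K0.rep_eq)
qed

lemma L2_fun_integrable: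
  assumes "L2_fun f"
  shows "integrable mu0 f"
proof (rule Bochner_Integration.integrable_bound)
  show "integrable mu0 (\<lambda>t. (norm (f t))\<^sup>2 + 1)"
    using assms by (simp add: L2_fun_def)
  show "AE t in mu0. norm (f t) \<le> norm ((norm (f t))\<^sup>2 + 1)"
  proof (intro AE_I2)
    fix t
    have "2 * norm (f t) \<le> (norm (f t))\<^sup>2 + 1"
      using sum_squares_bound[of "norm (f t)" 1] by simp
    moreover have "norm ((norm (f t))\<^sup>2 + 1) = (norm (f t))\<^sup>2 + 1"
      by simp
    ultimately show "norm (f t) \<le> norm ((norm (f t))\<^sup>2 + 1)"
      using norm_ge_zero[of "f t"] by linarith
  qed
qed (rule L2_fun_measurable[OF assms])

lemma surj_join_H0: "\<exists>p. join_H0 p = F"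
proof -
  define h where "h = (LINT t|mu0. rep_H0 F t)"
  have "cinner F (const_H0 g) = cinner h g" for g
  proof -
    have "cinner F (const_H0 g) = cinner (abs_H0 (rep_H0 F)) (abs_H0 (\<lambda>_. g))"
      by (simp add: abs_rep_H0 const_H0.abs_eq)
    also have "\<dots> = (LINT t|mu0. cinner (rep_H0 F t) g)"
      by (subst cinner_H0.abs_eq) (simp_all add: L2_fun_rep L2_fun_const)
    also have "\<dots> = cinner h g"
      unfolding h_def
      by (rule integral_bounded_linear[OF cinner.bounded_linear_left L2_fun_integrable[OF L2_fun_rep]])
    finally show ?thesis .
  qed
  then have "of_K0 (to_K0 (F - const_H0 h)) = F - const_H0 h"
    by (intro to_K0_inverse) (simp add: cinner.diff_left cinner_const_H0)
  then have "join_H0 (h, to_K0 (F - const_H0 h)) = F"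
    by (simp add: join_H0_def)
  then show ?thesis
    by blast
qed

lemma bounded_linear_join_H0: "bounded_linear join_H0"
proof (rule bounded_linear_intro[where K = 1])
  fix p :: "'a \<times> 'a K0"
  show "norm (join_H0 p) \<le> norm p * 1"
    by (simp add: norm_eq_sqrt_inner inner_eq_Re_cinner cinner_join_H0)
qed (simp_all add: join_H0_def const_H0_add const_H0_scaleR plus_K0.rep_eq scaleR_K0.rep_eq
    scaleR_add_right)

lemma norm_join_H0: "norm (join_H0 p) = norm p"
  by (simp add: norm_eq_sqrt_inner inner_eq_Re_cinner cinner_join_H0)

lemma bij_join_H0: "bij join_H0"
proof (rule bijI)
  interpret join: bounded_linear "join_H0 :: 'a \<times> 'a K0 \<Rightarrow> _"
    by (rule bounded_linear_join_H0)
  show "inj (join_H0 :: 'a \<times> 'a K0 \<Rightarrow> _)"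
  proof (rule injI)
    fix p q :: "'a \<times> 'a K0"
    assume "join_H0 p = join_H0 q"
    then have "norm (p - q) = 0"
      by (simp add: norm_join_H0[symmetric] join.diff)
    then show "p = q"
      by simp
  qed
  show "surj (join_H0 :: 'a \<times> 'a K0 \<Rightarrow> _)"
    using surj_join_H0 by (metis surjI)
qed

lemma bounded_linear_inv_join_H0: "bounded_linear (inv join_H0)"
proof (rule bounded_linear_intro[where K = 1])
  interpret join: bounded_linear "join_H0 :: 'a \<times> 'a K0 \<Rightarrow> _"
    by (rule bounded_linear_join_H0)
  note f_inv = surj_f_inv_f[OF bij_is_surj[OF bij_join_H0]]
  note inv_eq = inv_f_eq[OF bij_is_inj[OF bij_join_H0]]
  fix F G :: "'a H0" and r :: real
  show "inv join_H0 (F + G) = inv join_H0 F + inv join_H0 G"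
    by (rule inv_eq) (simp add: join.add f_inv)
  show "inv join_H0 (r *\<^sub>R F) = r *\<^sub>R inv join_H0 F"
    by (rule inv_eq) (simp add: join.scaleR f_inv)
  show "norm (inv join_H0 F) \<le> norm F * 1"
    by (simp add: norm_join_H0[symmetric] f_inv)
qed

lift_definition tau0 ::
    "('m::separable_chilbert_space \<times> 'm K0) \<Rightarrow>\<^sub>L ('m \<times> 'm K0)"
  is "\<lambda>p. inv join_H0 (T0 (join_H0 p))"
  by (intro bounded_linear_compose[OF bounded_linear_inv_join_H0]
      bounded_linear_compose[OF blinfun.bounded_linear_right] bounded_linear_join_H0)

end

theory Submission
  imports Defs "HOL-Complex_Analysis.Complex_Analysis"
begin

text \<open>
  No integral representations are used: quadratic forms reduce the operator statements to scalar
  functions, and inverses exist because the operators in question are coercive (Lax--Milgram).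
  Two classical facts about a holomorphic \<open>p\<close> on the right half plane with \<open>Re p \<ge> 0\<close>, real on the
  positive axis, carry the analysis: \<open>\<bar>arg (p z)\<bar> \<le> \<bar>arg z\<bar>\<close> and Harnack's inequality; both follow from
  the Schwarz lemma. The first, applied to the square root of the quadratic form of
  \<open>(1 + \<Omega>) (1 - \<Omega>)\<^sup>-\<^sup>1\<close>, says exactly that \<open>\<Phi>(\<Omega>)\<close> is a Nevanlinna function. For \<open>M\<close> in \<open>N0\<close> the function
  \<open>- sqrt (\<xi>\<^sup>2 - 1) (M(\<xi>) g, g)\<close> has nonnegative real part, by Rogosinski's argument for typically real
  functions; Harnack's inequality then gives the invertibility of \<open>M(\<xi>)\<close>, and the bound on the argument
  that \<open>\<Gamma>(M)\<close> is a Nevanlinna function.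

  A fixed point satisfies \<open>(1 - z \<Omega>)\<^sup>2 = 1 - z\<^sup>2\<close>, respectively \<open>M\<^sup>2 = (\<xi>\<^sup>2 - 1)\<^sup>-\<^sup>1\<close>, pointwise; the same
  coercivity estimates make one of the two factors \<open>B \<plusminus> s\<close> of \<open>B\<^sup>2 - s\<^sup>2 = 0\<close> invertible.

  For the model, \<open>\<integral> \<rho>\<^sub>0(t) / (t - \<xi>) dt\<close> has an elementary primitive, the transfer function is the
  Schur complement of the resolvent, and simplicity is the completeness of the polynomials.
\<close>


section \<open>Bounded operators on complex Hilbert spaces\<close>

text \<open>In both transformations the inverse disappears at a suitable vector: at
  \<open>f = g - z \<Omega>(z) g\<close>, respectively \<open>f = M(\<xi>) g\<close>, the quadratic
  form of the image is explicit in \<open>g\<close>. The sector bound concerns a form at another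
  vector, chosen so that its resolvent at the given point returns the same \<open>g\<close>. Square
  roots enter because (1 + z) / (1 - z) carries \<E> onto the plane cut along the negative axis, and
  its root onto the half plane. The form must avoid that cut too, which fails for degenerate
  functions such as the constant identity; hence a perturbation and a limit. On the other domain the
  Joukowski map moves infinity to the centre of the disk: the normalisation of \<open>M\<close> at
  infinity fixes the value there, and Harnack's inequality spreads it with a constant that depends
  on the point but not on \<open>g\<close>. The pointwise equation
  \<open>B\<^sup>2 = s\<^sup>2\<close> alone cannot give uniqueness, since \<open>s\<close> times
  any involution solves it; the Nevanlinna sign selects the root.\<close>

lemma bounded_bilinear_scaleC: "bounded_bilinear (scaleC :: complex \<Rightarrow> 'a::complex_inner \<Rightarrow> 'a)"
proof
  show "\<exists>K. \<forall>a (b::'a). norm (a *\<^sub>C b) \<le> norm a * norm b * K"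
    by (intro exI[of _ 1]) (simp add: norm_scaleC)
qed (simp_all add: scaleC_add_left scaleC_add_right scaleR_scaleC scaleC_scaleC mult.commute
    scaleR_conv_of_real)

interpretation scaleC: bounded_bilinear "scaleC :: complex \<Rightarrow> 'a::complex_inner \<Rightarrow> 'a"
  by (rule bounded_bilinear_scaleC)

lemma scaleC_one: "1 *\<^sub>C x = x" for x :: "'a::complex_inner"
  using scaleR_scaleC[of 1 x] by simp

lemma apply_scaleC [simp]: "blinfun_apply (a *\<^sub>C A) x = a *\<^sub>C A x"
  by (simp add: scaleC_blinfun.rep_eq)

lemma bounded_bilinear_scaleC_blinfun:
  "bounded_bilinear (scaleC :: complex \<Rightarrow> 'a::real_normed_vector \<Rightarrow>\<^sub>L 'b::complex_inner \<Rightarrow> _)"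
proof
  show "\<exists>K. \<forall>a (A::'a \<Rightarrow>\<^sub>L 'b). norm (a *\<^sub>C A) \<le> norm a * norm A * K"
  proof (intro exI[of _ 1] allI norm_blinfun_bound)
    fix a and A :: "'a \<Rightarrow>\<^sub>L 'b" and x
    show "norm (blinfun_apply (a *\<^sub>C A) x) \<le> norm a * norm A * 1 * norm x"
      using mult_left_mono[OF norm_blinfun[of A x], of "cmod a"]
      by (simp add: norm_scaleC mult.assoc)
  qed simp
qed (auto intro!: blinfun_eqI simp: blinfun.add_left blinfun.scaleR_left scaleC_add_left
    scaleC_add_right scaleR_scaleC scaleC_scaleC mult.commute scaleR_conv_of_real)

interpretation scaleC_op: bounded_bilinear
    "scaleC :: complex \<Rightarrow> 'a::real_normed_vector \<Rightarrow>\<^sub>L 'b::complex_inner \<Rightarrow> _"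
  by (rule bounded_bilinear_scaleC_blinfun)

lemma scaleC_op_scaleC: "a *\<^sub>C (b *\<^sub>C A) = (a * b) *\<^sub>C A"
  for A :: "'a::real_normed_vector \<Rightarrow>\<^sub>L 'b::complex_inner"
  by (auto intro!: blinfun_eqI simp: scaleC_scaleC)

lemma scaleC_op_one: "1 *\<^sub>C A = A" for A :: "'a::real_normed_vector \<Rightarrow>\<^sub>L 'b::complex_inner"
  by (auto intro!: blinfun_eqI simp: scaleC_one)

lemma clinear_opD: "clinear_op A \<Longrightarrow> A (a *\<^sub>C x) = a *\<^sub>C A x"
  by (simp add: clinear_op_def)

lemma clinear_op_id [simp]: "clinear_op id_blinfun"
  by (simp add: clinear_op_def)

lemma clinear_op_add: "clinear_op A \<Longrightarrow> clinear_op B \<Longrightarrow> clinear_op (A + B)"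
  by (simp add: clinear_op_def blinfun.add_left scaleC_add_right)

lemma clinear_op_diff: "clinear_op A \<Longrightarrow> clinear_op B \<Longrightarrow> clinear_op (A - B)"
  by (simp add: clinear_op_def blinfun.diff_left scaleC.diff_right)

lemma clinear_op_minus: "clinear_op A \<Longrightarrow> clinear_op (- A)"
  by (simp add: clinear_op_def blinfun.minus_left scaleC.minus_right)

lemma clinear_op_scaleC: "clinear_op A \<Longrightarrow> clinear_op (a *\<^sub>C A)"
  by (simp add: clinear_op_def scaleC_scaleC mult.commute)

lemma clinear_op_compose: "clinear_op A \<Longrightarrow> clinear_op B \<Longrightarrow> clinear_op (A o\<^sub>L B)"
  by (simp add: clinear_op_def)

lemmas clinear_intros = clinear_op_id clinear_op_add clinear_op_diff clinear_op_minus
  clinear_op_scaleC clinear_op_compose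

section \<open>Riesz representation on closed subspaces, and adjoints\<close>

lemma quadratic_nonneg_imp_zero:
  fixes a b :: real
  assumes "\<And>t. 0 \<le> a * t + b * t\<^sup>2" "0 \<le> b"
  shows "a = 0"
proof -
  \<comment> \<open>At \<open>t = - c\<close> the polynomial equals \<open>- c\<^sup>2\<close>; the
    added 1 covers the case \<open>b = 0\<close>.\<close>
  define c where "c = a / (b + 1)"
  have a: "a = c * (b + 1)"
    using assms(2) by (simp add: c_def)
  have "a * - c + b * (- c)\<^sup>2 = - c\<^sup>2"
    by (simp add: a power2_eq_square algebra_simps)
  with assms(1)[of "- c"] have "c\<^sup>2 \<le> 0"
    by linarith
  then show ?thesis
    by (simp add: a)
qed

text \<open>The representing vector minimises \<open>\<parallel>x\<parallel>\<^sup>2/2 - \<phi> x\<close> over \<open>V\<close>.\<close>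

theorem riesz_representation_on:
  fixes \<phi> :: "'a::{real_inner,complete_space} \<Rightarrow> real"
  assumes "closed V" "subspace V" "bounded_linear \<phi>"
  shows "\<exists>y\<in>V. \<forall>x\<in>V. \<phi> x = inner x y"
proof -
  interpret \<phi>: bounded_linear \<phi> by fact
  define J where "J x = (norm x)\<^sup>2 / 2 - \<phi> x" for x
  obtain K where K: "\<And>x. \<bar>\<phi> x\<bar> \<le> norm x * K"
    using \<phi>.bounded by auto
  have low: "- K\<^sup>2 / 2 \<le> J x" for x
  proof -
    have "\<phi> x \<le> norm x * K"
      using K[of x] by linarith
    then show ?thesis
      using sum_squares_bound[of "norm x" K] by (simp add: J_def)
  qed
  define I where "I = Inf (J ` V)"
  have bdd: "bdd_below (J ` V)"
    using low by (auto intro!: bdd_belowI)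
  have V0: "V \<noteq> {}"
    using assms(2) subspace_0 by auto
  have I_le: "I \<le> J x" if "x \<in> V" for x
    unfolding I_def using bdd that by (rule cINF_lower)
  have "\<exists>x\<in>V. J x < I + 1 / real (Suc n)" for n
  proof -
    have "I < I + 1 / real (Suc n)"
      by simp
    then show ?thesis
      unfolding I_def using cINF_less_iff[OF V0 bdd] by blast
  qed
  then obtain X where X: "\<And>n. X n \<in> V" "\<And>n. J (X n) < I + 1 / real (Suc n)"
    by metis
  \<comment> \<open>Parallelogram law: the midpoint lies in \<open>V\<close> and has
    \<open>J\<close> at least \<open>I\<close>, so points with \<open>J\<close> near the infimum are
    close to each other.\<close>
  have para: "(norm (x - y))\<^sup>2 \<le> 4 * (J x + J y - 2 * I)" if "x \<in> V" "y \<in> V" for x y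
  proof -
    have m: "(1/2) *\<^sub>R (x + y) \<in> V"
      using that assms(2) by (simp add: subspace_add subspace_scale)
    have "(norm (x - y))\<^sup>2 = 4 * (J x + J y - 2 * J ((1/2) *\<^sub>R (x + y)))"
      by (simp add: J_def \<phi>.scaleR \<phi>.add power2_norm_eq_inner inner_add inner_diff
          inner_commute field_simps)
    then show ?thesis
      using I_le[OF m] by simp
  qed
  have "Cauchy X"
  proof (rule CauchyI)
    fix e :: real assume "0 < e"
    then obtain N where N: "1 / real (Suc N) < e\<^sup>2 / 8"
      using nat_approx_posE[of "e\<^sup>2 / 8"] by auto
    have "norm (X m - X n) < e" if "m \<ge> N" "n \<ge> N" for m n
    proof -
      have "1 / real (Suc m) \<le> 1 / real (Suc N)" "1 / real (Suc n) \<le> 1 / real (Suc N)"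
        using that by (auto intro!: divide_left_mono)
      then have "J (X m) + J (X n) - 2 * I < e\<^sup>2 / 4"
        using X(2)[of m] X(2)[of n] N by linarith
      then have "(norm (X m - X n))\<^sup>2 < e\<^sup>2"
        using para[OF X(1) X(1), of m n] by argo
      then show ?thesis
        using \<open>0 < e\<close> by (simp add: power_less_imp_less_base)
    qed
    then show "\<exists>M. \<forall>m\<ge>M. \<forall>n\<ge>M. norm (X m - X n) < e"
      by blast
  qed
  then obtain y where y: "X \<longlonglongrightarrow> y"
    by (auto simp: Cauchy_convergent_iff convergent_def)
  then have yV: "y \<in> V"
    using assms(1) X(1) by (meson closed_sequentially)
  have "(\<lambda>n. J (X n)) \<longlonglongrightarrow> J y"
    unfolding J_def using y by (intro tendsto_intros \<phi>.tendsto) auto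
  moreover have "(\<lambda>n. I + 1 / real (Suc n)) \<longlonglongrightarrow> I"
    using tendsto_add[OF tendsto_const[of I] LIMSEQ_inverse_real_of_nat] by (simp add: inverse_eq_divide)
  ultimately have Jy: "J y \<le> I"
    using X(2) by (meson LIMSEQ_le less_imp_le)
  have "\<phi> v = inner v y" if "v \<in> V" for v
  proof -
    have "0 \<le> (inner y v - \<phi> v) * t + (norm v)\<^sup>2 / 2 * t\<^sup>2" for t
    proof -
      have "y + t *\<^sub>R v \<in> V"
        using yV that assms(2) by (simp add: subspace_add subspace_scale)
      then have "J y \<le> J (y + t *\<^sub>R v)"
        using Jy I_le by force
      then show ?thesis
        unfolding J_def power2_norm_eq_inner
        by (simp add: \<phi>.scaleR \<phi>.add inner_add inner_commute power2_eq_square algebra_simps)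
    qed
    from quadratic_nonneg_imp_zero[OF this] show ?thesis
      by (simp add: inner_commute)
  qed
  then show ?thesis
    using yV by blast
qed

lemma cinner_eqI: "(\<And>x. cinner x y = cinner x z) \<Longrightarrow> y = z"
  by (metis cinner.diff_right inner_eq_Re_cinner inner_eq_zero_iff right_minus_eq zero_complex.sel(1))

lemma cadjoint_eqI:
  fixes A :: "'a::chilbert_space \<Rightarrow>\<^sub>L 'b::chilbert_space" and B :: "'b \<Rightarrow>\<^sub>L 'a"
  assumes "\<And>x y. cinner (A x) y = cinner x (B y)"
  shows "cadjoint A = B"
  unfolding cadjoint_def
proof (rule the_equality)
  fix B' assume "\<forall>x y. cinner (A x) y = cinner x (blinfun_apply B' y)"
  then have "B' y = B y" for y
    using assms by (intro cinner_eqI[of "B' y" "B y"]) metis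
  then show "B' = B"
    by (rule blinfun_eqI)
qed (use assms in blast)

text \<open>Riesz is applied to the real inner product, which sees real parts only. Testing at
  \<open>-\<i> *\<^sub>C x\<close> and complex linearity of \<open>A\<close> recover the imaginary
  parts.\<close>

lemma cinner_cadjoint:
  fixes A :: "'a::chilbert_space \<Rightarrow>\<^sub>L 'b::chilbert_space"
  assumes "clinear_op A"
  shows "cinner (A x) y = cinner x (cadjoint A y)"
proof -
  have "\<exists>z\<in>UNIV. \<forall>x\<in>UNIV. inner (A x) y = inner x z" for y
    by (intro riesz_representation_on bounded_linear_compose[OF bounded_linear_inner_left]
        blinfun.bounded_linear_right) auto
  then obtain B where B: "\<And>x y. inner (A x) y = inner x (B y)"
    by (metis UNIV_I)
  have BC: "cinner (A x) y = cinner x (B y)" for x y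
  proof (rule complex_eqI)
    show "Re (cinner (A x) y) = Re (cinner x (B y))"
      using B by (simp add: inner_eq_Re_cinner)
    have "Re (cinner (A (-\<i> *\<^sub>C x)) y) = Re (cinner (-\<i> *\<^sub>C x) (B y))"
      using B by (simp add: inner_eq_Re_cinner)
    then show "Im (cinner (A x) y) = Im (cinner x (B y))"
      using assms by (simp add: clinear_op_def cinner_scaleC_left)
  qed
  have "bounded_linear B"
  proof (rule bounded_linear_intro[where K = "norm A"])
    fix y z and r :: real
    show "B (y + z) = B y + B z"
      by (rule cinner_eqI) (simp add: BC[symmetric] cinner_add_right)
    show "B (r *\<^sub>R y) = r *\<^sub>R B y"
      by (rule cinner_eqI) (simp add: BC[symmetric] cinner_scaleR_right)
    have "(norm (B y))\<^sup>2 = inner (A (B y)) y"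
      by (simp add: B power2_norm_eq_inner)
    also have "\<dots> \<le> norm A * norm (B y) * norm y"
      by (intro order_trans[OF norm_cauchy_schwarz] mult_right_mono norm_blinfun) auto
    finally show "norm (B y) \<le> norm y * norm A"
      by (cases "norm (B y) = 0") (auto simp: power2_eq_square mult_ac)
  qed
  then have app: "blinfun_apply (Blinfun B) = B"
    by (rule bounded_linear_Blinfun_apply)
  then have "cadjoint A = Blinfun B"
    using BC by (intro cadjoint_eqI) simp
  then show ?thesis
    by (simp add: BC app)
qed

section \<open>Inverses and coercive operators\<close>

lemma op_inv_eq:
  assumes "B o\<^sub>L A = id_blinfun" "A o\<^sub>L B = id_blinfun"
  shows "op_inv A = B"
  unfolding op_inv_def
proof (rule the_equality)
  fix B' assume B': "B' o\<^sub>L A = id_blinfun \<and> A o\<^sub>L B' = id_blinfun"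
  have "B' x = B x" for x
    by (metis B' assms(2) blinfun_apply_blinfun_compose id_blinfun.rep_eq)
  then show "B' = B"
    by (rule blinfun_eqI)
qed (use assms in blast)

lemma
  assumes "op_invertible A"
  shows op_inv_left: "op_inv A o\<^sub>L A = id_blinfun"
    and op_inv_right: "A o\<^sub>L op_inv A = id_blinfun"
  using assms unfolding op_invertible_def using op_inv_eq by auto

lemma
  assumes "op_invertible A"
  shows apply_op_inv_left [simp]: "op_inv A (A x) = x"
    and apply_op_inv_right [simp]: "A (op_inv A x) = x"
  using op_inv_left[OF assms] op_inv_right[OF assms]
  by (metis blinfun_apply_blinfun_compose id_blinfun.rep_eq id_apply)+

lemma clinear_op_inv:
  assumes "op_invertible A" "clinear_op A"
  shows "clinear_op (op_inv A)"
  unfolding clinear_op_def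
proof (intro allI)
  fix a x
  have "op_inv A (a *\<^sub>C x) = op_inv A (A (a *\<^sub>C op_inv A x))"
    using assms by (simp add: clinear_opD)
  then show "op_inv A (a *\<^sub>C x) = a *\<^sub>C op_inv A x"
    using assms(1) by simp
qed

text \<open>Banach's fixed point theorem for \<open>x - r *\<^sub>R (A x - y)\<close>: by coercivity
  the squared contraction ratio is at most \<open>1 - 2 r c + r\<^sup>2 N\<^sup>2\<close>, and
  \<open>r = c / N\<^sup>2\<close> minimises it, with value \<open>q\<close>. Since \<open>N\<close>
  dominates both \<open>norm A\<close> and \<open>c\<close>, \<open>q\<close> lies in [0,1).\<close>

lemma coercive_invertible:
  fixes A :: "'a::{real_inner,complete_space} \<Rightarrow>\<^sub>L 'a"
  assumes "0 < c" and coercive: "\<And>x. c * (norm x)\<^sup>2 \<le> inner (A x) x"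
  shows "op_invertible A"
proof -
  define N where "N = norm A + c"
  have N: "0 < N" "c \<le> N" "norm A \<le> N"
    using assms(1) by (auto simp: N_def add_nonneg_pos)
  have lower: "c * norm x \<le> norm (A x)" for x
  proof -
    have "c * norm x * norm x \<le> norm (A x) * norm x"
      using order_trans[OF coercive norm_cauchy_schwarz, of x] by (simp add: power2_eq_square mult.assoc)
    then show ?thesis
      by (cases "norm x = 0") auto
  qed
  define r where "r = c / N\<^sup>2"
  define q where "q = 1 - (c / N)\<^sup>2"
  have q: "0 \<le> q" "q < 1"
    using assms(1) N by (auto simp: q_def abs_square_le_1)
  have "\<exists>x. A x = y" for y
  proof -
    have contr: "dist (x - r *\<^sub>R (A x - y)) (x' - r *\<^sub>R (A x' - y)) \<le> sqrt q * dist x x'" for x x'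
    proof -
      define d where "d = x - x'"
      have "norm (A d) \<le> N * norm d"
        using norm_blinfun[of A d] mult_right_mono[OF N(3), of "norm d"] by simp
      then have "(norm (A d))\<^sup>2 \<le> (N * norm d)\<^sup>2"
        by (rule power_mono) simp
      then have "r\<^sup>2 * (norm (A d))\<^sup>2 \<le> r\<^sup>2 * (N\<^sup>2 * (norm d)\<^sup>2)"
        by (intro mult_left_mono) (auto simp: power_mult_distrib)
      moreover have "2 * r * (c * (norm d)\<^sup>2) \<le> 2 * r * inner (A d) d"
        using assms(1) by (intro mult_left_mono coercive) (auto simp: r_def)
      moreover have "(norm (d - r *\<^sub>R A d))\<^sup>2
          = (norm d)\<^sup>2 - 2 * r * inner (A d) d + r\<^sup>2 * (norm (A d))\<^sup>2"
        unfolding power2_norm_eq_inner by (simp add: inner_diff inner_commute power2_eq_square algebra_simps)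
      ultimately have "(norm (d - r *\<^sub>R A d))\<^sup>2
          \<le> (norm d)\<^sup>2 - 2 * r * (c * (norm d)\<^sup>2) + r\<^sup>2 * (N\<^sup>2 * (norm d)\<^sup>2)"
        by linarith
      also have "\<dots> = q * (norm d)\<^sup>2"
        using N(1) by (simp add: q_def r_def field_simps power2_eq_square)
      also have "\<dots> = (sqrt q * norm d)\<^sup>2"
        using q by (simp add: power_mult_distrib)
      finally have "norm (d - r *\<^sub>R A d) \<le> sqrt q * norm d"
        by (rule power2_le_imp_le) (simp add: q(1))
      moreover have "x - r *\<^sub>R (A x - y) - (x' - r *\<^sub>R (A x' - y)) = d - r *\<^sub>R A d"
        by (simp add: d_def blinfun.diff_right algebra_simps)
      ultimately show ?thesis
        unfolding dist_norm d_def by (simp only:)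
    qed
    have "\<exists>!x. x - r *\<^sub>R (A x - y) = x"
      using q contr by (intro banach_fix_type[where c = "sqrt q"]) auto
    then show ?thesis
      using assms(1) N(1) by (auto simp: r_def)
  qed
  then obtain B where B: "\<And>y. A (B y) = y"
    by metis
  have inj: "x = x'" if "A x = A x'" for x x'
    using lower[of "x - x'"] that assms(1) by (simp add: blinfun.diff_right mult_le_0_iff)
  have "bounded_linear B"
  proof (rule bounded_linear_intro[where K = "1 / c"])
    show "B (x + y) = B x + B y" "B (s *\<^sub>R x) = s *\<^sub>R B x" for x y s
      by (rule inj; simp add: B blinfun.add_right blinfun.scaleR_right)+
    show "norm (B x) \<le> norm x * (1 / c)" for x
      using lower[of "B x"] assms(1) by (simp add: B field_simps)
  qed
  then have "blinfun_apply (Blinfun B) = B"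
    by (rule bounded_linear_Blinfun_apply)
  moreover have "B (A x) = x" for x
    by (rule inj) (simp add: B)
  ultimately show ?thesis
    unfolding op_invertible_def
    by (intro exI[of _ "Blinfun B"]) (auto intro!: blinfun_eqI simp: B)
qed

lemma op_invertible_scaleC:
  fixes A :: "'a::complex_inner \<Rightarrow>\<^sub>L 'a"
  assumes "a \<noteq> 0" "op_invertible (a *\<^sub>C A)"
  shows "op_invertible A"
  unfolding op_invertible_def
proof (intro exI conjI)
  \<comment> \<open>The scalar stands on the right of the inverse because \<open>A\<close> is only
    real linear here.\<close>
  let ?B = "op_inv (a *\<^sub>C A) o\<^sub>L (a *\<^sub>C id_blinfun)"
  show "?B o\<^sub>L A = id_blinfun"
    using apply_op_inv_left[OF assms(2)] by (auto intro!: blinfun_eqI)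
  have "a *\<^sub>C A (op_inv (a *\<^sub>C A) (a *\<^sub>C x)) = a *\<^sub>C x" for x
    using apply_op_inv_right[OF assms(2)] by simp
  then have "(1 / a) *\<^sub>C (a *\<^sub>C A (op_inv (a *\<^sub>C A) (a *\<^sub>C x))) = (1 / a) *\<^sub>C (a *\<^sub>C x)" for x
    by simp
  then show "A o\<^sub>L ?B = id_blinfun"
    using assms(1) by (auto intro!: blinfun_eqI simp: scaleC_scaleC scaleC_one)
qed

text \<open>The form of \<open>A\<close> stays in a half plane away from 0; multiplication by
  \<open>a\<close> rotates it into the right half plane, where real coercivity applies.\<close>

lemma coercive_invertible_complex:
  fixes A :: "'a::chilbert_space \<Rightarrow>\<^sub>L 'a"
  assumes "0 < c" "a \<noteq> 0" "\<And>x. c * (norm x)\<^sup>2 \<le> Re (a * cinner (A x) x)"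
  shows "op_invertible A"
  using assms(2)
  by (rule op_invertible_scaleC)
    (rule coercive_invertible[OF assms(1)],
      use assms(3) in \<open>simp add: inner_eq_Re_cinner cinner_scaleC_left\<close>)

section \<open>Operator-valued holomorphic functions\<close>

lemma tendsto_op_compose:
  "(F \<longlongrightarrow> A) net \<Longrightarrow> (G \<longlongrightarrow> B) net \<Longrightarrow> ((\<lambda>w. F w o\<^sub>L G w) \<longlongrightarrow> A o\<^sub>L B) net"
  for A :: "'b::real_normed_vector \<Rightarrow>\<^sub>L 'c::real_normed_vector" and B :: "'a::real_normed_vector \<Rightarrow>\<^sub>L 'b"
  by (rule bounded_bilinear.tendsto[OF bounded_bilinear_blinfun_compose])

lemma op_holomorphic_tendsto:
  assumes "op_holomorphic_on F S" "z \<in> S"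
  shows "(F \<longlongrightarrow> F z) (at z within S)"
proof -
  obtain D where D: "((\<lambda>w. (1 / (w - z)) *\<^sub>C (F w - F z)) \<longlongrightarrow> D) (at z within S)"
    using assms by (auto simp: op_holomorphic_on_def)
  have "((\<lambda>w. F z + (w - z) *\<^sub>C ((1 / (w - z)) *\<^sub>C (F w - F z))) \<longlongrightarrow> F z + (z - z) *\<^sub>C D) (at z within S)"
    by (intro tendsto_intros scaleC_op.tendsto D)
  moreover have "\<forall>\<^sub>F w in at z within S. F z + (w - z) *\<^sub>C ((1 / (w - z)) *\<^sub>C (F w - F z)) = F w"
    by (auto simp: eventually_at_filter scaleC_op_scaleC scaleC_op_one)
  ultimately have "(F \<longlongrightarrow> F z + (z - z) *\<^sub>C D) (at z within S)"
    by (rule Lim_transform_eventually)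
  then show ?thesis
    by (simp add: scaleC_op.zero_left)
qed

lemma op_holomorphic_cong:
  assumes "op_holomorphic_on F S" "\<And>z. z \<in> S \<Longrightarrow> F z = G z"
  shows "op_holomorphic_on G S"
  unfolding op_holomorphic_on_def
proof
  fix z assume z: "z \<in> S"
  then obtain D where "((\<lambda>w. (1 / (w - z)) *\<^sub>C (F w - F z)) \<longlongrightarrow> D) (at z within S)"
    using assms(1) by (auto simp: op_holomorphic_on_def)
  moreover have "\<forall>\<^sub>F w in at z within S. (1 / (w - z)) *\<^sub>C (F w - F z) = (1 / (w - z)) *\<^sub>C (G w - G z)"
    using assms(2) z by (auto simp: eventually_at_filter)
  ultimately have "((\<lambda>w. (1 / (w - z)) *\<^sub>C (G w - G z)) \<longlongrightarrow> D) (at z within S)"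
    by (rule Lim_transform_eventually)
  then show "\<exists>D. ((\<lambda>w. (1 / (w - z)) *\<^sub>C (G w - G z)) \<longlongrightarrow> D) (at z within S)"
    by blast
qed

lemma op_holomorphic_subset:
  assumes "op_holomorphic_on F S" "T \<subseteq> S"
  shows "op_holomorphic_on F T"
  using assms unfolding op_holomorphic_on_def by (meson subset_iff tendsto_within_subset)

lemma op_holomorphic_scaleC:
  assumes "c holomorphic_on S"
  shows "op_holomorphic_on (\<lambda>z. c z *\<^sub>C A) S"
  unfolding op_holomorphic_on_def
proof
  fix z assume "z \<in> S"
  then obtain d where d: "((\<lambda>w. (c w - c z) / (w - z)) \<longlongrightarrow> d) (at z within S)"
    using assms by (auto simp: holomorphic_on_def field_differentiable_def has_field_derivative_iff)
  have "((\<lambda>w. ((c w - c z) / (w - z)) *\<^sub>C A) \<longlongrightarrow> d *\<^sub>C A) (at z within S)"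
    by (intro scaleC_op.tendsto d tendsto_const)
  moreover have "((c w - c z) / (w - z)) *\<^sub>C A = (1 / (w - z)) *\<^sub>C (c w *\<^sub>C A - c z *\<^sub>C A)" for w
    by (simp add: scaleC_op.diff_left[symmetric] scaleC_op_scaleC)
  ultimately show "\<exists>D. ((\<lambda>w. (1 / (w - z)) *\<^sub>C (c w *\<^sub>C A - c z *\<^sub>C A)) \<longlongrightarrow> D) (at z within S)"
    by auto
qed

lemma op_holomorphic_const: "op_holomorphic_on (\<lambda>z. A) S"
  by (auto simp: op_holomorphic_on_def scaleC_op.zero_right intro!: exI tendsto_const)

lemma op_holomorphic_add:
  assumes "op_holomorphic_on F S" "op_holomorphic_on G S"
  shows "op_holomorphic_on (\<lambda>z. F z + G z) S"
  unfolding op_holomorphic_on_def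
proof
  fix z assume "z \<in> S"
  then obtain D D' where "((\<lambda>w. (1 / (w - z)) *\<^sub>C (F w - F z)) \<longlongrightarrow> D) (at z within S)"
    "((\<lambda>w. (1 / (w - z)) *\<^sub>C (G w - G z)) \<longlongrightarrow> D') (at z within S)"
    using assms by (fastforce simp: op_holomorphic_on_def)
  from tendsto_add[OF this]
  show "\<exists>D. ((\<lambda>w. (1 / (w - z)) *\<^sub>C (F w + G w - (F z + G z))) \<longlongrightarrow> D) (at z within S)"
    by (auto simp: scaleC_op.add_right[symmetric] algebra_simps)
qed

text \<open>Product rule. The elements of the operator type are merely real linear, so complex
  linearity of \<open>F z\<close> is what moves the factor \<open>1 / (w - z)\<close> across
  it.\<close>

lemma op_holomorphic_compose:
  assumes "op_holomorphic_on F S" "op_holomorphic_on G S" "\<And>z. z \<in> S \<Longrightarrow> clinear_op (F z)"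
  shows "op_holomorphic_on (\<lambda>z. F z o\<^sub>L G z) S"
  unfolding op_holomorphic_on_def
proof
  fix z assume z: "z \<in> S"
  then obtain D D' where D: "((\<lambda>w. (1 / (w - z)) *\<^sub>C (F w - F z)) \<longlongrightarrow> D) (at z within S)"
    "((\<lambda>w. (1 / (w - z)) *\<^sub>C (G w - G z)) \<longlongrightarrow> D') (at z within S)"
    using assms by (fastforce simp: op_holomorphic_on_def)
  have "((\<lambda>w. (((1 / (w - z)) *\<^sub>C (F w - F z)) o\<^sub>L G w) + (F z o\<^sub>L ((1 / (w - z)) *\<^sub>C (G w - G z))))
      \<longlongrightarrow> (D o\<^sub>L G z) + (F z o\<^sub>L D')) (at z within S)"
    by (intro tendsto_intros tendsto_op_compose D op_holomorphic_tendsto[OF assms(2)] z)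
  moreover have "(((1 / (w - z)) *\<^sub>C (F w - F z)) o\<^sub>L G w) + (F z o\<^sub>L ((1 / (w - z)) *\<^sub>C (G w - G z)))
      = (1 / (w - z)) *\<^sub>C ((F w o\<^sub>L G w) - (F z o\<^sub>L G z))" for w
    using assms(3)[OF z] unfolding clinear_op_def
    by (auto intro!: blinfun_eqI simp: blinfun.add_left blinfun.diff_left blinfun.diff_right
        scaleC_add_right[symmetric])
  ultimately show "\<exists>D. ((\<lambda>w. (1 / (w - z)) *\<^sub>C ((F w o\<^sub>L G w) - (F z o\<^sub>L G z))) \<longlongrightarrow> D) (at z within S)"
    by auto
qed

lemma op_holomorphic_scaleC_mult:
  assumes "c holomorphic_on S" "op_holomorphic_on F S"
  shows "op_holomorphic_on (\<lambda>z. c z *\<^sub>C F z) S"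
proof -
  have "c z *\<^sub>C F z = (c z *\<^sub>C id_blinfun) o\<^sub>L F z" for z
    by (auto intro!: blinfun_eqI)
  then show ?thesis
    by (intro op_holomorphic_cong[OF op_holomorphic_compose[OF
          op_holomorphic_scaleC[OF assms(1), of id_blinfun] assms(2)]])
      (simp_all add: clinear_op_scaleC)
qed

lemma op_holomorphic_minus:
  assumes "op_holomorphic_on F S"
  shows "op_holomorphic_on (\<lambda>z. - F z) S"
  using op_holomorphic_scaleC_mult[of "\<lambda>_. -1", OF _ assms] scaleC_op.minus_left scaleC_op_one
  by (simp add: scaleC_op.minus_left scaleC_op_one)

lemma op_holomorphic_diff:
  assumes "op_holomorphic_on F S" "op_holomorphic_on G S"
  shows "op_holomorphic_on (\<lambda>z. F z - G z) S"
  using op_holomorphic_add[OF assms(1) op_holomorphic_minus[OF assms(2)]] by simp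

text \<open>The identity \<open>eq\<close> for the difference of inverses is used twice: once
  \<open>norm (A w - A0)\<close> is below \<open>1 / (2 * B)\<close> it bounds the inverses by
  \<open>2 * B\<close>, and with this bound it gives convergence.\<close>

lemma tendsto_op_inv:
  fixes A :: "'b \<Rightarrow> 'a::real_normed_vector \<Rightarrow>\<^sub>L 'a"
  assumes "(A \<longlongrightarrow> A0) net" "op_invertible A0" "\<forall>\<^sub>F w in net. op_invertible (A w)"
  shows "((\<lambda>w. op_inv (A w)) \<longlongrightarrow> op_inv A0) net"
proof -
  define B where "B = norm (op_inv A0) + 1"
  have B: "0 < B" "norm (op_inv A0) \<le> B"
    by (auto simp: B_def add_nonneg_pos)
  have "((\<lambda>w. norm (A w - A0)) \<longlongrightarrow> 0) net"
    using assms(1) by (simp add: LIM_zero_iff tendsto_norm_zero_iff)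
  then have lim: "((\<lambda>w. 2 * B * norm (A w - A0) * B) \<longlongrightarrow> 0) net"
    using tendsto_mult_right_zero tendsto_mult_left_zero by blast
  have "\<forall>\<^sub>F w in net. norm (A w - A0) < 1 / (2 * B)"
    using \<open>((\<lambda>w. norm (A w - A0)) \<longlongrightarrow> 0) net\<close> B by (simp add: order_tendstoD(2))
  then have "\<forall>\<^sub>F w in net. norm (op_inv (A w) - op_inv A0) \<le> 2 * B * norm (A w - A0) * B"
    using assms(3)
  proof eventually_elim
    case (elim w)
    have eq: "op_inv (A w) - op_inv A0 = - (op_inv (A w) o\<^sub>L (A w - A0) o\<^sub>L op_inv A0)"
      using elim assms(2)
      by (auto intro!: blinfun_eqI simp: blinfun.diff_left blinfun.diff_right blinfun.minus_left)
    let ?n = "norm (op_inv (A w))"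
    have le: "norm (op_inv (A w) - op_inv A0) \<le> ?n * norm (A w - A0) * B"
    proof -
      have "norm (op_inv (A w) o\<^sub>L (A w - A0) o\<^sub>L op_inv A0) \<le> ?n * norm (A w - A0) * norm (op_inv A0)"
        by (intro order_trans[OF norm_blinfun_compose] mult_right_mono norm_blinfun_compose) simp
      also have "\<dots> \<le> ?n * norm (A w - A0) * B"
        using B by (intro mult_left_mono) auto
      finally show ?thesis
        by (simp add: eq)
    qed
    also have "\<dots> \<le> ?n * (1 / (2 * B)) * B"
      using elim B by (intro mult_right_mono mult_left_mono) auto
    finally have "norm (op_inv (A w) - op_inv A0) \<le> ?n / 2"
      using B by simp
    moreover have "?n \<le> norm (op_inv (A w) - op_inv A0) + norm (op_inv A0)"
      by (metis diff_add_cancel norm_triangle_ineq)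
    ultimately have "?n \<le> 2 * B"
      using B by linarith
    then have "?n * norm (A w - A0) * B \<le> 2 * B * norm (A w - A0) * B"
      using B by (intro mult_right_mono) auto
    then show ?case
      using le by linarith
  qed
  then have "((\<lambda>w. op_inv (A w) - op_inv A0) \<longlongrightarrow> 0) net"
    by (rule Lim_null_comparison[OF _ lim])
  then show ?thesis
    by (simp add: LIM_zero_iff)
qed

lemma op_holomorphic_inv:
  assumes "op_holomorphic_on A S" "\<And>z. z \<in> S \<Longrightarrow> op_invertible (A z)" "\<And>z. z \<in> S \<Longrightarrow> clinear_op (A z)"
  shows "op_holomorphic_on (\<lambda>z. op_inv (A z)) S"
  unfolding op_holomorphic_on_def
proof
  fix z assume z: "z \<in> S"
  then obtain D where D: "((\<lambda>w. (1 / (w - z)) *\<^sub>C (A w - A z)) \<longlongrightarrow> D) (at z within S)"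
    using assms by (fastforce simp: op_holomorphic_on_def)
  have inS: "\<forall>\<^sub>F w in at z within S. w \<in> S"
    by (simp add: eventually_at_filter)
  have "((\<lambda>w. - (op_inv (A w) o\<^sub>L ((1 / (w - z)) *\<^sub>C (A w - A z)) o\<^sub>L op_inv (A z)))
      \<longlongrightarrow> - (op_inv (A z) o\<^sub>L D o\<^sub>L op_inv (A z))) (at z within S)"
    using inS z assms(2)
    by (intro tendsto_intros tendsto_op_compose D tendsto_op_inv op_holomorphic_tendsto[OF assms(1)])
      (auto elim: eventually_mono)
  moreover have "\<forall>\<^sub>F w in at z within S. - (op_inv (A w) o\<^sub>L ((1 / (w - z)) *\<^sub>C (A w - A z)) o\<^sub>L op_inv (A z))
      = (1 / (w - z)) *\<^sub>C (op_inv (A w) - op_inv (A z))"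
    using inS
  proof eventually_elim
    case (elim w)
    then show ?case
      using assms(2)[OF elim] assms(2)[OF z] clinear_op_inv[OF assms(2,3)[OF elim]]
      by (auto intro!: blinfun_eqI simp: blinfun.diff_left blinfun.diff_right blinfun.minus_left
          clinear_opD scaleC.diff_right)
  qed
  ultimately have "((\<lambda>w. (1 / (w - z)) *\<^sub>C (op_inv (A w) - op_inv (A z)))
      \<longlongrightarrow> - (op_inv (A z) o\<^sub>L D o\<^sub>L op_inv (A z))) (at z within S)"
    by (rule Lim_transform_eventually)
  then show "\<exists>D. ((\<lambda>w. (1 / (w - z)) *\<^sub>C (op_inv (A w) - op_inv (A z))) \<longlongrightarrow> D) (at z within S)"
    by blast
qed

text \<open>The passage to scalars: complex analysis is applied to such matrix elements.\<close>

lemma holomorphic_cinner: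
  assumes "op_holomorphic_on F S"
  shows "(\<lambda>z. cinner (F z f) g) holomorphic_on S"
  unfolding holomorphic_on_def field_differentiable_def has_field_derivative_iff
proof
  fix z assume "z \<in> S"
  then obtain D where D: "((\<lambda>w. (1 / (w - z)) *\<^sub>C (F w - F z)) \<longlongrightarrow> D) (at z within S)"
    using assms by (auto simp: op_holomorphic_on_def)
  have "((\<lambda>w. cinner (((1 / (w - z)) *\<^sub>C (F w - F z)) f) g) \<longlongrightarrow> cinner (D f) g) (at z within S)"
    by (intro cinner.tendsto blinfun.tendsto D tendsto_const)
  then show "\<exists>d. ((\<lambda>w. (cinner (F w f) g - cinner (F z f) g) / (w - z)) \<longlongrightarrow> d) (at z within S)"
    by (auto simp: cinner_scaleC_left blinfun.diff_left cinner.diff_left diff_divide_distrib)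
qed

lemmas op_holomorphic_intros = op_holomorphic_const op_holomorphic_add op_holomorphic_diff
  op_holomorphic_minus op_holomorphic_compose op_holomorphic_scaleC_mult op_holomorphic_inv

section \<open>Holomorphic functions with positive real part\<close>

lemma cmod_diff_less_cmod_add:
  assumes "0 < Re a" "0 < k"
  shows "cmod (a - of_real k) < cmod (a + of_real k)"
proof (rule power_less_imp_less_base)
  show "(cmod (a - of_real k))\<^sup>2 < (cmod (a + of_real k))\<^sup>2"
    using assms unfolding cmod_power2 by (simp add: power2_eq_square algebra_simps)
qed simp

lemma Re_cayley_pos:
  assumes "cmod w < 1"
  shows "0 < Re ((1 + w) / (1 - w))"
proof -
  have "w \<noteq> 1"
    using assms by auto
  have "(cmod w)\<^sup>2 < 1"
    using assms by (simp add: power_less_one_iff)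
  then have "0 < (1 - (cmod w)\<^sup>2) / (cmod (1 - w))\<^sup>2"
    using \<open>w \<noteq> 1\<close> by simp
  also have "\<dots> = Re ((1 + w) / (1 - w))"
    by (simp add: Re_divide cmod_power2) (simp add: power2_eq_square algebra_simps)
  finally show ?thesis .
qed

text \<open>The Schwarz lemma between two Cayley transforms, one centred at \<open>x\<close> and one
  at the positive number \<open>p x\<close>. The denominators are cleared so that the inequality can
  be squared and expanded.\<close>

lemma schwarz_pick_halfplane:
  assumes hol: "p holomorphic_on {z. 0 < Re z}"
    and pos: "\<And>z. 0 < Re z \<Longrightarrow> 0 < Re (p z)"
    and k: "0 < x" "Im (p (of_real x)) = 0" and z: "0 < Re z"
  shows "cmod (p z - p (of_real x)) * cmod (z + of_real x) \<le> cmod (z - of_real x) * cmod (p z + p (of_real x))"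
proof -
  define k where "k = Re (p (of_real x))"
  have k: "p (of_real x) = of_real k" "0 < k"
    using k pos[of "of_real x"] by (auto simp: complex_eq_iff k_def)
  define c where "c w = of_real x * ((1 + w) / (1 - w))" for w :: complex
  define f where "f w = (p (c w) - of_real k) / (p (c w) + of_real k)" for w
  have c: "0 < Re (c w)" if "cmod w < 1" for w
    using Re_cayley_pos[OF that] \<open>0 < x\<close> unfolding c_def times_complex.sel by simp
  have nz: "p (c w) + of_real k \<noteq> 0" if "cmod w < 1" for w
    using pos[OF c[OF that]] k(2) by (auto simp: complex_eq_iff)
  have "c holomorphic_on ball 0 1"
    unfolding c_def[abs_def] by (intro holomorphic_intros) auto
  then have "(p \<circ> c) holomorphic_on ball 0 1"
    by (rule holomorphic_on_compose_gen[OF _ hol]) (use c in auto)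
  then have "f holomorphic_on ball 0 1"
    unfolding f_def[abs_def] using nz by (intro holomorphic_intros) (auto simp: o_def)
  moreover have "f 0 = 0"
    by (simp add: f_def c_def k)
  moreover have "cmod (f w) < 1" if "cmod w < 1" for w
    using cmod_diff_less_cmod_add[OF pos[OF c[OF that]] k(2)] nz[OF that]
    by (simp add: f_def norm_divide)
  moreover define w where "w = (z - of_real x) / (z + of_real x)"
  have w1: "cmod w < 1" and zx: "z + of_real x \<noteq> 0"
    using cmod_diff_less_cmod_add[OF z \<open>0 < x\<close>]
    by (auto simp: w_def norm_divide divide_less_eq_1)
  ultimately have "cmod (f w) \<le> cmod w"
    using Schwarz_Lemma(1) by blast
  moreover have "c w = z"
  proof -
    have "1 + w = 2 * z / (z + of_real x)" "1 - w = 2 * of_real x / (z + of_real x)"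
      using zx by (simp_all add: w_def field_simps)
    then show ?thesis
      using zx \<open>0 < x\<close> by (simp add: c_def)
  qed
  ultimately have "cmod (p z - of_real k) / cmod (p z + of_real k) \<le> cmod (z - of_real x) / cmod (z + of_real x)"
    by (simp add: f_def w_def norm_divide)
  moreover have "0 < cmod (p z + of_real k)" "0 < cmod (z + of_real x)"
    using nz[OF w1] \<open>c w = z\<close> zx by auto
  ultimately show ?thesis
    unfolding k(1) by (simp add: field_simps)
qed

text \<open>The hyperbolic cosine of the distance of \<open>z\<close> and \<open>x\<close> in the
  right half plane is \<open>((cmod z)\<^sup>2 + x\<^sup>2) / (2 * x * Re z)\<close>. So this says
  that \<open>p\<close> does not increase the distance to \<open>x\<close>; it is the square of the
  preceding inequality.\<close>

lemma halfplane_real_point: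
  assumes hol: "p holomorphic_on {z. 0 < Re z}"
    and pos: "\<And>z. 0 < Re z \<Longrightarrow> 0 < Re (p z)"
    and k: "0 < x" "Im (p (of_real x)) = 0" and z: "0 < Re z"
  shows "((cmod (p z))\<^sup>2 + (Re (p (of_real x)))\<^sup>2) * (2 * x * Re z)
      \<le> 2 * Re (p (of_real x)) * Re (p z) * ((cmod z)\<^sup>2 + x\<^sup>2)"
proof -
  define k where "k = Re (p (of_real x))"
  have pk: "p (of_real x) = of_real k"
    using k by (simp add: complex_eq_iff k_def)
  have "(cmod (p z - of_real k) * cmod (z + of_real x))\<^sup>2 \<le> (cmod (z - of_real x) * cmod (p z + of_real k))\<^sup>2"
    using schwarz_pick_halfplane[of p, OF hol _ k z] pos unfolding pk
    by (intro power_mono) auto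
  moreover have "(cmod (a + of_real t))\<^sup>2 = (cmod a)\<^sup>2 + t\<^sup>2 + 2 * t * Re a"
    "(cmod (a - of_real t))\<^sup>2 = (cmod a)\<^sup>2 + t\<^sup>2 - 2 * t * Re a" for a t
    unfolding cmod_power2 by (simp_all add: power2_eq_square algebra_simps)
  ultimately have "((cmod (p z))\<^sup>2 + k\<^sup>2 - 2 * k * Re (p z)) * ((cmod z)\<^sup>2 + x\<^sup>2 + 2 * x * Re z)
      \<le> ((cmod z)\<^sup>2 + x\<^sup>2 - 2 * x * Re z) * ((cmod (p z))\<^sup>2 + k\<^sup>2 + 2 * k * Re (p z))"
    by (simp add: power_mult_distrib)
  then have "2 * (((cmod (p z))\<^sup>2 + k\<^sup>2) * (2 * x * Re z)) \<le> 2 * (2 * k * Re (p z) * ((cmod z)\<^sup>2 + x\<^sup>2))"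
    by (simp add: algebra_simps)
  then show ?thesis
    by (simp add: k_def)
qed

text \<open>
  Hyperbolic distances to the positive axis decrease, and the distance of \<open>z\<close> depends on
  \<open>arg z\<close> only. So \<open>\<bar>arg (p z)\<bar> \<le> \<bar>arg z\<bar>\<close>.
\<close>

lemma halfplane_sector_strict:
  assumes hol: "p holomorphic_on {z. 0 < Re z}"
    and pos: "\<And>z. 0 < Re z \<Longrightarrow> 0 < Re (p z)"
    and real: "\<And>x. 0 < x \<Longrightarrow> Im (p (of_real x)) = 0" and z: "0 < Re z"
  shows "\<bar>Im (p z)\<bar> * Re z \<le> Re (p z) * \<bar>Im z\<bar>"
proof -
  \<comment> \<open>The point of the axis nearest to \<open>z\<close>; the cosh of the distance is
    \<open>cmod z / Re z\<close>, the reciprocal of the cosine of the argument. On the side of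
    \<open>p z\<close> the point \<open>k\<close> need not be nearest, and the inequality of means
    bounds the cosh from below.\<close>
  define r where "r = cmod z"
  define k where "k = Re (p (of_real r))"
  have "z \<noteq> 0"
    using z by auto
  then have r: "0 < r" "0 < k"
    using pos[of "of_real r"] by (simp_all add: r_def k_def)
  have P: "0 < Re (p z)"
    by (rule pos[OF z])
  have "2 * k * cmod (p z) \<le> (cmod (p z))\<^sup>2 + k\<^sup>2"
    using sum_squares_bound[of k "cmod (p z)"] by simp
  then have "2 * k * cmod (p z) * (2 * r * Re z) \<le> ((cmod (p z))\<^sup>2 + k\<^sup>2) * (2 * r * Re z)"
    using r z by (intro mult_right_mono) auto
  also have "\<dots> \<le> 2 * k * Re (p z) * ((cmod z)\<^sup>2 + r\<^sup>2)"
    unfolding k_def using halfplane_real_point[OF hol pos r(1) real[OF r(1)] z] by simp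
  also have "\<dots> = (2 * k * (2 * r)) * (Re (p z) * r)"
    by (simp add: r_def power2_eq_square)
  finally have "(2 * k * (2 * r)) * (cmod (p z) * Re z) \<le> (2 * k * (2 * r)) * (Re (p z) * r)"
    by (simp add: mult_ac)
  then have "cmod (p z) * Re z \<le> Re (p z) * r"
    using r by (simp add: mult_le_cancel_left)
  then have "(cmod (p z) * Re z)\<^sup>2 \<le> (Re (p z) * r)\<^sup>2"
    using z by (intro power_mono) auto
  then have "(\<bar>Im (p z)\<bar> * Re z)\<^sup>2 \<le> (Re (p z) * \<bar>Im z\<bar>)\<^sup>2"
    by (simp add: power_mult_distrib r_def cmod_power2 algebra_simps)
  then show ?thesis
    by (rule power2_le_imp_le) (use P in simp)
qed

context
  fixes p :: "complex \<Rightarrow> complex" and z :: complex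
  assumes hol: "p holomorphic_on {z. 0 < Re z}"
    and nonneg: "\<And>z. 0 < Re z \<Longrightarrow> 0 \<le> Re (p z)"
    and real: "\<And>x. 0 < x \<Longrightarrow> Im (p (of_real x)) = 0"
    and z: "0 < Re z"
begin

text \<open>Adding a small positive constant \<open>d\<close> to \<open>p\<close> makes the real
  part strictly positive; \<open>d\<close> is scaled so that the error is at most
  \<open>e\<close>.\<close>

lemma halfplane_sector: "\<bar>Im (p z)\<bar> * Re z \<le> Re (p z) * \<bar>Im z\<bar>"
proof (rule field_le_epsilon)
  fix e :: real assume "0 < e"
  define d where "d = e / (1 + \<bar>Im z\<bar>)"
  have d: "0 < d" "d * \<bar>Im z\<bar> \<le> e"
    using \<open>0 < e\<close> by (auto simp: d_def field_simps intro: add_pos_nonneg)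
  have "\<bar>Im (p z + of_real d)\<bar> * Re z \<le> Re (p z + of_real d) * \<bar>Im z\<bar>"
    using d(1) nonneg real z
    by (intro halfplane_sector_strict holomorphic_intros hol) (auto simp: add_nonneg_pos)
  then show "\<bar>Im (p z)\<bar> * Re z \<le> Re (p z) * \<bar>Im z\<bar> + e"
    using d(2) by (simp add: algebra_simps)
qed

text \<open>With the base point 1, dropping the square of \<open>cmod (p z)\<close> leaves a common
  factor \<open>k\<close>. After cancelling it the bound is linear in \<open>p\<close>, as
  coercivity requires when \<open>p\<close> is a quadratic form. The constant \<open>d\<close> makes
  \<open>k\<close> positive.\<close>

lemma halfplane_harnack: "Re (p 1) * Re z \<le> Re (p z) * ((cmod z)\<^sup>2 + 1)"
proof (rule field_le_epsilon)
  fix e :: real assume "0 < e"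
  define d where "d = e / ((cmod z)\<^sup>2 + 1)"
  have d: "0 < d" "d * ((cmod z)\<^sup>2 + 1) = e"
    using \<open>0 < e\<close> add_nonneg_pos[of "(cmod z)\<^sup>2" 1] by (auto simp: d_def field_simps)
  define k where "k = Re (p 1) + d"
  have k: "0 < k"
    using nonneg[of 1] d by (simp add: k_def)
  have "((cmod (p z + of_real d))\<^sup>2 + (Re (p (of_real 1) + of_real d))\<^sup>2) * (2 * 1 * Re z)
      \<le> 2 * Re (p (of_real 1) + of_real d) * Re (p z + of_real d) * ((cmod z)\<^sup>2 + 1\<^sup>2)"
    using d(1) nonneg real[of 1] z
    by (intro halfplane_real_point holomorphic_intros hol) (auto simp: add_nonneg_pos)
  moreover have "k\<^sup>2 * (2 * Re z) \<le> ((cmod (p z + of_real d))\<^sup>2 + k\<^sup>2) * (2 * Re z)"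
    using z by (intro mult_right_mono) auto
  ultimately have "(2 * k) * (k * Re z) \<le> (2 * k) * ((Re (p z) + d) * ((cmod z)\<^sup>2 + 1))"
    by (simp add: k_def power2_eq_square mult_ac)
  then have "k * Re z \<le> (Re (p z) + d) * ((cmod z)\<^sup>2 + 1)"
    using k by (simp add: mult_le_cancel_left)
  moreover have "0 \<le> d * Re z"
    using d(1) z by simp
  ultimately show "Re (p 1) * Re z \<le> Re (p z) * ((cmod z)\<^sup>2 + 1) + e"
    using d(2) by (simp add: k_def algebra_simps)
qed

end

text \<open>On \<open>\<bar>v\<bar> = 1\<close> one has \<open>(1 - v\<^sup>2) / v = - 2 \<i> Im v\<close>; the maximum principle gives the rest.\<close>

lemma typically_real_imp_Re_nonneg:
  assumes hol: "n holomorphic_on ball 0 1"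
    and tr: "\<And>u. cmod u < 1 \<Longrightarrow> 0 \<le> Im u * Im (u * n u)" and u: "cmod u < 1"
  shows "0 \<le> Re ((1 - u\<^sup>2) * n u)"
proof -
  \<comment> \<open>Only the argument of \<open>n\<close> is dilated: this gives holomorphy beyond
    the closed disk, while the factor \<open>1 - v\<^sup>2\<close> keeps its boundary
    identity.\<close>
  have *: "0 \<le> Re ((1 - u\<^sup>2) * n (of_real r * u))" if r: "0 < r" "r < 1" for r
  proof -
    have small: "cmod (of_real r * v) < 1" if "cmod v \<le> 1" for v
    proof -
      have "r * cmod v \<le> r * 1"
        using r that by (intro mult_left_mono) auto
      moreover have "cmod (of_real r * v) = r * cmod v"
        using r by (simp add: norm_mult)
      ultimately show ?thesis
        using r(2) by linarith
    qed
    have hol': "(\<lambda>v. - ((1 - v\<^sup>2) * n (of_real r * v))) holomorphic_on ball 0 (1 / r)"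
    proof -
      have "(n \<circ> (\<lambda>v. of_real r * v)) holomorphic_on ball 0 (1 / r)"
        using r by (intro holomorphic_on_compose_gen[OF _ hol] holomorphic_intros)
          (auto simp: norm_mult field_simps)
      then show ?thesis
        by (intro holomorphic_intros) (simp add: o_def)
    qed
    have sub: "cball 0 1 \<subseteq> ball (0::complex) (1 / r)"
      using less_divide_eq_1_pos[OF r(1), of 1] r(2) by auto
    have "Re (- ((1 - u\<^sup>2) * n (of_real r * u))) \<le> 0"
    proof (rule maximum_real_frontier[where S = "ball 0 1" and f = "\<lambda>v. - ((1 - v\<^sup>2) * n (of_real r * v))"])
      show "(\<lambda>v. - ((1 - v\<^sup>2) * n (of_real r * v))) holomorphic_on interior (ball 0 1)"
        using sub by (intro holomorphic_on_subset[OF hol']) auto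
      show "continuous_on (closure (ball 0 1)) (\<lambda>v. - ((1 - v\<^sup>2) * n (of_real r * v)))"
        using sub by (intro continuous_on_subset[OF holomorphic_on_imp_continuous_on[OF hol']]) auto
      show "u \<in> ball 0 1" "bounded (ball (0::complex) 1)"
        using u by auto
      fix v :: complex assume "v \<in> frontier (ball 0 1)"
      then have v: "cmod v = 1"
        by simp
      then have vv: "v * cnj v = 1"
        by (simp add: complex_norm_square[symmetric])
      have "(1 - v\<^sup>2) * cnj v = cnj v - v * (v * cnj v)"
        by (simp add: power2_eq_square algebra_simps)
      then have e: "(1 - v\<^sup>2) * cnj v = - 2 * \<i> * of_real (Im v)"
        by (simp add: vv complex_eq_iff)
      \<comment> \<open>The value at \<open>u = r v\<close> of the typically real function
        \<open>u * n u\<close>, so \<open>Im v * Im K\<close> is nonnegative; on the unit circle the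
        real part in question is \<open>2 * Im v * Im K / r\<close>.\<close>
      define K where "K = of_real r * v * n (of_real r * v)"
      have "of_real r * ((1 - v\<^sup>2) * n (of_real r * v)) = (v * cnj v) * (of_real r * ((1 - v\<^sup>2) * n (of_real r * v)))"
        by (simp add: vv)
      also have "\<dots> = ((1 - v\<^sup>2) * cnj v) * K"
        by (simp add: K_def mult_ac)
      also have "\<dots> = - 2 * \<i> * of_real (Im v) * K"
        by (simp only: e)
      finally have "Re (of_real r * ((1 - v\<^sup>2) * n (of_real r * v))) = Re (- 2 * \<i> * of_real (Im v) * K)"
        by (rule arg_cong)
      then have "r * Re ((1 - v\<^sup>2) * n (of_real r * v)) = 2 * (Im v * Im K)"
        unfolding times_complex.sel(1)[of "of_real r"] by simp
      moreover have "0 \<le> Im (of_real r * v) * Im K"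
        unfolding K_def using tr[OF small] v by simp
      then have "0 \<le> r * (Im v * Im K)"
        by (simp add: mult.assoc)
      then have "0 \<le> Im v * Im K"
        using r by (metis mult_zero_right mult_le_cancel_left_pos)
      ultimately have "r * 0 \<le> r * Re ((1 - v\<^sup>2) * n (of_real r * v))"
        by linarith
      then have "0 \<le> Re ((1 - v\<^sup>2) * n (of_real r * v))"
        by (rule mult_left_le_imp_le) (rule r(1))
      then show "Re (- ((1 - v\<^sup>2) * n (of_real r * v))) \<le> 0"
        by simp
    qed
    then show ?thesis
      by simp
  qed
  have "isCont n u"
    using holomorphic_on_imp_continuous_on[OF hol] u by (simp add: continuous_on_eq_continuous_at)
  then have "((\<lambda>r. n (of_real r * u)) \<longlongrightarrow> n u) (at_left 1)"
    by (rule isCont_tendsto_compose) (auto intro!: tendsto_eq_intros)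
  then have "((\<lambda>r. Re ((1 - u\<^sup>2) * n (of_real r * u))) \<longlongrightarrow> Re ((1 - u\<^sup>2) * n u)) (at_left 1)"
    by (intro tendsto_intros)
  moreover have "\<forall>\<^sub>F r in at_left 1. 0 \<le> Re ((1 - u\<^sup>2) * n (of_real r * u))"
    using * eventually_at_left_real[of 0 "1::real"] by (auto elim!: eventually_mono)
  ultimately show ?thesis
    by (rule tendsto_lowerbound) simp
qed

section \<open>The two slit domains, and the sector bound on \<E>\<close>

lemma slit_plane_iff: "z \<in> \<E> \<longleftrightarrow> Im z \<noteq> 0 \<or> (-1 < Re z \<and> Re z < 1)"
  by (auto simp: slit_plane_def image_iff complex_eq_iff not_le)

lemma cut_plane_iff: "z \<in> cut_plane \<longleftrightarrow> Im z \<noteq> 0 \<or> Re z < -1 \<or> 1 < Re z"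
  by (auto simp: cut_plane_def image_iff complex_eq_iff not_le)

lemma Re_sq_plus_one_nz: "0 < Re z \<Longrightarrow> z\<^sup>2 + 1 \<noteq> 0"
proof
  assume "0 < Re z" "z\<^sup>2 + 1 = 0"
  then have "Im (z\<^sup>2 + 1) = 0" "Re (z\<^sup>2 + 1) = 0"
    by simp_all
  then have "Re z * Im z = 0" "(Re z)\<^sup>2 - (Im z)\<^sup>2 + 1 = 0"
    by (auto simp: power2_eq_square)
  then have "(Re z)\<^sup>2 + 1 = 0"
    using \<open>0 < Re z\<close> by simp
  then show False
    using zero_le_power2[of "Re z"] by linarith
qed

text \<open>This map inverts \<open>v\<^sup>2 = (1 + z) / (1 - z)\<close>: for
  \<open>Re v > 0\<close> the square avoids the nonpositive axis, which corresponds to the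
  complement of \<E>.\<close>

lemma slit_halfplane:
  assumes "0 < Re z"
  shows "(z\<^sup>2 - 1) / (z\<^sup>2 + 1) \<in> \<E>"
proof (rule ccontr)
  assume "(z\<^sup>2 - 1) / (z\<^sup>2 + 1) \<notin> \<E>"
  then obtain t :: real where t: "(z\<^sup>2 - 1) / (z\<^sup>2 + 1) = of_real t" "t \<le> -1 \<or> 1 \<le> t"
    by (auto simp: slit_plane_def)
  then have "z\<^sup>2 - 1 = of_real t * (z\<^sup>2 + 1)"
    using Re_sq_plus_one_nz[OF assms] by (simp add: field_simps)
  then have w: "z\<^sup>2 * of_real (1 - t) = of_real (1 + t)"
    by (simp add: algebra_simps)
  then have "Im (z\<^sup>2) * (1 - t) = 0" "Re (z\<^sup>2) * (1 - t) = 1 + t"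
    by (auto dest: arg_cong[of _ _ Im] arg_cong[of _ _ Re])
  moreover from this have "t \<noteq> 1"
    by auto
  ultimately have "Im (z\<^sup>2) = 0" "Re (z\<^sup>2) = (1 + t) / (1 - t)"
    by (simp_all add: field_simps)
  moreover have "(1 + t) / (1 - t) \<le> 0"
    using t(2) by (auto simp: divide_le_0_iff)
  ultimately have "Re z * Im z = 0" "Re z * Re z - Im z * Im z \<le> 0"
    by (auto simp: power2_eq_square)
  then show False
    using assms by (auto simp: mult_le_0_iff)
qed

text \<open>Put \<open>v\<^sup>2 = (1 + z) / (1 - z)\<close>. The strict signs keep \<open>F\<close>
  off the nonpositive axis, so its principal root is a holomorphic function of \<open>v\<close> with
  nonnegative real part, and the sector bound compares the arguments of the root and of
  \<open>v\<close>. Doubling them gives arg F \<le> arg ((1 + z) / (1 - z)), which is the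
  conclusion.\<close>

theorem stieltjes_quotient:
  assumes hol: "F holomorphic_on \<E>"
    and upper: "\<And>z. 0 < Im z \<Longrightarrow> 0 < Im (F z)" and lower: "\<And>z. Im z < 0 \<Longrightarrow> Im (F z) < 0"
    and real: "\<And>x. -1 < x \<Longrightarrow> x < 1 \<Longrightarrow> Im (F (of_real x)) = 0 \<and> 0 < Re (F (of_real x))"
    and z: "0 < Im z"
  shows "Im (F z * cnj ((1 + z) / (1 - z))) \<le> 0"
proof -
  define g where "g v = (v\<^sup>2 - 1) / (v\<^sup>2 + 1)" for v :: complex
  have nonpos: "F w \<notin> \<real>\<^sub>\<le>\<^sub>0" if "w \<in> \<E>" for w
  proof (cases "Im w = 0")
    case True
    then have "w = of_real (Re w)"
      by (simp add: complex_eq_iff)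
    then show ?thesis
      using that True real[of "Re w"] by (auto simp: slit_plane_iff complex_nonpos_Reals_iff)
  next
    case False
    then show ?thesis
      using upper[of w] lower[of w] by (auto simp: complex_nonpos_Reals_iff neq_iff)
  qed
  define p where "p v = csqrt (F (g v))" for v
  have "g holomorphic_on {v. 0 < Re v}"
    unfolding g_def[abs_def] using Re_sq_plus_one_nz by (intro holomorphic_intros) auto
  then have "(F \<circ> g) holomorphic_on {v. 0 < Re v}"
    by (rule holomorphic_on_compose_gen[OF _ hol]) (auto simp: g_def slit_halfplane)
  then have hp: "p holomorphic_on {v. 0 < Re v}"
    unfolding p_def[abs_def] using nonpos slit_halfplane
    by (intro holomorphic_on_csqrt' holomorphic_intros) (auto simp: g_def o_def)
  have Re_csqrt: "0 \<le> Re (csqrt c)" for c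
    using csqrt_principal[of c] by auto
  have Rep: "0 \<le> Re (p v)" for v
    unfolding p_def by (rule Re_csqrt)
  have realp: "Im (p (of_real x)) = 0" if "0 < x" for x
  proof -
    have "g (of_real x) = of_real ((x\<^sup>2 - 1) / (x\<^sup>2 + 1))"
      by (simp add: g_def)
    moreover have "-1 < (x\<^sup>2 - 1) / (x\<^sup>2 + 1)" "(x\<^sup>2 - 1) / (x\<^sup>2 + 1) < 1"
      using that by (auto simp: field_simps add_pos_nonneg)
    moreover define y where "y = (x\<^sup>2 - 1) / (x\<^sup>2 + 1)"
    ultimately have y: "g (of_real x) = of_real y" "Im (F (of_real y)) = 0" "0 < Re (F (of_real y))"
      using real[of y] by auto
    then have "F (of_real y) = of_real (Re (F (of_real y)))"
      by (simp add: complex_eq_iff)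
    then have "p (of_real x) = of_real (sqrt (Re (F (of_real y))))"
      using y by (metis csqrt_of_real_nonneg less_imp_le p_def)
    then show ?thesis
      by simp
  qed
  define W where "W = (1 + z) / (1 - z)"
  have z1: "z \<noteq> 1" "z \<noteq> - 1"
    using z by auto
  have "0 < Im z * 2 / (cmod (1 - z))\<^sup>2"
    using z z1 by simp
  also have "\<dots> = Im W"
    unfolding W_def by (simp add: Im_divide cmod_power2) (simp add: power2_eq_square algebra_simps)
  finally have ImW: "0 < Im W" .
  define v where "v = csqrt W"
  have v: "v\<^sup>2 = W" "0 \<le> Re v"
    by (simp_all only: v_def power2_csqrt Re_csqrt)
  have "0 < 2 * Re v * Im v"
    using ImW unfolding v(1)[symmetric] by (simp add: power2_eq_square)
  then have vpos: "0 < Re v" "0 < Im v"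
    using v(2) by (auto simp: zero_less_mult_iff)
  have gv: "g v = z"
  proof -
    have "W - 1 = 2 * z / (1 - z)" "W + 1 = 2 / (1 - z)"
      using z1 by (simp_all add: W_def field_simps)
    then show ?thesis
      using z1 by (simp add: g_def v)
  qed
  have pF: "(p v)\<^sup>2 = F z"
    by (simp add: p_def gv)
  have "0 < 2 * Re (p v) * Im (p v)"
    using upper[OF z] unfolding pF[symmetric] by (simp add: power2_eq_square)
  then have ppos: "0 < Re (p v)" "0 < Im (p v)"
    using Rep[of v] by (auto simp: zero_less_mult_iff)
  have "Im (p v) * Re v \<le> Re (p v) * Im v"
    using halfplane_sector[OF hp Rep realp vpos(1)] vpos(2) ppos(2) by simp
  \<comment> \<open>The two factors are the real and imaginary part of \<open>p v * cnj v\<close>,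
    and \<open>Im (c\<^sup>2) = 2 * Re c * Im c\<close>.\<close>
  then have "(Re (p v) * Re v + Im (p v) * Im v) * (Im (p v) * Re v - Re (p v) * Im v) \<le> 0"
    using vpos ppos by (intro mult_nonneg_nonpos) auto
  moreover have "Im ((p v)\<^sup>2 * cnj (v\<^sup>2))
      = 2 * ((Re (p v) * Re v + Im (p v) * Im v) * (Im (p v) * Re v - Re (p v) * Im v))"
    by (simp add: power2_eq_square algebra_simps)
  ultimately have "Im ((p v)\<^sup>2 * cnj (v\<^sup>2)) \<le> 0"
    by linarith
  then show ?thesis
    unfolding pF v W_def .
qed

section \<open>The class RS\<close>

lemma cinner_op_Im:
  assumes "clinear_op A"
  shows "cinner (op_Im A x) x = of_real (Im (cinner (A x) x))"
proof -
  have "cinner (cadjoint A x) x = cnj (cinner (A x) x)"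
    by (metis assms cinner_cadjoint cinner_commute)
  then show ?thesis
    by (simp add: op_Im_def blinfun.diff_left cinner_scaleC_left cinner.diff_left complex_eq_iff
        Re_divide Im_divide)
qed

lemma positive_op_Im_iff:
  assumes "clinear_op A"
  shows "positive_op (r *\<^sub>R op_Im A) \<longleftrightarrow> (\<forall>x. 0 \<le> r * Im (cinner (A x) x))"
  by (simp add: positive_op_def blinfun.scaleR_left cinner_scaleR_left cinner_op_Im[OF assms]
      complex_nonneg_Reals_iff)

text \<open>Positivity is demanded in the upper half plane only: the adjoint relation conjugates the
  form when \<open>z\<close> is conjugated, which yields the lower one.\<close>

lemma nevanlinna_iff:
  "nevanlinna M \<longleftrightarrow> op_holomorphic_on M (- \<real>) \<and> (\<forall>z. Im z \<noteq> 0 \<longrightarrow> clinear_op (M z)) \<and>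
    (\<forall>z f g. Im z \<noteq> 0 \<longrightarrow> cinner (M z f) g = cinner f (M (cnj z) g)) \<and>
    (\<forall>z f. 0 < Im z \<longrightarrow> 0 \<le> Im (cinner (M z f) f))" (is "_ \<longleftrightarrow> ?R")
proof
  assume M: "nevanlinna M"
  have "clinear_op (M z)" "cadjoint (M z) = M (cnj z)" "positive_op (Im z *\<^sub>R op_Im (M z))" if "Im z \<noteq> 0" for z
    using M that by (auto simp: nevanlinna_def complex_is_Real_iff)
  note * = this
  have "0 \<le> Im (cinner (M z f) f)" if "0 < Im z" for z f
    using *(1,3)[of z] that positive_op_Im_iff[of "M z" "Im z"] by (auto simp: zero_le_mult_iff)
  moreover have "cinner (M z f) g = cinner f (M (cnj z) g)" if "Im z \<noteq> 0" for z f g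
    using *[OF that] cinner_cadjoint by metis
  ultimately show ?R
    using M * by (auto simp: nevanlinna_def)
next
  assume R: ?R
  have "clinear_op (M z)" "cadjoint (M z) = M (cnj z)" "positive_op (Im z *\<^sub>R op_Im (M z))" if z: "Im z \<noteq> 0" for z
  proof -
    show cl: "clinear_op (M z)" and "cadjoint (M z) = M (cnj z)"
      using R z by (auto intro!: cadjoint_eqI)
    have "0 \<le> Im z * Im (cinner (M z f) f)" for f
    proof (cases "0 < Im z")
      case False
      have "cinner (M z f) f = cnj (cinner (M (cnj z) f) f)"
        using R z by (metis cinner_commute)
      moreover have "0 < Im (cnj z)"
        using z False by simp
      then have "0 \<le> Im (cinner (M (cnj z) f) f)"
        using R by blast
      ultimately show ?thesis
        using False by (simp add: mult_nonpos_nonneg)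
    next
      case True
      then have "0 \<le> Im (cinner (M z f) f)"
        using R by blast
      then show ?thesis
        using True by simp
    qed
    then show "positive_op (Im z *\<^sub>R op_Im (M z))"
      by (simp add: positive_op_Im_iff[OF cl])
  qed
  then show "nevanlinna M"
    using R by (auto simp: nevanlinna_def complex_is_Real_iff)
qed

text \<open>Polarisation: the sesquilinear defect \<open>D\<close> vanishes on the diagonal, hence
  is antisymmetric; replacing \<open>y\<close> by \<open>\<i> *\<^sub>C y\<close> makes it symmetric
  as well.\<close>

lemma real_form_selfadjoint:
  fixes A :: "'a::chilbert_space \<Rightarrow>\<^sub>L 'a"
  assumes "clinear_op A" "\<And>x. Im (cinner (A x) x) = 0"
  shows "cinner (A x) y = cinner x (A y)"
proof -
  define D where "D x y = cinner (A x) y - cinner x (A y)" for x y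
  have D0: "D x x = 0" for x
    unfolding D_def using assms(2)[of x] cinner_commute[of x "A x"] by (simp add: complex_eq_iff)
  have sym: "D x y + D y x = 0" for x y
    using D0[of "x + y"] D0[of x] D0[of y]
    by (simp add: D_def blinfun.add_right cinner_add_left cinner_add_right algebra_simps)
  have "D x (\<i> *\<^sub>C y) = - \<i> * D x y" "D (\<i> *\<^sub>C y) x = \<i> * D y x"
    using assms(1) by (simp_all add: D_def clinear_opD cinner_scaleC_left cinner_scaleC_right algebra_simps)
  then have "D x y = D y x"
    using sym[of x "\<i> *\<^sub>C y"] by (simp add: complex_eq_iff)
  then show ?thesis
    using sym[of x y] by (simp add: D_def)
qed

lemma op_le_iff:
  "op_le A B \<longleftrightarrow> (\<forall>x. Im (cinner (A x) x) = Im (cinner (B x) x) \<and> Re (cinner (A x) x) \<le> Re (cinner (B x) x))"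
  by (auto simp: op_le_def positive_op_def blinfun.diff_left cinner.diff_left complex_nonneg_Reals_iff)

text \<open>The norm bound comes from \<open>2 (1 - A\<^sup>2) = (1 - A) (1 + A) (1 - A) + (1 + A) (1 - A) (1 + A)\<close>.\<close>

lemma contraction_iff_op_le:
  fixes A :: "'a::chilbert_space \<Rightarrow>\<^sub>L 'a"
  assumes "clinear_op A"
  shows "op_le (- id_blinfun) A \<and> op_le A id_blinfun \<longleftrightarrow>
    (\<forall>x y. cinner (A x) y = cinner x (A y)) \<and> (\<forall>x. norm (A x) \<le> norm x)"
proof
  assume le: "op_le (- id_blinfun) A \<and> op_le A id_blinfun"
  have re: "- (norm x)\<^sup>2 \<le> inner (A x) x" "inner (A x) x \<le> (norm x)\<^sup>2" and im: "Im (cinner (A x) x) = 0" for x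
    using le by (auto simp: op_le_iff blinfun.minus_left cinner.minus_left cinner_self inner_eq_Re_cinner
        simp flip: of_real_power)
  have sym: "cinner (A x) y = cinner x (A y)" for x y
    by (rule real_form_selfadjoint[OF assms im])
  have "norm (A x) \<le> norm x" for x
  proof (rule power2_le_imp_le)
    have s: "inner (A x) y = inner x (A y)" for x y
      using sym by (simp add: inner_eq_Re_cinner)
    show "(norm (A x))\<^sup>2 \<le> (norm x)\<^sup>2"
      using re(1)[of "x - A x"] re(2)[of "x + A x"] s[of "A x" x] s[of "A x" "A x"]
      unfolding power2_norm_eq_inner
      by (simp add: blinfun.diff_right blinfun.add_right inner_add inner_diff inner_commute)
  qed simp
  with sym show "(\<forall>x y. cinner (A x) y = cinner x (A y)) \<and> (\<forall>x. norm (A x) \<le> norm x)"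
    by blast
next
  assume *: "(\<forall>x y. cinner (A x) y = cinner x (A y)) \<and> (\<forall>x. norm (A x) \<le> norm x)"
  have im: "Im (cinner (A x) x) = 0" for x
  proof -
    have "cinner (A x) x = cnj (cinner (A x) x)"
      using * by (metis cinner_commute)
    then show ?thesis
      by (metis Reals_cnj_iff complex_is_Real_iff)
  qed
  have "\<bar>Re (cinner (A x) x)\<bar> \<le> (norm x)\<^sup>2" for x
  proof -
    have "\<bar>inner (A x) x\<bar> \<le> norm x * norm x"
      using * by (intro order_trans[OF Cauchy_Schwarz_ineq2] mult_right_mono) auto
    then show ?thesis
      by (simp add: inner_eq_Re_cinner power2_eq_square)
  qed
  then have "- (norm x)\<^sup>2 \<le> Re (cinner (A x) x)" "Re (cinner (A x) x) \<le> (norm x)\<^sup>2" for x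
    by (auto simp: abs_le_iff minus_le_iff)
  then show "op_le (- id_blinfun) A \<and> op_le A id_blinfun"
    using im by (auto simp: op_le_iff blinfun.minus_left cinner.minus_left cinner_self simp flip: of_real_power)
qed

lemma cnj_slit_iff: "cnj z \<in> \<E> \<longleftrightarrow> z \<in> \<E>"
  by (simp add: slit_plane_iff)

text \<open>On (-1,1) the order bounds contain selfadjointness, so real and nonreal points share one
  adjoint relation on \<E>, and what remains of the bounds is contractivity.\<close>

lemma RS_iff:
  "\<Omega> \<in> RS \<longleftrightarrow> \<Omega> \<in> extensional \<E> \<and> (\<forall>z\<in>\<E>. clinear_op (\<Omega> z)) \<and> op_holomorphic_on \<Omega> \<E> \<and>
    (\<forall>z\<in>\<E>. \<forall>f g. cinner (\<Omega> z f) g = cinner f (\<Omega> (cnj z) g)) \<and>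
    (\<forall>z f. 0 < Im z \<longrightarrow> 0 \<le> Im (cinner (\<Omega> z f) f)) \<and>
    (\<forall>x\<in>{-1<..<1}. \<forall>f. norm (\<Omega> (of_real x) f) \<le> norm f)" (is "_ \<longleftrightarrow> ?R")
proof -
  have E: "of_real x \<in> \<E>" if "x \<in> {-1<..<1}" for x
    using that by (simp add: slit_plane_iff)
  have real: "z = of_real (Re z) \<and> Re z \<in> {-1<..<1}" if "z \<in> \<E>" "Im z = 0" for z
    using that by (simp add: slit_plane_iff complex_eq_iff)
  have sub: "- \<real> \<subseteq> \<E>"
    by (auto simp: slit_plane_iff complex_is_Real_iff)
  show ?thesis
  proof
    assume RS: "\<Omega> \<in> RS"
    then have cl: "\<forall>z\<in>\<E>. clinear_op (\<Omega> z)" and N: "nevanlinna \<Omega>"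
      by (auto simp: RS_def)
    have c: "(\<forall>f g. cinner (\<Omega> (of_real x) f) g = cinner f (\<Omega> (of_real x) g)) \<and>
        (\<forall>f. norm (\<Omega> (of_real x) f) \<le> norm f)" if "x \<in> {-1<..<1}" for x
      using RS contraction_iff_op_le[OF cl[rule_format, OF E[OF that]]] that by (auto simp: RS_def)
    have "cinner (\<Omega> z f) g = cinner f (\<Omega> (cnj z) g)" if "z \<in> \<E>" for z f g
    proof (cases "Im z = 0")
      case True
      then show ?thesis
        using c real[OF that True] by (metis complex_cnj_complex_of_real)
    qed (use N in \<open>simp add: nevanlinna_iff\<close>)
    then show ?R
      using RS N c by (auto simp: RS_def nevanlinna_iff)
  next
    assume R: ?R
    have "nevanlinna \<Omega>"
      unfolding nevanlinna_iff using R op_holomorphic_subset[OF _ sub] by (auto simp: slit_plane_iff)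
    moreover have "op_le (- id_blinfun) (\<Omega> (of_real x)) \<and> op_le (\<Omega> (of_real x)) id_blinfun"
      if x: "x \<in> {-1<..<1}" for x
    proof -
      have "\<forall>f g. cinner (\<Omega> (of_real x) f) g = cinner f (\<Omega> (of_real x) g)"
        using R E[OF x] by (metis complex_cnj_complex_of_real)
      then show ?thesis
        using R x E[OF x] by (subst contraction_iff_op_le) auto
    qed
    ultimately show "\<Omega> \<in> RS"
      using R by (auto simp: RS_def)
  qed
qed

section \<open>Invertible shifts, and the action of \<open>Phi\<close> on the class\<close>

lemma contraction_shift_invertible:
  fixes A :: "'a::chilbert_space \<Rightarrow>\<^sub>L 'a"
  assumes "\<And>x. norm (A x) \<le> q * norm x" "q < Re c"
  shows "op_invertible (c *\<^sub>C id_blinfun - A)"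
proof (rule coercive_invertible)
  show "0 < Re c - q"
    using assms(2) by simp
  fix x
  have "inner (A x) x \<le> norm (A x) * norm x"
    by (rule norm_cauchy_schwarz)
  also have "\<dots> \<le> q * norm x * norm x"
    by (intro mult_right_mono assms) simp
  finally show "(Re c - q) * (norm x)\<^sup>2 \<le> inner ((c *\<^sub>C id_blinfun - A) x) x"
    by (simp add: blinfun.diff_left inner_diff_left inner_eq_Re_cinner[of "c *\<^sub>C x"] cinner_scaleC_left
        cinner_self power2_eq_square algebra_simps)
qed

text \<open>Since Re (\<i> y w) = - y Im w, the factor \<open>\<i> * y\<close> turns a sign of
  imaginary parts into coercivity. Taking for \<open>y\<close> the imaginary part of the spectral
  variable, up to sign, treats both half planes at once.\<close>

lemma Im_shift_invertible:
  fixes A :: "'a::chilbert_space \<Rightarrow>\<^sub>L 'a"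
  assumes "\<And>x. 0 \<le> y * Im (cinner (A x) x)" "y * Im c < 0"
  shows "op_invertible (c *\<^sub>C id_blinfun - A)"
proof (rule coercive_invertible_complex)
  show "0 < - (y * Im c)" "of_real y * \<i> \<noteq> 0"
    using assms(2) by auto
  fix x
  show "- (y * Im c) * (norm x)\<^sup>2 \<le> Re (of_real y * \<i> * cinner ((c *\<^sub>C id_blinfun - A) x) x)"
    using assms(1)[of x]
    by (simp add: blinfun.diff_left cinner.diff_left cinner_scaleC_left cinner_self algebra_simps
        flip: of_real_power)
qed

lemma op_invertible_zdiff:
  fixes A :: "'a::chilbert_space \<Rightarrow>\<^sub>L 'a"
  assumes "z \<noteq> 0" "op_invertible ((c / z) *\<^sub>C id_blinfun - A)"
  shows "op_invertible (c *\<^sub>C id_blinfun - z *\<^sub>C A)"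
proof (rule op_invertible_scaleC[of "1 / z"])
  have "(1 / z) *\<^sub>C (c *\<^sub>C id_blinfun - z *\<^sub>C A) = (c / z) *\<^sub>C id_blinfun - A"
    using assms(1) by (simp add: scaleC_op.diff_right scaleC_op_scaleC scaleC_op_one)
  then show "op_invertible ((1 / z) *\<^sub>C (c *\<^sub>C id_blinfun - z *\<^sub>C A))"
    using assms(2) by simp
qed (use assms in simp)

context
  fixes \<Omega> :: "complex \<Rightarrow> 'a::chilbert_space \<Rightarrow>\<^sub>L 'a"
  assumes RS: "\<Omega> \<in> RS"
begin

lemma
  shows RS_extensional: "\<Omega> \<in> extensional \<E>"
    and RS_clinear: "z \<in> \<E> \<Longrightarrow> clinear_op (\<Omega> z)"
    and RS_holomorphic: "op_holomorphic_on \<Omega> \<E>"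
    and RS_adjoint: "z \<in> \<E> \<Longrightarrow> cinner (\<Omega> z f) g = cinner f (\<Omega> (cnj z) g)"
    and RS_Im: "0 < Im z \<Longrightarrow> 0 \<le> Im (cinner (\<Omega> z f) f)"
    and RS_norm: "-1 < x \<Longrightarrow> x < 1 \<Longrightarrow> norm (\<Omega> (of_real x) f) \<le> norm f"
  using RS unfolding RS_iff by auto

lemma RS_Im_mult: "z \<in> \<E> \<Longrightarrow> 0 \<le> Im z * Im (cinner (\<Omega> z f) f)"
proof (cases "0 < Im z")
  case False
  assume z: "z \<in> \<E>"
  have "cinner (\<Omega> z f) f = cnj (cinner (\<Omega> (cnj z) f) f)"
    using RS_adjoint[OF z] by (metis cinner_commute)
  then show ?thesis
    using RS_Im[of "cnj z" f] False by (cases "Im z = 0") (auto simp: mult_nonpos_nonneg)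
qed (simp add: RS_Im)

lemma RS_real_Im: "-1 < x \<Longrightarrow> x < 1 \<Longrightarrow> Im (cinner (\<Omega> (of_real x) f) f) = 0"
  using RS_adjoint[of "of_real x" f f] cinner_commute[of "\<Omega> (of_real x) f" f]
  by (simp add: slit_plane_iff complex_eq_iff)

text \<open>Used with \<open>c = 1\<close> for the resolvent in \<open>Phi\<close> and with
  \<open>c = 1 + sqrt_slit z\<close> for the uniqueness of the fixed point. Off the axis, division
  by \<open>z\<close> leaves \<open>c / z - \<Omega> z\<close>, with imaginary parts of opposite
  signs; on it, \<Omega> is a contraction.\<close>

lemma RS_shift_invertible:
  assumes z: "z \<in> \<E>" and "Im z \<noteq> 0 \<Longrightarrow> Im z * Im (c / z) < 0" "Im z = 0 \<Longrightarrow> cmod z < Re c"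
  shows "op_invertible (c *\<^sub>C id_blinfun - z *\<^sub>C \<Omega> z)"
proof (cases "Im z = 0")
  case True
  then have z': "z = of_real (Re z)" "-1 < Re z" "Re z < 1"
    using z by (auto simp: slit_plane_iff complex_eq_iff)
  show ?thesis
  proof (rule contraction_shift_invertible)
    show "norm ((z *\<^sub>C \<Omega> z) x) \<le> cmod z * norm x" for x
      using RS_norm[OF z'(2,3), of x] z'(1) by (auto simp: norm_scaleC intro!: mult_left_mono)
  qed (use assms True in simp)
next
  case False
  then show ?thesis
    by (intro op_invertible_zdiff Im_shift_invertible[of "Im z"] RS_Im_mult[OF z] assms(2)) auto
qed

lemma RS_resolvent_invertible:
  assumes z: "z \<in> \<E>"
  shows "op_invertible (id_blinfun - z *\<^sub>C \<Omega> z)"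
proof -
  have "op_invertible (1 *\<^sub>C id_blinfun - z *\<^sub>C \<Omega> z)"
  proof (rule RS_shift_invertible[OF z])
    assume "Im z \<noteq> 0"
    then have "0 < (Im z)\<^sup>2 / (cmod z)\<^sup>2"
      by (auto intro!: divide_pos_pos)
    then show "Im z * Im (1 / z) < 0"
      unfolding cmod_power2 by (simp add: Im_divide power2_eq_square)
  next
    assume "Im z = 0"
    then show "cmod z < Re 1"
      using z by (auto simp: slit_plane_iff cmod_eq_Re)
  qed
  then show ?thesis
    by (simp add: scaleC_op_one)
qed

text \<open>
  The perturbation \<open>(1 - d) \<Omega>(w) + d w\<close> stays in the class and makes the Cayley transform
  \<open>(1 + \<Omega>) (1 - \<Omega>)\<^sup>-\<^sup>1\<close> well defined; the quadratic forms of the latter are Stieltjes type functions.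
\<close>

lemma RS_schwarz_perturbed:
  assumes d: "0 < d" "d < 1" and z: "0 < Im z" and "g \<noteq> 0"
  defines "k \<equiv> of_real (1 - d) *\<^sub>C \<Omega> z g + (of_real d * z) *\<^sub>C g"
  shows "0 \<le> Im z * ((norm g)\<^sup>2 - (norm k)\<^sup>2) + ((cmod z)\<^sup>2 - 1) * Im (cinner k g)"
proof -
  define P where "P w = of_real (1 - d) *\<^sub>C \<Omega> w + (of_real d * w) *\<^sub>C id_blinfun" for w
  have Papp: "P w h = of_real (1 - d) *\<^sub>C \<Omega> w h + (of_real d * w) *\<^sub>C h" for w h
    by (simp add: P_def blinfun.add_left)
  have Pcl: "clinear_op (P w)" if "w \<in> \<E>" for w
    unfolding P_def by (intro clinear_intros RS_clinear that)
  have Phol: "op_holomorphic_on P \<E>"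
    unfolding P_def[abs_def]
    by (intro op_holomorphic_intros holomorphic_intros RS_holomorphic)
  have PIm: "Im (cinner (P w h) h) = (1 - d) * Im (cinner (\<Omega> w h) h) + d * Im w * (norm h)\<^sup>2" for w h
    by (simp add: Papp cinner_add_left cinner_scaleC_left cinner_self flip: of_real_power)
  have Pnorm: "norm (P (of_real x) h) \<le> ((1 - d) + d * \<bar>x\<bar>) * norm h" if "-1 < x" "x < 1" for x h
  proof -
    have "norm (P (of_real x) h) \<le> (1 - d) * norm (\<Omega> (of_real x) h) + d * \<bar>x\<bar> * norm h"
      unfolding Papp using d
      by (intro order_trans[OF norm_triangle_ineq])
        (simp add: norm_scaleC norm_mult del: of_real_diff)
    also have "\<dots> \<le> (1 - d) * norm h + d * \<bar>x\<bar> * norm h"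
      using d that by (intro add_right_mono mult_left_mono RS_norm) auto
    finally show ?thesis
      by (simp add: algebra_simps)
  qed
  have less1: "(1 - d) + d * \<bar>x\<bar> < 1" if "-1 < x" "x < 1" for x
    using d that by (simp add: abs_less_iff)
  have nonreal: "0 < Im w * Im (cinner (P w h) h)" if "Im w \<noteq> 0" "h \<noteq> 0" for w h
  proof -
    have "0 < d * (Im w)\<^sup>2 * (norm h)\<^sup>2"
      using that d by simp
    moreover have "0 \<le> (1 - d) * (Im w * Im (cinner (\<Omega> w h) h))"
      using d that by (intro mult_nonneg_nonneg RS_Im_mult) (auto simp: slit_plane_iff)
    ultimately show ?thesis
      by (simp add: PIm power2_eq_square algebra_simps)
  qed
  have inv: "op_invertible (id_blinfun - P w)" if w: "w \<in> \<E>" for w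
  proof (cases "Im w = 0")
    case True
    then have w': "w = of_real (Re w)" "-1 < Re w" "Re w < 1"
      using w by (auto simp: slit_plane_iff complex_eq_iff)
    have "op_invertible (1 *\<^sub>C id_blinfun - P w)"
      using Pnorm[OF w'(2,3)] less1[OF w'(2,3)] w'(1)
      by (intro contraction_shift_invertible[where q = "(1 - d) + d * \<bar>Re w\<bar>"]) auto
    then show ?thesis
      by (simp add: scaleC_op_one)
  next
    case False
    have "op_invertible ((1 - of_real d * w) *\<^sub>C id_blinfun - of_real (1 - d) *\<^sub>C \<Omega> w)"
    proof (rule Im_shift_invertible[of "Im w"])
      show "Im w * Im (1 - of_real d * w) < 0"
        using False d by (auto simp: mult_less_0_iff zero_less_mult_iff neq_iff)
      have "0 \<le> (1 - d) * (Im w * Im (cinner (\<Omega> w h) h))" for h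
        using d w by (intro mult_nonneg_nonneg RS_Im_mult) auto
      then show "0 \<le> Im w * Im (cinner ((of_real (1 - d) *\<^sub>C \<Omega> w) h) h)" for h
        by (simp add: cinner_scaleC_left mult_ac)
    qed
    moreover have "(1 - of_real d * w) *\<^sub>C id_blinfun - of_real (1 - d) *\<^sub>C \<Omega> w = id_blinfun - P w"
      by (simp add: P_def scaleC_op.diff_left scaleC_op_one)
    ultimately show ?thesis
      by simp
  qed
  have zE: "z \<in> \<E>"
    using z by (simp add: slit_plane_iff)
  \<comment> \<open>The vector is frozen at the given point, so that the resolvent vector there is
    \<open>h z = g\<close>; at other points \<open>h w\<close> varies, but \<open>f\<close> does
    not, and \<open>F\<close> is holomorphic.\<close>
  define f where "f = g - P z g"
  define h where "h w = op_inv (id_blinfun - P w) f" for w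
  have fh: "h w - P w (h w) = f" if "w \<in> \<E>" for w
    using apply_op_inv_right[OF inv[OF that], of f] by (simp add: h_def blinfun.diff_left)
  have hz: "h z = g"
    using apply_op_inv_left[OF inv[OF zE], of g] by (simp add: h_def f_def blinfun.diff_left)
  have "f \<noteq> 0"
    using hz \<open>g \<noteq> 0\<close> by (auto simp: h_def)
  then have h0: "h w \<noteq> 0" if "w \<in> \<E>" for w
    using fh[OF that] by auto
  \<comment> \<open>The form of the Cayley transform. Writing \<open>f\<close> as
    \<open>h w - P w (h w)\<close> separates its real and imaginary parts, and strict contractivity
    on (-1,1) and strict signs off it keep \<open>F\<close> away from the cut.\<close>
  define F where "F w = cinner (((id_blinfun + P w) o\<^sub>L op_inv (id_blinfun - P w)) f) f" for w
  have F: "Re (F w) = (norm (h w))\<^sup>2 - (norm (P w (h w)))\<^sup>2" "Im (F w) = 2 * Im (cinner (P w (h w)) (h w))"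
    if "w \<in> \<E>" for w
  proof -
    have "F w = cinner (h w + P w (h w)) f"
      by (simp add: F_def blinfun.add_left h_def)
    also have "\<dots> = cinner (h w + P w (h w)) (h w - P w (h w))"
      by (simp only: fh[OF that])
    also have "\<dots> = cinner (h w) (h w) - cinner (P w (h w)) (P w (h w))
        + (cinner (P w (h w)) (h w) - cnj (cinner (P w (h w)) (h w)))"
      using cinner_commute[of "h w" "P w (h w)"]
      by (simp add: cinner_add_left cinner.diff_right)
    finally show "Re (F w) = (norm (h w))\<^sup>2 - (norm (P w (h w)))\<^sup>2"
      "Im (F w) = 2 * Im (cinner (P w (h w)) (h w))"
      by (simp_all add: cinner_self flip: of_real_power)
  qed
  have sgn: "0 < Im w * Im (F w)" if "Im w \<noteq> 0" for w
  proof -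
    have w: "w \<in> \<E>"
      using that by (simp add: slit_plane_iff)
    show ?thesis
      using nonreal[OF that h0[OF w]] by (simp add: F[OF w])
  qed
  have "Im (F z * cnj ((1 + z) / (1 - z))) \<le> 0"
  proof (rule stieltjes_quotient[OF _ _ _ _ z])
    show "F holomorphic_on \<E>"
      unfolding F_def[abs_def]
      by (intro holomorphic_cinner op_holomorphic_intros Phol clinear_intros Pcl inv)
    show "0 < Im (F w)" if "0 < Im w" for w
      using sgn[of w] that by (simp add: zero_less_mult_iff)
    show "Im (F w) < 0" if "Im w < 0" for w
      using sgn[of w] that by (simp add: zero_less_mult_iff)
    fix x :: real assume x: "-1 < x" "x < 1"
    then have w: "of_real x \<in> \<E>"
      by (simp add: slit_plane_iff)
    have "norm (P (of_real x) (h (of_real x))) < norm (h (of_real x))"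
    proof -
      have "((1 - d) + d * \<bar>x\<bar>) * norm (h (of_real x)) < 1 * norm (h (of_real x))"
        using h0[OF w] by (intro mult_strict_right_mono less1[OF x]) simp
      then show ?thesis
        using Pnorm[OF x, of "h (of_real x)"] by linarith
    qed
    then have "(norm (P (of_real x) (h (of_real x))))\<^sup>2 < (norm (h (of_real x)))\<^sup>2"
      by (intro power_strict_mono) auto
    then show "Im (F (of_real x)) = 0 \<and> 0 < Re (F (of_real x))"
      by (simp add: F[OF w] PIm RS_real_Im[OF x])
  qed
  \<comment> \<open>Clearing the positive denominator turns the bound on the argument of
    \<open>F z\<close> into the polynomial inequality of the goal, up to a factor 2.\<close>
  moreover have "cnj ((1 + z) / (1 - z)) = Complex (1 - (cmod z)\<^sup>2) (- 2 * Im z) / of_real ((cmod (1 - z))\<^sup>2)"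
  proof -
    have "of_real ((cmod (1 - z))\<^sup>2) = (1 - z) * (1 - cnj z)"
      by (simp only: complex_norm_square) simp
    moreover have "1 - z \<noteq> 0"
      using z by auto
    ultimately have "cnj ((1 + z) / (1 - z)) = (1 + cnj z) * (1 - z) / of_real ((cmod (1 - z))\<^sup>2)"
      by simp
    moreover have "(1 + cnj z) * (1 - z) = Complex (1 - (cmod z)\<^sup>2) (- 2 * Im z)"
      unfolding cmod_power2 by (simp add: complex_eq_iff power2_eq_square algebra_simps)
    ultimately show ?thesis
      by simp
  qed
  ultimately have "Im (F z * Complex (1 - (cmod z)\<^sup>2) (- 2 * Im z)) / (cmod (1 - z))\<^sup>2 \<le> 0"
    by (metis Im_divide_of_real times_divide_eq_right)
  moreover have "0 < (cmod (1 - z))\<^sup>2"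
    using z by auto
  ultimately have "Im (F z * Complex (1 - (cmod z)\<^sup>2) (- 2 * Im z)) \<le> 0"
    by (simp add: divide_le_0_iff)
  then have "Im (F z) * (1 - (cmod z)\<^sup>2) - 2 * Im z * Re (F z) \<le> 0"
    by (simp add: algebra_simps)
  moreover have "P z g = k"
    by (simp add: Papp k_def)
  ultimately show ?thesis
    unfolding F[OF zE] hz by (simp add: algebra_simps)
qed

text \<open>The right side is the imaginary part of the form of \<open>Phi \<Omega> z\<close> at
  \<open>g - z *\<^sub>C \<Omega> z g\<close>. It is the limit of the perturbed inequality as
  \<open>d\<close> tends to 0 from above.\<close>

lemma RS_schwarz:
  assumes z: "0 < Im z"
  shows "0 \<le> Im z * ((norm g)\<^sup>2 - (norm (\<Omega> z g))\<^sup>2) + ((cmod z)\<^sup>2 - 1) * Im (cinner (\<Omega> z g) g)"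
proof (cases "g = 0")
  case False
  define k where "k d = of_real (1 - d) *\<^sub>C \<Omega> z g + (of_real d * z) *\<^sub>C g" for d
  have "(k \<longlongrightarrow> of_real (1 - 0) *\<^sub>C \<Omega> z g + (of_real 0 * z) *\<^sub>C g) (at_right 0)"
    unfolding k_def[abs_def] by (intro tendsto_intros scaleC.tendsto)
  then have "(k \<longlongrightarrow> \<Omega> z g) (at_right 0)"
    by (simp add: scaleC_one scaleC.zero_left)
  then have "((\<lambda>d. Im z * ((norm g)\<^sup>2 - (norm (k d))\<^sup>2) + ((cmod z)\<^sup>2 - 1) * Im (cinner (k d) g))
      \<longlongrightarrow> Im z * ((norm g)\<^sup>2 - (norm (\<Omega> z g))\<^sup>2) + ((cmod z)\<^sup>2 - 1) * Im (cinner (\<Omega> z g) g)) (at_right 0)"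
    by (intro tendsto_intros cinner.tendsto)
  moreover have "\<forall>\<^sub>F d in at_right 0. 0 \<le> Im z * ((norm g)\<^sup>2 - (norm (k d))\<^sup>2) + ((cmod z)\<^sup>2 - 1) * Im (cinner (k d) g)"
    by (rule eventually_mono[OF eventually_at_right_real[OF zero_less_one]])
      (use RS_schwarz_perturbed[OF _ _ z False] in \<open>auto simp: k_def\<close>)
  ultimately show ?thesis
    by (rule tendsto_lowerbound) simp
qed (simp add: cinner.zero_left blinfun.zero_right)

lemma Phi_apply: "z \<in> \<E> \<Longrightarrow> Phi \<Omega> z (g - z *\<^sub>C \<Omega> z g) = z *\<^sub>C g - \<Omega> z g"
  using apply_op_inv_left[OF RS_resolvent_invertible, of z g] by (simp add: Phi_def blinfun.diff_left)

lemma RS_resolvent_surj: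
  assumes "z \<in> \<E>"
  obtains g where "f = g - z *\<^sub>C \<Omega> z g"
proof -
  have "f = op_inv (id_blinfun - z *\<^sub>C \<Omega> z) f - z *\<^sub>C \<Omega> z (op_inv (id_blinfun - z *\<^sub>C \<Omega> z) f)"
    using apply_op_inv_right[OF RS_resolvent_invertible[OF assms], of f] by (simp add: blinfun.diff_left)
  then show thesis
    by (rule that)
qed

lemma Phi_RS: "Phi \<Omega> \<in> RS"
  unfolding RS_iff
proof (intro conjI ballI allI impI)
  show "Phi \<Omega> \<in> extensional \<E>"
    by (simp add: Phi_def)
  show "clinear_op (Phi \<Omega> z)" if "z \<in> \<E>" for z
    using that by (auto simp: Phi_def intro!: clinear_intros clinear_op_inv RS_clinear RS_resolvent_invertible)
  have "op_holomorphic_on (\<lambda>z. (z *\<^sub>C id_blinfun - \<Omega> z) o\<^sub>L op_inv (id_blinfun - z *\<^sub>C \<Omega> z)) \<E>"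
    by (intro op_holomorphic_intros holomorphic_intros RS_holomorphic RS_resolvent_invertible
        clinear_intros RS_clinear)
  then show "op_holomorphic_on (Phi \<Omega>) \<E>"
    by (rule op_holomorphic_cong) (simp add: Phi_def)
next
  fix z f g assume z: "z \<in> \<E>"
  then have cz: "cnj z \<in> \<E>"
    by (simp add: cnj_slit_iff)
  obtain a where f: "f = a - z *\<^sub>C \<Omega> z a"
    using RS_resolvent_surj[OF z] .
  obtain b where g: "g = b - cnj z *\<^sub>C \<Omega> (cnj z) b"
    using RS_resolvent_surj[OF cz] .
  show "cinner (Phi \<Omega> z f) g = cinner f (Phi \<Omega> (cnj z) g)"
    unfolding f g Phi_apply[OF z] Phi_apply[OF cz]
    by (simp add: cinner.diff_left cinner.diff_right cinner_scaleC_left cinner_scaleC_right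
        RS_adjoint[OF z] algebra_simps)
next
  fix z f assume z: "0 < Im z"
  then have zE: "z \<in> \<E>"
    by (simp add: slit_plane_iff)
  obtain g where f: "f = g - z *\<^sub>C \<Omega> z g"
    using RS_resolvent_surj[OF zE] .
  have "cinner (Phi \<Omega> z f) f = z * cinner g g - of_real ((cmod z)\<^sup>2) * cnj (cinner (\<Omega> z g) g)
      - cinner (\<Omega> z g) g + cnj z * cinner (\<Omega> z g) (\<Omega> z g)"
    unfolding f Phi_apply[OF zE] complex_norm_square
    using cinner_commute[of g "\<Omega> z g"]
    by (simp add: cinner.diff_left cinner.diff_right cinner_scaleC_left cinner_scaleC_right algebra_simps)
  from arg_cong[OF this, of Im] have "Im (cinner (Phi \<Omega> z f) f)
      = Im z * ((norm g)\<^sup>2 - (norm (\<Omega> z g))\<^sup>2) + ((cmod z)\<^sup>2 - 1) * Im (cinner (\<Omega> z g) g)"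
    by (simp add: cinner_self algebra_simps flip: of_real_power)
  then show "0 \<le> Im (cinner (Phi \<Omega> z f) f)"
    using RS_schwarz[OF z] by simp
next
  fix x :: real and f :: 'a assume "x \<in> {-1<..<1}"
  then have x: "-1 < x" "x < 1" and xE: "of_real x \<in> \<E>"
    by (auto simp: slit_plane_iff)
  obtain g where f: "f = g - of_real x *\<^sub>C \<Omega> (of_real x) g"
    using RS_resolvent_surj[OF xE] .
  define b where "b = \<Omega> (of_real x) g"
  have "(norm b)\<^sup>2 \<le> (norm g)\<^sup>2" "x\<^sup>2 \<le> 1"
    using RS_norm[OF x, of g] x by (auto simp: b_def abs_square_le_1 intro!: power_mono)
  \<comment> \<open>This product is the difference of the squared norms of
    \<open>g - x *\<^sub>R b\<close> and \<open>x *\<^sub>R g - b\<close>: a real Moebius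
    transformation preserves contractions that are selfadjoint.\<close>
  then have "0 \<le> (1 - x\<^sup>2) * ((norm g)\<^sup>2 - (norm b)\<^sup>2)"
    by (intro mult_nonneg_nonneg) auto
  also have "\<dots> = (norm (g - x *\<^sub>R b))\<^sup>2 - (norm (x *\<^sub>R g - b))\<^sup>2"
    unfolding power2_norm_eq_inner
    by (simp add: inner_diff inner_commute power2_eq_square algebra_simps)
  finally have "norm (x *\<^sub>R g - b) \<le> norm (g - x *\<^sub>R b)"
    by (intro power2_le_imp_le[OF _ norm_ge_zero]) simp
  then show "norm (Phi \<Omega> (of_real x) f) \<le> norm f"
    unfolding f Phi_apply[OF xE] by (simp add: b_def scaleR_scaleC)
qed

end

section \<open>The scalar fixed point of \<open>Phi\<close>, and uniqueness\<close>

lemma Re_csqrt_pos: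
  assumes "w \<notin> \<real>\<^sub>\<le>\<^sub>0"
  shows "0 < Re (csqrt w)"
proof -
  have "Re c \<noteq> 0" if "c\<^sup>2 = w" for c
  proof
    assume "Re c = 0"
    then have "c\<^sup>2 = of_real (- (Im c)\<^sup>2)"
      by (simp add: complex_eq_iff power2_eq_square)
    then have "w = of_real (- (Im c)\<^sup>2)"
      using that by simp
    moreover have "- (Im c)\<^sup>2 \<le> 0"
      by simp
    ultimately show False
      using assms by (metis nonpos_Reals_of_real_iff)
  qed
  from this[OF power2_csqrt] show ?thesis
    using csqrt_principal[of w] by auto
qed

lemma csqrt_cnj_not_nonpos:
  assumes "w \<notin> \<real>\<^sub>\<le>\<^sub>0"
  shows "csqrt (cnj w) = cnj (csqrt w)"
proof (rule csqrt_unique)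
  show "0 < Re (cnj (csqrt w)) \<or> Re (cnj (csqrt w)) = 0 \<and> 0 \<le> Im (cnj (csqrt w))"
    using Re_csqrt_pos[OF assms] by simp
  show "(cnj (csqrt w))\<^sup>2 = cnj w"
    by (metis complex_cnj_power power2_csqrt)
qed

context
  fixes z :: complex
  assumes z: "z \<in> \<E>"
begin

lemma Re_sqrt_slit_pos: "0 < Re (sqrt_slit z)"
  unfolding sqrt_slit_def by (rule Re_csqrt_pos[OF slit_not_nonpos[OF z]])

lemma one_plus_sqrt_slit_nz: "1 + sqrt_slit z \<noteq> 0"
  using Re_sqrt_slit_pos by (auto simp: complex_eq_iff)

text \<open>The first equation is the scalar fixed point equation
  \<open>u = (z - u) / (1 - z * u)\<close> with cleared denominator; both come from
  \<open>z * u = 1 - s\<close>.\<close>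

lemma omega_quadratic:
  fixes u :: complex
  defines "u \<equiv> z / (1 + sqrt_slit z)"
  shows "z * (1 + u\<^sup>2) = 2 * u" "1 - z * u = sqrt_slit z"
proof -
  define s where "s = sqrt_slit z"
  have "z * z = (1 + s) * (1 - s)"
    using sqrt_slit_square[of z] by (simp add: s_def power2_eq_square algebra_simps)
  then have zu: "z * u = 1 - s"
    using one_plus_sqrt_slit_nz by (simp add: u_def s_def field_simps)
  then show "1 - z * u = sqrt_slit z"
    by (simp add: s_def)
  have "z = u * (1 + s)"
    using one_plus_sqrt_slit_nz by (simp add: u_def s_def)
  then have "z + (1 - s) * u = 2 * u"
    by (simp add: algebra_simps)
  moreover have "z * (1 + u\<^sup>2) = z + (z * u) * u"
    by (simp add: power2_eq_square algebra_simps)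
  ultimately show "z * (1 + u\<^sup>2) = 2 * u"
    by (simp only: zu)
qed

text \<open>From \<open>z\<^sup>2 = (1 - s) * (1 + s)\<close>: a root \<open>s\<close> in the right
  half plane is nearer to 1 than to -1.\<close>

lemma omega_norm_less_one: "cmod (z / (1 + sqrt_slit z)) < 1"
proof -
  define s where "s = sqrt_slit z"
  have "z\<^sup>2 = (1 - s) * (1 + s)"
    using sqrt_slit_square[of z] by (simp add: s_def power2_eq_square algebra_simps)
  then have "(cmod z)\<^sup>2 = cmod (1 - s) * cmod (1 + s)"
    by (metis norm_mult norm_power)
  also have "\<dots> < cmod (1 + s) * cmod (1 + s)"
    using cmod_diff_less_cmod_add[of s 1] Re_sqrt_slit_pos one_plus_sqrt_slit_nz
    by (intro mult_strict_right_mono) (auto simp: s_def norm_minus_commute add.commute)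
  finally have "(cmod z)\<^sup>2 < (cmod (1 + s))\<^sup>2"
    by (simp add: power2_eq_square)
  then have "cmod z < cmod (1 + s)"
    by (rule power_less_imp_less_base) simp
  then show ?thesis
    by (simp add: norm_divide s_def divide_less_eq_1)
qed

text \<open>The imaginary part of the quadratic equation multiplied by the conjugate of
  \<open>1 + u\<^sup>2\<close>. As \<open>cmod u < 1\<close>, it shows that \<open>Im u\<close> has
  the sign of \<open>Im z\<close>.\<close>

lemma omega_Im:
  fixes u :: complex
  defines "u \<equiv> z / (1 + sqrt_slit z)"
  shows "Im z * (cmod (1 + u\<^sup>2))\<^sup>2 = 2 * Im u * (1 - (cmod u)\<^sup>2)"
proof -
  have "z * of_real ((cmod (1 + u\<^sup>2))\<^sup>2) = z * (1 + u\<^sup>2) * cnj (1 + u\<^sup>2)"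
    by (simp only: complex_norm_square mult.assoc)
  also have "\<dots> = 2 * (u + (u * cnj u) * cnj u)"
    using omega_quadratic(1) unfolding u_def[symmetric] by (simp add: power2_eq_square algebra_simps)
  also have "\<dots> = 2 * (u + of_real ((cmod u)\<^sup>2) * cnj u)"
    by (simp only: complex_norm_square)
  finally have "Im (z * of_real ((cmod (1 + u\<^sup>2))\<^sup>2)) = Im (2 * (u + of_real ((cmod u)\<^sup>2) * cnj u))"
    by (rule arg_cong)
  then show ?thesis
    by (simp add: algebra_simps)
qed

lemma omega_Im_pos: "0 < Im z \<Longrightarrow> 0 < Im (z / (1 + sqrt_slit z))"
  and omega_Im_mult_pos: "Im z \<noteq> 0 \<Longrightarrow> 0 < Im z * Im (z / (1 + sqrt_slit z))"
proof -
  define u where "u = z / (1 + sqrt_slit z)"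
  have 1: "0 < 1 - (cmod u)\<^sup>2"
    using omega_norm_less_one by (simp add: u_def abs_square_less_1)
  show *: "0 < Im z * Im (z / (1 + sqrt_slit z))" if "Im z \<noteq> 0"
  proof -
    have "z \<noteq> 0"
      using that by auto
    then have "1 + u\<^sup>2 \<noteq> 0"
      using omega_quadratic(1) one_plus_sqrt_slit_nz by (auto simp: u_def)
    then have "0 < (Im z)\<^sup>2 * (cmod (1 + u\<^sup>2))\<^sup>2"
      using that by simp
    also have "\<dots> = 2 * (1 - (cmod u)\<^sup>2) * (Im z * Im u)"
      using omega_Im by (simp add: u_def power2_eq_square mult_ac)
    finally show ?thesis
      using 1 by (simp add: zero_less_mult_iff u_def)
  qed
  show "0 < Im (z / (1 + sqrt_slit z))" if "0 < Im z"
    using * that by (simp add: zero_less_mult_iff)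
qed

end

lemma sqrt_slit_cnj: "z \<in> \<E> \<Longrightarrow> sqrt_slit (cnj z) = cnj (sqrt_slit z)"
  using csqrt_cnj_not_nonpos[OF slit_not_nonpos, of z] by (simp add: sqrt_slit_def)

lemma Omega0_RS: "Omega0 \<in> RS"
  unfolding RS_iff
proof (intro conjI ballI allI impI)
  let ?u = "\<lambda>z. z / (1 + sqrt_slit z)"
  show "Omega0 \<in> extensional \<E>"
    by (simp add: Omega0_def)
  show "clinear_op (Omega0 z :: 'a \<Rightarrow>\<^sub>L 'a)" if "z \<in> \<E>" for z
    using that by (auto simp: Omega0_def intro!: clinear_intros)
  have "op_holomorphic_on (\<lambda>z. ?u z *\<^sub>C (id_blinfun :: 'a \<Rightarrow>\<^sub>L 'a)) \<E>"
    by (intro op_holomorphic_intros holomorphic_intros sqrt_slit_holomorphic one_plus_sqrt_slit_nz)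
  then show "op_holomorphic_on (Omega0 :: _ \<Rightarrow> 'a \<Rightarrow>\<^sub>L 'a) \<E>"
    by (rule op_holomorphic_cong) (simp add: Omega0_def)
  fix z f and g :: 'a
  show "cinner (Omega0 z f) g = cinner f (Omega0 (cnj z) g)" if "z \<in> \<E>"
    using that by (simp add: Omega0_def cnj_slit_iff cinner_scaleC_left cinner_scaleC_right sqrt_slit_cnj)
  show "0 \<le> Im (cinner (Omega0 z f) f)" if "0 < Im z"
  proof -
    have "z \<in> \<E>"
      using that by (simp add: slit_plane_iff)
    define v where "v = ?u z"
    have "0 \<le> Im v * (norm f)\<^sup>2"
      unfolding v_def using omega_Im_pos[OF \<open>z \<in> \<E>\<close> that] by (intro mult_nonneg_nonneg) auto
    moreover have "Omega0 z f = v *\<^sub>C f"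
      using \<open>z \<in> \<E>\<close> by (simp add: Omega0_def v_def)
    ultimately show ?thesis
      by (simp add: cinner_scaleC_left cinner_self flip: of_real_power)
  qed
  show "norm (Omega0 (of_real x) f) \<le> norm f" if "x \<in> {-1<..<1}" for x
  proof -
    have "of_real x \<in> \<E>"
      using that by (simp add: slit_plane_iff)
    then show ?thesis
      using omega_norm_less_one[of "of_real x"] mult_right_mono[of "cmod (?u (of_real x))" 1 "norm f"]
      by (simp add: Omega0_def norm_scaleC)
  qed
qed

lemma Phi_Omega0: "Phi Omega0 = Omega0"
proof
  fix z
  show "Phi Omega0 z = (Omega0 z :: 'a \<Rightarrow>\<^sub>L 'a)"
  proof (cases "z \<in> \<E>")
    case True
    define u where "u = z / (1 + sqrt_slit z)"
    have O: "Omega0 z = u *\<^sub>C (id_blinfun :: 'a \<Rightarrow>\<^sub>L 'a)"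
      using True by (simp add: Omega0_def u_def)
    have "sqrt_slit z \<noteq> 0"
      using Re_sqrt_slit_pos[OF True] by auto
    then have nz: "1 - z * u \<noteq> 0"
      using omega_quadratic(2)[OF True] by (simp add: u_def)
    show ?thesis
    proof (rule blinfun_eqI)
      fix f :: 'a
      define g where "g = (1 / (1 - z * u)) *\<^sub>C f"
      have "f = g - z *\<^sub>C (Omega0 z :: 'a \<Rightarrow>\<^sub>L 'a) g"
        using nz by (simp add: g_def O scaleC_scaleC scaleC.diff_left[symmetric] scaleC_one diff_divide_distrib[symmetric])
      then have "Phi Omega0 z f = z *\<^sub>C g - (Omega0 z :: 'a \<Rightarrow>\<^sub>L 'a) g"
        using Phi_apply[OF Omega0_RS True] by metis
      also have "\<dots> = ((z - u) / (1 - z * u)) *\<^sub>C f"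
        by (simp add: O g_def scaleC.diff_left[symmetric] scaleC_scaleC diff_divide_distrib)
      also have "(z - u) / (1 - z * u) = u"
        using omega_quadratic(1)[OF True] nz by (simp add: u_def[symmetric] field_simps power2_eq_square)
      finally show "Phi Omega0 z f = (Omega0 z :: 'a \<Rightarrow>\<^sub>L 'a) f"
        by (simp add: O)
    qed
  qed (simp add: Phi_def Omega0_def)
qed

text \<open>For a fixed point, \<open>B = 1 - z \<Omega>(z)\<close> has the square \<open>s\<^sup>2\<close>, and \<open>B + s\<close> is invertible.\<close>

lemma Phi_fixed_point_unique:
  assumes RS: "\<Omega> \<in> RS" and fixed: "Phi \<Omega> = \<Omega>"
  shows "\<Omega> = Omega0"
proof (rule extensionalityI[OF RS_extensional[OF RS] RS_extensional[OF Omega0_RS]])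
  fix z assume z: "z \<in> \<E>"
  define s where "s = sqrt_slit z"
  define u where "u = z / (1 + s)"
  have s2: "s * s = 1 - z * z"
    using sqrt_slit_square[of z] by (simp add: s_def power2_eq_square)
  note cl = clinear_opD[OF RS_clinear[OF RS z]]
  \<comment> \<open>This is \<open>B + s\<close>. After division by \<open>z\<close> the scalar is
    \<open>1 / u\<close>, with \<open>u\<close> the scalar fixed point, and
    \<open>Im (1 / u)\<close> has the sign opposite to \<open>Im z\<close>.\<close>
  have inv: "op_invertible ((1 + s) *\<^sub>C id_blinfun - z *\<^sub>C \<Omega> z)"
  proof (rule RS_shift_invertible[OF RS z])
    assume "Im z \<noteq> 0"
    then have "0 < Im z * Im u"
      using omega_Im_mult_pos[OF z] by (simp add: u_def s_def)
    then have "0 < Im z * Im u / (cmod u)\<^sup>2"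
      by (intro divide_pos_pos) auto
    moreover have "Im (1 / u) = - Im u / (cmod u)\<^sup>2"
      unfolding cmod_power2 by (simp add: Im_divide)
    moreover have "(1 + s) / z = 1 / u"
      by (simp add: u_def)
    ultimately show "Im z * Im ((1 + s) / z) < 0"
      by simp
  next
    assume "Im z = 0"
    then have "cmod z < 1"
      using z by (auto simp: slit_plane_iff cmod_eq_Re)
    then show "cmod z < Re (1 + s)"
      using Re_sqrt_slit_pos[OF z] by (simp add: s_def)
  qed
  have fx: "\<Omega> z (g - z *\<^sub>C \<Omega> z g) = z *\<^sub>C g - \<Omega> z g" for g
    using Phi_apply[OF RS z, of g] unfolding fixed .
  have quad: "z *\<^sub>C \<Omega> z (\<Omega> z g) = 2 *\<^sub>C \<Omega> z g - z *\<^sub>C g" for g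
  proof -
    have "2 *\<^sub>C \<Omega> z g = \<Omega> z g + \<Omega> z g"
      using scaleC_add_left[of 1 1] by (simp add: scaleC_one)
    then show ?thesis
      using fx[of g] by (simp add: blinfun.diff_right cl algebra_simps)
  qed
  show "\<Omega> z = Omega0 z"
  proof (rule blinfun_eqI)
    fix f
    \<comment> \<open>\<open>k = (B - s) f\<close>, so
      \<open>(B + s) k = (B\<^sup>2 - s\<^sup>2) f = 0\<close>.\<close>
    define k where "k = (1 - s) *\<^sub>C f - z *\<^sub>C \<Omega> z f"
    have "((1 + s) *\<^sub>C id_blinfun - z *\<^sub>C \<Omega> z) k = 0"
    proof -
      have "((1 + s) *\<^sub>C id_blinfun - z *\<^sub>C \<Omega> z) k
          = ((1 + s) * (1 - s)) *\<^sub>C f - ((1 + s) * z) *\<^sub>C \<Omega> z f - (z * (1 - s)) *\<^sub>C \<Omega> z f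
            + z *\<^sub>C (z *\<^sub>C \<Omega> z (\<Omega> z f))"
        by (simp add: k_def blinfun.diff_left blinfun.diff_right cl scaleC.diff_right scaleC_scaleC)
      also have "\<dots> = ((1 + s) * (1 - s) - z * z) *\<^sub>C f + (z * 2 - (1 + s) * z - z * (1 - s)) *\<^sub>C \<Omega> z f"
        by (simp only: quad scaleC.diff_left scaleC.diff_right scaleC_scaleC) (simp add: algebra_simps)
      also have "\<dots> = 0"
        using s2 by (simp add: algebra_simps scaleC.zero_left)
      finally show ?thesis .
    qed
    then have "k = 0"
      by (metis apply_op_inv_left[OF inv] blinfun.zero_right)
    then have zO: "z *\<^sub>C \<Omega> z f = (1 - s) *\<^sub>C f"
      by (simp add: k_def)
    \<comment> \<open>The relation just obtained cannot be divided by \<open>z\<close> at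
      \<open>z = 0\<close>. Inserting it into the quadratic equation leaves the factor
      \<open>1 + s\<close>, which never vanishes.\<close>
    have "2 *\<^sub>C \<Omega> z f = z *\<^sub>C f + \<Omega> z (z *\<^sub>C \<Omega> z f)"
      using quad[of f] by (simp add: cl)
    also have "\<dots> = z *\<^sub>C f + (1 - s) *\<^sub>C \<Omega> z f"
      by (simp add: zO cl)
    finally have "2 *\<^sub>C \<Omega> z f - (1 - s) *\<^sub>C \<Omega> z f = z *\<^sub>C f"
      by simp
    then have "(1 + s) *\<^sub>C \<Omega> z f = z *\<^sub>C f"
      by (simp add: scaleC.diff_left[symmetric])
    then have "(1 / (1 + s)) *\<^sub>C ((1 + s) *\<^sub>C \<Omega> z f) = (1 / (1 + s)) *\<^sub>C (z *\<^sub>C f)"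
      by simp
    then show "\<Omega> z f = Omega0 z f"
      using one_plus_sqrt_slit_nz[OF z] z by (simp add: scaleC_scaleC scaleC_one Omega0_def s_def)
  qed
qed

lemma Omega0_i: "Omega0 \<i> = (\<i> / of_real (1 + sqrt 2)) *\<^sub>C id_blinfun"
  by (simp add: Omega0_def slit_plane_iff sqrt_slit_i)

section \<open>The class N0\<close>

lemma Im_one_divide: "Im (1 / u) = - Im u / (cmod u)\<^sup>2" and Re_one_divide: "Re (1 / u) = Re u / (cmod u)\<^sup>2"
  unfolding cmod_power2 by (simp_all add: Im_divide Re_divide)

text \<open>Inside the unit disk the last factor is positive, so the map interchanges the two half
  planes.\<close>

lemma Im_joukowski: "Im ((u + 1 / u) / 2) = - Im u * (1 / (cmod u)\<^sup>2 - 1) / 2"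
  by (simp add: Im_one_divide del: Im_divide) (simp add: algebra_simps)

lemma norm_sq_inverse_gt_one: "u \<noteq> 0 \<Longrightarrow> cmod u < 1 \<Longrightarrow> 1 < 1 / (cmod u)\<^sup>2"
  by (simp add: abs_square_less_1)

lemma joukowski_cut_plane:
  assumes "u \<noteq> 0" "cmod u < 1"
  shows "(u + 1 / u) / 2 \<in> cut_plane"
proof (cases "Im u = 0")
  case True
  define r where "r = Re u"
  have u: "u = of_real r"
    using True by (simp add: r_def complex_eq_iff)
  have r: "r \<noteq> 0" "\<bar>r\<bar> < 1"
    using assms by (auto simp: u)
  have "Re ((u + 1 / u) / 2) = (r + 1 / r) / 2"
  proof -
    have "(u + 1 / u) / 2 = of_real ((r + 1 / r) / 2)"
      by (simp add: u)
    then show ?thesis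
      by (simp only: Re_complex_of_real)
  qed
  moreover have "1 < (r + 1 / r) / 2" if "0 < r"
  proof -
    have "0 < (1 - r)\<^sup>2 / r"
      using that r by simp
    also have "(1 - r)\<^sup>2 / r = r + 1 / r - 2"
      using that by (simp add: field_simps power2_eq_square)
    finally show ?thesis
      by simp
  qed
  moreover have "(r + 1 / r) / 2 < -1" if "r < 0"
  proof -
    have "0 > (1 + r)\<^sup>2 / r"
      using that r by (simp add: divide_less_0_iff)
    also have "(1 + r)\<^sup>2 / r = r + 1 / r + 2"
      using that by (simp add: field_simps power2_eq_square)
    finally show ?thesis
      by simp
  qed
  ultimately show ?thesis
    using r(1) by (auto simp: cut_plane_iff neq_iff)
next
  case False
  define X where "X = 1 / (cmod u)\<^sup>2"
  have "1 < X"
    using norm_sq_inverse_gt_one[OF assms] by (simp only: X_def)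
  then have "Im ((u + 1 / u) / 2) \<noteq> 0"
    unfolding Im_joukowski X_def[symmetric] using False by simp
  then show ?thesis
    unfolding cut_plane_iff by blast
qed

text \<open>As (\<xi> - s) (\<xi> + s) = 1, take u = \<xi> - s, whose inverse is \<xi> + s. The
  chosen branch is \<xi> times a root with positive real part, which makes u the smaller of the two
  factors.\<close>

lemma cut_plane_param:
  assumes "\<xi> \<in> cut_plane"
  obtains u where "u \<noteq> 0" "cmod u < 1" "\<xi> = (u + 1 / u) / 2" "sqrt_cut \<xi> = (1 / u - u) / 2"
proof -
  define q where "q = csqrt (1 - 1 / \<xi>\<^sup>2)"
  define s where "s = sqrt_cut \<xi>"
  have s: "s = \<xi> * q" "s\<^sup>2 = \<xi>\<^sup>2 - 1"
    using sqrt_cut_square[OF assms] by (auto simp: s_def q_def sqrt_cut_def)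
  have q: "0 < Re q"
    unfolding q_def by (rule Re_csqrt_pos[OF cut_not_nonpos[OF assms]])
  have prod: "(\<xi> - s) * (\<xi> + s) = 1"
    using s(2) by (simp add: power2_eq_square algebra_simps)
  have "cmod (\<xi> - s) = cmod \<xi> * cmod (1 - q)" "cmod (\<xi> + s) = cmod \<xi> * cmod (1 + q)"
    unfolding s(1) norm_mult[symmetric] by (simp_all add: algebra_simps)
  moreover have "cmod (1 - q) < cmod (1 + q)"
    using cmod_diff_less_cmod_add[OF q, of 1] by (simp add: norm_minus_commute add.commute)
  ultimately have less: "cmod (\<xi> - s) < cmod (\<xi> + s)"
    using cut_nonzero[OF assms] by simp
  define u where "u = \<xi> - s"
  have u0: "u \<noteq> 0"
    using prod by (auto simp: u_def)
  have inv: "1 / u = \<xi> + s"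
    using prod u0 by (simp add: u_def field_simps)
  have "cmod u * cmod u < cmod u * cmod (\<xi> + s)"
    using less u0 by (intro mult_strict_left_mono) (auto simp: u_def)
  also have "\<dots> = 1"
    using prod by (simp add: u_def flip: norm_mult)
  finally have "cmod u < 1"
    by (simp add: abs_square_less_1 flip: power2_eq_square)
  show thesis
  proof (rule that[OF u0 \<open>cmod u < 1\<close>])
    show "\<xi> = (u + 1 / u) / 2" "sqrt_cut \<xi> = (1 / u - u) / 2"
      unfolding inv by (simp_all add: u_def s_def)
  qed
qed

lemma sqrt_cut_nz: "\<xi> \<in> cut_plane \<Longrightarrow> sqrt_cut \<xi> \<noteq> 0"
proof -
  assume "\<xi> \<in> cut_plane"
  then have "csqrt (1 - 1 / \<xi>\<^sup>2) \<noteq> 0"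
    using Re_csqrt_pos[OF cut_not_nonpos, of \<xi>] by auto
  then show ?thesis
    using cut_nonzero[of \<xi>] \<open>\<xi> \<in> cut_plane\<close> by (simp add: sqrt_cut_def)
qed

lemma cut_plane_open: "open cut_plane"
  unfolding cut_plane_def
  by (intro open_Compl compact_imp_closed compact_continuous_image continuous_intros compact_Icc)

lemma nonreal_subset_cut: "- \<real> \<subseteq> cut_plane"
  by (auto simp: cut_plane_iff complex_is_Real_iff)

lemma eventually_cut_plane: "\<forall>\<^sub>F \<xi> in at_infinity. \<xi> \<in> cut_plane"
  unfolding eventually_at_infinity
proof (intro exI[of _ 2] allI impI)
  fix \<xi> :: complex assume "2 \<le> norm \<xi>"
  then show "\<xi> \<in> cut_plane"
    by (cases "Im \<xi> = 0") (auto simp: cut_plane_iff cmod_eq_Re)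
qed

text \<open>Vertical approach to \<open>x\<close> from both sides. It supplies real forms of
  \<open>M\<close> on the real axis outside [-1,1], where the definition of the class states no
  adjoint relation.\<close>

lemma Im_eq_0_of_sign_change:
  assumes "isCont f (of_real x)"
    and "\<And>z. 0 < Im z \<Longrightarrow> 0 \<le> Im (f z)" "\<And>z. Im z < 0 \<Longrightarrow> Im (f z) \<le> 0"
  shows "Im (f (of_real x)) = 0"
proof (rule antisym)
  have lim: "(\<lambda>n. Im (f (of_real x + of_real (c / real (Suc n)) * \<i>))) \<longlonglongrightarrow> Im (f (of_real x))" for c
  proof (intro tendsto_Im isCont_tendsto_compose[OF assms(1)])
    have "(\<lambda>n. of_real x + of_real (c * inverse (real (Suc n))) * \<i>) \<longlonglongrightarrow> of_real x + of_real (c * 0) * \<i>"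
      by (intro tendsto_intros LIMSEQ_inverse_real_of_nat)
    then show "(\<lambda>n. of_real x + of_real (c / real (Suc n)) * \<i>) \<longlonglongrightarrow> of_real x"
      by (simp add: divide_inverse)
  qed
  show "Im (f (of_real x)) \<le> 0"
    by (rule tendsto_upperbound[OF lim[of "-1"]]) (auto intro!: always_eventually assms(3))
  show "0 \<le> Im (f (of_real x))"
    by (rule tendsto_lowerbound[OF lim[of 1]]) (auto intro!: always_eventually assms(2))
qed

section \<open>Coercivity in the class, and the action of \<open>Gam\<close>\<close>

context
  fixes M :: "complex \<Rightarrow> 'a::chilbert_space \<Rightarrow>\<^sub>L 'a"
  assumes N0: "M \<in> N0"
begin

lemma
  shows N0_extensional: "M \<in> extensional cut_plane"
    and N0_clinear: "\<xi> \<in> cut_plane \<Longrightarrow> clinear_op (M \<xi>)"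
    and N0_holomorphic: "op_holomorphic_on M cut_plane"
    and N0_adjoint: "Im \<xi> \<noteq> 0 \<Longrightarrow> cinner (M \<xi> f) g = cinner f (M (cnj \<xi>) g)"
    and N0_Im: "0 < Im \<xi> \<Longrightarrow> 0 \<le> Im (cinner (M \<xi> f) f)"
    and N0_lim: "((\<lambda>\<xi>. \<xi> *\<^sub>C M \<xi>) \<longlongrightarrow> - id_blinfun) at_infinity"
  using N0 by (auto simp: N0_def nevanlinna_iff)

lemma N0_Im_neg: "Im \<xi> < 0 \<Longrightarrow> Im (cinner (M \<xi> f) f) \<le> 0"
proof -
  assume \<xi>: "Im \<xi> < 0"
  have "cinner (M \<xi> f) f = cnj (cinner (M (cnj \<xi>) f) f)"
    using N0_adjoint[of \<xi> f f] \<xi> by (metis cinner_commute less_irrefl)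
  then show ?thesis
    using N0_Im[of "cnj \<xi>" f] \<xi> by simp
qed

text \<open>
  With \<open>\<xi> = (u + 1/u) / 2\<close> and \<open>s = sqrt_cut \<xi> = (1/u - u) / 2\<close>, the function
  \<open>- s (M(\<xi>) g, g)\<close> of \<open>u\<close> extends to the disk with the value \<open>\<parallel>g\<parallel>\<^sup>2\<close> at \<open>0\<close>.
\<close>

lemma N0_disk_function:
  obtains n where "n holomorphic_on ball 0 1" "n 0 = 2 * of_real ((norm g)\<^sup>2)"
    "\<And>u. u \<noteq> 0 \<Longrightarrow> cmod u < 1 \<Longrightarrow> u * n u = - cinner (M ((u + 1 / u) / 2) g) g"
proof -
  define J where "J u = (u + 1 / u) / 2" for u :: complex
  define m where "m \<xi> = cinner (M \<xi> g) g" for \<xi>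
  \<comment> \<open>Near 0 the point \<open>J u\<close> is close to \<open>1 / (2 * u)\<close>, and
    \<xi> m(\<xi>) tends to minus the squared norm of \<open>g\<close> at infinity; hence the
    removable value with the factor 2.\<close>
  define n where "n u = (if u = 0 then 2 * of_real ((norm g)\<^sup>2) else - m (J u) / u)" for u
  have n0: "n 0 = 2 * of_real ((norm g)\<^sup>2)"
    by (simp add: n_def)
  have nJ: "u * n u = - cinner (M ((u + 1 / u) / 2) g) g" if "u \<noteq> 0" "cmod u < 1" for u
    using that by (simp add: n_def m_def J_def)
  have hol: "n holomorphic_on ball 0 1"
  proof (rule no_isolated_singularity'[where K = "{0}"])
    have J: "J u \<in> cut_plane" if "u \<in> ball 0 1 - {0}" for u
      using that joukowski_cut_plane[of u] by (simp add: J_def)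
    have m: "m holomorphic_on cut_plane"
      unfolding m_def[abs_def] by (intro holomorphic_cinner N0_holomorphic)
    have "J holomorphic_on ball 0 1 - {0}"
      unfolding J_def[abs_def] by (intro holomorphic_intros) auto
    then have "(m \<circ> J) holomorphic_on ball 0 1 - {0}"
      by (rule holomorphic_on_compose_gen[OF _ m]) (use J in blast)
    then have "(\<lambda>u. - m (J u) / u) holomorphic_on ball 0 1 - {0}"
      by (intro holomorphic_intros) (auto simp: o_def)
    then show "n holomorphic_on ball 0 1 - {0}"
      by (rule holomorphic_transform) (simp add: n_def)
    fix v :: complex assume "v \<in> {0}"
    have "filterlim (\<lambda>u. u + 1 / u) at_infinity (at (0::complex))"
      by (intro tendsto_add_filterlim_at_infinity[where c = 0] tendsto_ident_at)
        (simp add: filterlim_inverse_at_infinity flip: inverse_eq_divide)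
    then have "filterlim (\<lambda>u::complex. (1 / 2) * (u + 1 / u)) at_infinity (at 0)"
      by (intro tendsto_mult_filterlim_at_infinity[OF tendsto_const]) auto
    then have "filterlim J at_infinity (at 0)"
      by (simp add: J_def[abs_def])
    then have "((\<lambda>u. J u *\<^sub>C M (J u)) \<longlongrightarrow> - id_blinfun) (at 0)"
      by (rule filterlim_compose[OF N0_lim])
    then have "((\<lambda>u. - cinner ((J u *\<^sub>C M (J u)) g) g / ((u * u + 1) / 2))
        \<longlongrightarrow> - cinner ((- id_blinfun) g) g / ((0 * 0 + 1) / 2)) (at 0)"
      by (intro tendsto_intros cinner.tendsto blinfun.tendsto) auto
    moreover have "\<forall>\<^sub>F u in at 0. - cinner ((J u *\<^sub>C M (J u)) g) g / ((u * u + 1) / 2) = n u"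
    proof -
      have "\<forall>\<^sub>F u in at 0. u \<in> ball 0 1 - {0::complex}"
        by (intro eventually_at_in_open) auto
      then show ?thesis
      proof eventually_elim
        case (elim u)
        have "u * u + 1 \<noteq> 0"
        proof
          assume "u * u + 1 = 0"
          then have "cmod (u * u) = 1"
            by (metis add_eq_0_iff norm_minus_cancel norm_one)
          moreover have "cmod u * cmod u < 1 * 1"
            using elim by (intro mult_strict_mono) auto
          ultimately show False
            by (simp add: norm_mult)
        qed
        moreover have "J u = ((u * u + 1) / 2) / u"
          using elim by (simp add: J_def field_simps)
        ultimately show ?case
          using elim by (simp add: n_def cinner_scaleC_left m_def)
      qed
    qed
    ultimately have "(n \<longlongrightarrow> - cinner ((- id_blinfun) g) g / ((0 * 0 + 1) / 2)) (at 0)"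
      by (rule Lim_transform_eventually)
    moreover have "- cinner ((- id_blinfun) g) g / ((0 * 0 + 1) / 2) = n 0"
      by (simp add: n_def blinfun.minus_left cinner.minus_left cinner_self)
    ultimately have "(n \<longlongrightarrow> n 0) (at 0)"
      by metis
    then show "(n \<longlongrightarrow> n v) (at v within ball 0 1)"
      using \<open>v \<in> {0}\<close> by (simp add: tendsto_within_subset[of _ _ _ UNIV])
  qed auto
  show thesis
    by (rule that[OF hol n0 nJ])
qed

text \<open>The function \<open>u * n u\<close> is typically real, since the Joukowski map and the
  minus sign each reverse the sign of imaginary parts. Carrying
  \<open>(1 - u\<^sup>2) * n u / 2\<close> to the right half plane by
  \<open>\<zeta> = (1 + u) / (1 - u)\<close> gives \<open>P\<close> with
  \<open>P \<zeta> = p\<close> and \<open>P 1\<close> equal to the squared norm of \<open>g\<close>;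
  Harnack's inequality and the sector bound apply to \<open>P\<close>.\<close>

lemma N0_positive:
  fixes g :: 'a
  assumes u: "u \<noteq> 0" "cmod u < 1"
  defines "p \<equiv> - ((1 / u - u) / 2) * cinner (M ((u + 1 / u) / 2) g) g"
    and "\<zeta> \<equiv> (1 + u) / (1 - u)"
  shows "(norm g)\<^sup>2 * Re \<zeta> \<le> Re p * ((cmod \<zeta>)\<^sup>2 + 1)"
    and "\<bar>Im p\<bar> * Re \<zeta> \<le> Re p * \<bar>Im \<zeta>\<bar>" and "0 \<le> Re p"
proof -
  obtain n where n: "n holomorphic_on ball 0 1" "n 0 = 2 * of_real ((norm g)\<^sup>2)"
    "\<And>u. u \<noteq> 0 \<Longrightarrow> cmod u < 1 \<Longrightarrow> u * n u = - cinner (M ((u + 1 / u) / 2) g) g"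
    using N0_disk_function by blast
  have tr: "0 \<le> Im v * Im (v * n v)" if v: "cmod v < 1" for v
  proof (cases "v = 0 \<or> Im v = 0")
    case False
    define \<xi> where "\<xi> = (v + 1 / v) / 2"
    have e: "Im \<xi> = - Im v * ((1 / (cmod v)\<^sup>2 - 1) / 2)"
      unfolding \<xi>_def Im_joukowski by simp
    have pos: "0 < (1 / (cmod v)\<^sup>2 - 1) / 2"
      using norm_sq_inverse_gt_one[of v] v False by auto
    show ?thesis
    proof (cases "0 < Im v")
      case True
      then have "Im \<xi> < 0"
        unfolding e using pos by simp
      then show ?thesis
        using N0_Im_neg[of \<xi> g] True n(3)[of v] v False by (simp add: \<xi>_def mult_nonneg_nonpos)
    next
      case neg: False
      then have "0 < Im \<xi>"
        unfolding e using pos False by (simp add: mult_neg_pos)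
      then show ?thesis
        using N0_Im[of \<xi> g] neg n(3)[of v] v False by (simp add: \<xi>_def mult_nonpos_nonneg)
    qed
  qed auto
  have Re_n: "0 \<le> Re ((1 - v\<^sup>2) * n v)" if "cmod v < 1" for v
    by (rule typically_real_imp_Re_nonneg[OF n(1) tr that])
  have n_real: "Im (n (of_real x)) = 0" if x: "\<bar>x\<bar> < 1" for x
  proof (cases "x = 0")
    case False
    define \<xi> where "\<xi> = (x + 1 / x) / 2"
    have e: "(of_real x + 1 / of_real x) / 2 = (of_real \<xi> :: complex)"
      by (simp add: \<xi>_def)
    have "(of_real \<xi> :: complex) \<in> cut_plane"
      unfolding e[symmetric] using x False by (intro joukowski_cut_plane) auto
    moreover have "(\<lambda>\<xi>. cinner (M \<xi> g) g) holomorphic_on cut_plane"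
      by (intro holomorphic_cinner N0_holomorphic)
    ultimately have "isCont (\<lambda>\<xi>. cinner (M \<xi> g) g) (of_real \<xi>)"
      by (metis continuous_on_eq_continuous_at cut_plane_open holomorphic_on_imp_continuous_on)
    then have "Im (cinner (M (of_real \<xi>) g) g) = 0"
      by (rule Im_eq_0_of_sign_change) (auto intro: N0_Im N0_Im_neg)
    then have "Im (of_real x * n (of_real x)) = 0"
      using n(3)[of "of_real x"] x False by (simp add: e)
    then show ?thesis
      using False by simp
  qed (simp add: n(2))
  define c where "c z = (z - 1) / (z + 1)" for z :: complex
  have c: "cmod (c z) < 1" and z1: "z + 1 \<noteq> 0" if "0 < Re z" for z
    using cmod_diff_less_cmod_add[OF that, of 1] by (auto simp: c_def norm_divide divide_less_eq_1)
  define P where "P z = (1 - (c z)\<^sup>2) * n (c z) / 2" for z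
  have "c holomorphic_on {z. 0 < Re z}"
    unfolding c_def[abs_def] using z1 by (intro holomorphic_intros) auto
  moreover from this have "(n \<circ> c) holomorphic_on {z. 0 < Re z}"
    by (rule holomorphic_on_compose_gen[OF _ n(1)]) (use c in auto)
  ultimately have hol: "P holomorphic_on {z. 0 < Re z}"
    unfolding P_def[abs_def] by (intro holomorphic_intros) (auto simp: o_def)
  have ReP: "0 \<le> Re (P z)" if "0 < Re z" for z
    using Re_n[OF c[OF that]] by (simp add: P_def)
  have ImP: "Im (P (of_real x)) = 0" if "0 < x" for x
  proof -
    define y where "y = (x - 1) / (x + 1)"
    have cy: "c (of_real x) = of_real y"
      by (simp add: c_def y_def)
    then have "\<bar>y\<bar> < 1"
      using c[of "of_real x"] that by simp
    then have "Im (of_real ((1 - y\<^sup>2) / 2) * n (of_real y)) = 0"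
      by (simp add: n_real)
    then show ?thesis
      by (simp add: P_def cy)
  qed
  have u1: "u \<noteq> 1"
    using u(2) by auto
  have \<zeta>: "0 < Re \<zeta>" "c \<zeta> = u"
  proof -
    show "0 < Re \<zeta>"
      unfolding \<zeta>_def by (rule Re_cayley_pos[OF u(2)])
    have "\<zeta> - 1 = 2 * u / (1 - u)" "\<zeta> + 1 = 2 / (1 - u)"
      using u1 by (simp_all add: \<zeta>_def field_simps)
    then show "c \<zeta> = u"
      using u1 by (simp add: c_def)
  qed
  have "P \<zeta> = ((1 - u\<^sup>2) / (2 * u)) * (u * n u)"
    using u(1) by (simp add: P_def \<zeta>(2))
  also have "(1 - u\<^sup>2) / (2 * u) = (1 / u - u) / 2"
    using u(1) by (simp add: field_simps power2_eq_square)
  finally have p: "P \<zeta> = p"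
    unfolding p_def n(3)[OF u] by simp
  have "P 1 = of_real ((norm g)\<^sup>2)"
    by (simp add: P_def c_def n(2))
  then show "(norm g)\<^sup>2 * Re \<zeta> \<le> Re p * ((cmod \<zeta>)\<^sup>2 + 1)"
    using halfplane_harnack[OF hol ReP ImP \<zeta>(1)] by (simp add: p)
  show "\<bar>Im p\<bar> * Re \<zeta> \<le> Re p * \<bar>Im \<zeta>\<bar>" "0 \<le> Re p"
    using halfplane_sector[OF hol ReP ImP \<zeta>(1)] ReP[OF \<zeta>(1)] by (auto simp: p)
qed

text \<open>The Harnack constant depends on \<xi> through \<zeta> alone, so it serves all vectors
  \<open>g\<close>.\<close>

lemma N0_coercive:
  assumes "\<xi> \<in> cut_plane"
  obtains c where "0 < c" "\<And>g. c * (norm g)\<^sup>2 \<le> Re (- sqrt_cut \<xi> * cinner (M \<xi> g) g)"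
proof -
  obtain u where u: "u \<noteq> 0" "cmod u < 1" and \<xi>: "\<xi> = (u + 1 / u) / 2" "sqrt_cut \<xi> = (1 / u - u) / 2"
    using cut_plane_param[OF assms] .
  define \<zeta> where "\<zeta> = (1 + u) / (1 - u)"
  have pos: "0 < Re \<zeta>" "0 < (cmod \<zeta>)\<^sup>2 + 1"
    unfolding \<zeta>_def by (rule Re_cayley_pos[OF u(2)]) (simp add: add_nonneg_pos)
  show thesis
  proof (rule that)
    show "0 < Re \<zeta> / ((cmod \<zeta>)\<^sup>2 + 1)"
      using pos by simp
    show "Re \<zeta> / ((cmod \<zeta>)\<^sup>2 + 1) * (norm g)\<^sup>2 \<le> Re (- sqrt_cut \<xi> * cinner (M \<xi> g) g)" for g
      using N0_positive(1)[OF u, of g] pos(2) unfolding \<zeta>_def[symmetric] \<xi>(1)[symmetric] \<xi>(2)[symmetric]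
      by (simp add: pos_divide_le_eq mult.commute)
  qed
qed

text \<open>The claim is \<open>Im (s * p) \<ge> 0\<close>. In terms of \<open>t\<close> and
  \<open>a\<close> the sector bound reads \<bar>Im p\<bar> (1 - t) \<le> 2 a Re p, and 2 \<bar>Re
  u\<bar> \<le> 1 + t makes the possibly negative term \<open>Re s * Im p\<close> at most as large
  as \<open>Im s * Re p\<close>.\<close>

lemma N0_Im_le:
  assumes "0 < Im \<xi>"
  shows "Im ((\<xi>\<^sup>2 - 1) * cinner (M \<xi> g) g) \<le> 0"
proof -
  have cut: "\<xi> \<in> cut_plane"
    using assms by (simp add: cut_plane_iff)
  obtain u where u: "u \<noteq> 0" "cmod u < 1" and \<xi>: "\<xi> = (u + 1 / u) / 2" "sqrt_cut \<xi> = (1 / u - u) / 2"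
    using cut_plane_param[OF cut] .
  define s where "s = sqrt_cut \<xi>"
  define p where "p = - s * cinner (M \<xi> g) g"
  define t where "t = (cmod u)\<^sup>2"
  define a where "a = - Im u"
  have t: "0 < t" "t < 1"
    using u by (auto simp: t_def abs_square_less_1)
  have "0 < a * ((1 / t - 1) / 2)"
    using assms unfolding \<xi>(1) Im_joukowski by (simp add: t_def a_def)
  moreover have "0 < (1 / t - 1) / 2"
    using t by simp
  ultimately have a: "0 < a"
    by (simp add: zero_less_mult_iff)
  have Im_s: "Im s = a * (1 + t) / (2 * t)" and Re_s: "Re s = Re u * (1 - t) / (2 * t)"
    unfolding s_def \<xi>(2) using t(1)
    by (simp_all add: Im_one_divide Re_one_divide a_def del: Im_divide Re_divide flip: t_def)
      (simp_all add: field_simps)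
  have "(1 + u) / (1 - u) = Complex (1 - t) (2 * Im u) / of_real ((cmod (1 - u))\<^sup>2)"
  proof -
    have "of_real ((cmod (1 - u))\<^sup>2) = (1 - u) * (1 - cnj u)"
      by (simp only: complex_norm_square) simp
    moreover have "u \<noteq> 1"
      using u(2) by auto
    then have "(1 + u) / (1 - u) = ((1 + u) * (1 - cnj u)) / ((1 - u) * (1 - cnj u))"
      by simp
    moreover have "(1 + u) * (1 - cnj u) = Complex (1 - t) (2 * Im u)"
      unfolding t_def cmod_power2 by (simp add: complex_eq_iff power2_eq_square algebra_simps)
    ultimately show ?thesis
      by (simp only:)
  qed
  then have "Re ((1 + u) / (1 - u)) = (1 - t) / (cmod (1 - u))\<^sup>2" "\<bar>Im ((1 + u) / (1 - u))\<bar> = 2 * a / (cmod (1 - u))\<^sup>2"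
    using a by (auto simp: a_def Re_divide_of_real Im_divide_of_real simp del: of_real_power Re_divide Im_divide)
  moreover have "0 < (cmod (1 - u))\<^sup>2"
    using u(2) by auto
  moreover have sector: "\<bar>Im p\<bar> * Re ((1 + u) / (1 - u)) \<le> Re p * \<bar>Im ((1 + u) / (1 - u))\<bar>" and Rep: "0 \<le> Re p"
    using N0_positive(2,3)[OF u, of g] unfolding \<xi>(1)[symmetric] \<xi>(2)[symmetric] s_def[symmetric] p_def[symmetric]
    by blast+
  ultimately have "\<bar>Im p\<bar> * (1 - t) \<le> Re p * (2 * a)"
    by (simp add: divide_le_cancel)
  then have "\<bar>Re u\<bar> * (\<bar>Im p\<bar> * (1 - t)) \<le> \<bar>Re u\<bar> * (Re p * (2 * a))"
    by (rule mult_left_mono) simp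
  also have "\<dots> = (2 * \<bar>Re u\<bar>) * (Re p * a)"
    by simp
  also have "\<dots> \<le> (1 + t) * (Re p * a)"
  proof (intro mult_right_mono)
    have "2 * \<bar>Re u\<bar> \<le> 1 + (Re u)\<^sup>2"
      using sum_squares_bound[of 1 "\<bar>Re u\<bar>"] by simp
    also have "\<dots> \<le> 1 + t"
      by (simp add: t_def cmod_power2)
    finally show "2 * \<bar>Re u\<bar> \<le> 1 + t" .
  qed (use Rep a in simp)
  finally have "\<bar>Re u * (1 - t) * Im p\<bar> \<le> a * (1 + t) * Re p"
    using t by (simp add: abs_mult mult_ac)
  then have "0 \<le> (a * (1 + t) * Re p + Re u * (1 - t) * Im p) / (2 * t)"
    using t(1) by (intro divide_nonneg_pos) auto
  also have "\<dots> = Im (s * p)"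
    unfolding times_complex.sel Im_s Re_s by (simp add: add_divide_distrib)
  also have "s * p = - ((\<xi>\<^sup>2 - 1) * cinner (M \<xi> g) g)"
    unfolding p_def sqrt_cut_square[OF cut, symmetric] s_def[symmetric] by (simp add: power2_eq_square)
  finally show ?thesis
    by simp
qed

lemma N0_invertible: "\<xi> \<in> cut_plane \<Longrightarrow> op_invertible (M \<xi>)"
proof -
  assume \<xi>: "\<xi> \<in> cut_plane"
  then obtain c where "0 < c" "\<And>g. c * (norm g)\<^sup>2 \<le> Re (- sqrt_cut \<xi> * cinner (M \<xi> g) g)"
    using N0_coercive by blast
  then show ?thesis
    using sqrt_cut_nz[OF \<xi>] by (intro coercive_invertible_complex[where a = "- sqrt_cut \<xi>"]) auto
qed

lemma Gam_apply: "\<xi> \<in> cut_plane \<Longrightarrow> Gam M \<xi> (M \<xi> g) = (1 / (\<xi>\<^sup>2 - 1)) *\<^sub>C g"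
  using apply_op_inv_left[OF N0_invertible, of \<xi> g] by (simp add: Gam_def)

lemma N0_surj:
  assumes "\<xi> \<in> cut_plane"
  obtains g where "f = M \<xi> g"
  using apply_op_inv_right[OF N0_invertible[OF assms], of f] by metis

lemma Gam_holomorphic: "op_holomorphic_on (Gam M) cut_plane"
proof -
  have "\<xi>\<^sup>2 - 1 \<noteq> 0" if "\<xi> \<in> cut_plane" for \<xi>
    using sqrt_cut_nz[OF that] sqrt_cut_square[OF that] by (metis power_not_zero)
  then have "op_holomorphic_on (\<lambda>\<xi>. (1 / (\<xi>\<^sup>2 - 1)) *\<^sub>C op_inv (M \<xi>)) cut_plane"
    by (intro op_holomorphic_intros holomorphic_intros N0_holomorphic N0_invertible N0_clinear)
  then show ?thesis
    by (rule op_holomorphic_cong) (simp add: Gam_def)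
qed

lemma Gam_clinear: "\<xi> \<in> cut_plane \<Longrightarrow> clinear_op (Gam M \<xi>)"
  by (auto simp: Gam_def intro!: clinear_intros clinear_op_inv N0_clinear N0_invertible)

text \<open>Write \<xi> \<open>Gam M\<close> \<xi> as \<open>1 / (1 - 1 / \<xi>\<^sup>2)\<close>
  times the inverse of \<xi> M(\<xi>). The inverse is continuous at the limit
  \<open>- id_blinfun\<close>, which is its own inverse.\<close>

lemma Gam_lim: "((\<lambda>\<xi>. \<xi> *\<^sub>C Gam M \<xi>) \<longlongrightarrow> - id_blinfun) at_infinity"
proof -
  have ev: "\<forall>\<^sub>F \<xi> in at_infinity. \<xi> \<in> cut_plane \<and> \<xi> \<noteq> 0"
    using eventually_cut_plane by (rule eventually_mono) (simp add: cut_nonzero)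
  have inv: "op_invertible (\<xi> *\<^sub>C M \<xi>)" "op_inv (\<xi> *\<^sub>C M \<xi>) = (1 / \<xi>) *\<^sub>C op_inv (M \<xi>)"
    if \<xi>: "\<xi> \<in> cut_plane \<and> \<xi> \<noteq> 0" for \<xi>
  proof -
    let ?B = "(1 / \<xi>) *\<^sub>C op_inv (M \<xi>)"
    have 1: "?B o\<^sub>L (\<xi> *\<^sub>C M \<xi>) = id_blinfun" "(\<xi> *\<^sub>C M \<xi>) o\<^sub>L ?B = id_blinfun"
      using \<xi> N0_invertible[of \<xi>] clinear_opD[OF N0_clinear, of \<xi>]
        clinear_opD[OF clinear_op_inv[OF N0_invertible N0_clinear], of \<xi>]
      by (auto intro!: blinfun_eqI simp: scaleC_scaleC scaleC_one)
    then show "op_invertible (\<xi> *\<^sub>C M \<xi>)"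
      unfolding op_invertible_def by blast
    show "op_inv (\<xi> *\<^sub>C M \<xi>) = ?B"
      by (rule op_inv_eq[OF 1])
  qed
  have id: "(- id_blinfun) o\<^sub>L (- id_blinfun) = (id_blinfun :: 'a \<Rightarrow>\<^sub>L 'a)"
    by (auto intro!: blinfun_eqI simp: blinfun.minus_left blinfun.minus_right)
  have "((\<lambda>\<xi>. op_inv (\<xi> *\<^sub>C M \<xi>)) \<longlongrightarrow> op_inv (- id_blinfun)) at_infinity"
    using ev inv id by (intro tendsto_op_inv N0_lim) (auto simp: op_invertible_def elim!: eventually_mono)
  then have "((\<lambda>\<xi>. op_inv (\<xi> *\<^sub>C M \<xi>)) \<longlongrightarrow> - id_blinfun) at_infinity"
    by (simp only: op_inv_eq[OF id id])
  moreover have "((\<lambda>\<xi>::complex. 1 / (1 - inverse \<xi> * inverse \<xi>)) \<longlongrightarrow> 1 / (1 - 0 * 0)) at_infinity"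
    by (intro tendsto_intros tendsto_inverse_0) auto
  ultimately have "((\<lambda>\<xi>. (1 / (1 - inverse \<xi> * inverse \<xi>)) *\<^sub>C op_inv (\<xi> *\<^sub>C M \<xi>))
      \<longlongrightarrow> (1 / (1 - 0 * 0)) *\<^sub>C (- id_blinfun)) at_infinity"
    by (intro scaleC_op.tendsto)
  then have "((\<lambda>\<xi>. (1 / (1 - inverse \<xi> * inverse \<xi>)) *\<^sub>C op_inv (\<xi> *\<^sub>C M \<xi>)) \<longlongrightarrow> - id_blinfun) at_infinity"
    by (simp add: scaleC_op_one)
  moreover have "\<forall>\<^sub>F \<xi> in at_infinity. (1 / (1 - inverse \<xi> * inverse \<xi>)) *\<^sub>C op_inv (\<xi> *\<^sub>C M \<xi>) = \<xi> *\<^sub>C Gam M \<xi>"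
    using ev
  proof eventually_elim
    case (elim \<xi>)
    then have "1 / (1 - inverse \<xi> * inverse \<xi>) * (1 / \<xi>) = \<xi> * (1 / (\<xi>\<^sup>2 - 1))"
      by (simp add: field_simps power2_eq_square)
    then show ?case
      unfolding inv(2)[OF elim] scaleC_op_scaleC using elim by (simp add: Gam_def scaleC_op_scaleC)
  qed
  ultimately show ?thesis
    by (rule Lim_transform_eventually)
qed

lemma Gam_N0: "Gam M \<in> N0"
proof -
  have "nevanlinna (Gam M)"
    unfolding nevanlinna_iff
  proof (intro conjI allI impI)
    show "op_holomorphic_on (Gam M) (- \<real>)"
      by (rule op_holomorphic_subset[OF Gam_holomorphic nonreal_subset_cut])
    fix z f g
    show "clinear_op (Gam M z)" if "Im z \<noteq> 0"
      using that by (intro Gam_clinear) (simp add: cut_plane_iff)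
    show "cinner (Gam M z f) g = cinner f (Gam M (cnj z) g)" if z: "Im z \<noteq> 0"
    proof -
      have cut: "z \<in> cut_plane" "cnj z \<in> cut_plane"
        using z by (simp_all add: cut_plane_iff)
      obtain a where f: "f = M z a"
        using N0_surj[OF cut(1)] .
      obtain b where g: "g = M (cnj z) b"
        using N0_surj[OF cut(2)] .
      show ?thesis
        unfolding f g Gam_apply[OF cut(1)] Gam_apply[OF cut(2)]
        by (simp add: cinner_scaleC_left cinner_scaleC_right N0_adjoint[OF z])
    qed
    show "0 \<le> Im (cinner (Gam M z f) f)" if z: "0 < Im z"
    proof -
      have cut: "z \<in> cut_plane"
        using z by (simp add: cut_plane_iff)
      obtain g where f: "f = M z g"
        using N0_surj[OF cut] .
      define d where "d = z\<^sup>2 - 1"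
      define w where "w = d * cinner (M z g) g"
      have "d \<noteq> 0"
        unfolding d_def
        using sqrt_cut_nz[OF cut] sqrt_cut_square[OF cut] by (metis power_not_zero)
      moreover have "cinner g (M z g) = cnj (cinner (M z g) g)"
        by (rule cinner_commute)
      ultimately have "cinner (Gam M z f) f = cnj w / of_real ((cmod d)\<^sup>2)"
        unfolding f Gam_apply[OF cut] complex_norm_square by (simp add: cinner_scaleC_left w_def flip: d_def)
      then have "Im (cinner (Gam M z f) f) = - Im w / (cmod d)\<^sup>2"
        by (simp only: Im_divide_of_real cnj.sel)
      then show ?thesis
        using N0_Im_le[OF z, of g] by (simp add: w_def d_def)
    qed
  qed
  moreover have "Gam M \<in> extensional cut_plane"
    by (simp add: Gam_def)
  ultimately show ?thesis
    using Gam_holomorphic Gam_clinear Gam_lim by (auto simp: N0_def)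
qed

end

section \<open>The fixed point of \<open>Gam\<close>, and uniqueness\<close>

lemma sqrt_cut_cnj: "\<xi> \<in> cut_plane \<Longrightarrow> sqrt_cut (cnj \<xi>) = cnj (sqrt_cut \<xi>)"
  using csqrt_cnj_not_nonpos[OF cut_not_nonpos, of \<xi>] by (simp add: sqrt_cut_def)

lemma sqrt_cut_Im:
  assumes "0 < Im \<xi>"
  shows "0 < Im (sqrt_cut \<xi>)"
proof -
  have cut: "\<xi> \<in> cut_plane"
    using assms by (simp add: cut_plane_iff)
  obtain u where u: "u \<noteq> 0" "cmod u < 1" and \<xi>: "\<xi> = (u + 1 / u) / 2" "sqrt_cut \<xi> = (1 / u - u) / 2"
    using cut_plane_param[OF cut] .
  have t: "1 < 1 / (cmod u)\<^sup>2"
    by (rule norm_sq_inverse_gt_one[OF u])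
  have "0 < - Im u * ((1 / (cmod u)\<^sup>2 - 1) / 2)"
    using assms unfolding \<xi>(1) Im_joukowski by simp
  then have "0 < - Im u"
    by (rule zero_less_mult_pos2) (use t in simp)
  moreover have "Im (sqrt_cut \<xi>) = - Im u * ((1 / (cmod u)\<^sup>2 + 1) / 2)"
    unfolding \<xi>(2) by (simp add: Im_one_divide del: Im_divide) (simp add: algebra_simps)
  ultimately show ?thesis
    using t by (simp only:) (intro mult_pos_pos, auto)
qed

lemma M0_holomorphic: "op_holomorphic_on M0 cut_plane"
proof -
  have "op_holomorphic_on (\<lambda>\<xi>. - ((1 / sqrt_cut \<xi>) *\<^sub>C (id_blinfun :: 'a \<Rightarrow>\<^sub>L 'a))) cut_plane"
    by (intro op_holomorphic_intros holomorphic_intros sqrt_cut_holomorphic sqrt_cut_nz)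
  then show ?thesis
    by (rule op_holomorphic_cong) (simp add: M0_def)
qed

lemma M0_clinear: "\<xi> \<in> cut_plane \<Longrightarrow> clinear_op (M0 \<xi>)"
  by (auto simp: M0_def intro!: clinear_intros)

lemma M0_apply: "\<xi> \<in> cut_plane \<Longrightarrow> M0 \<xi> f = (- 1 / sqrt_cut \<xi>) *\<^sub>C f"
  by (simp add: M0_def blinfun.minus_left scaleC.minus_left)

lemma M0_lim: "((\<lambda>\<xi>. \<xi> *\<^sub>C M0 \<xi>) \<longlongrightarrow> (- id_blinfun :: 'a::chilbert_space \<Rightarrow>\<^sub>L 'a)) at_infinity"
proof -
  have "((\<lambda>\<xi>::complex. 1 - inverse \<xi> * inverse \<xi>) \<longlongrightarrow> 1 - 0 * 0) at_infinity"
    by (intro tendsto_intros tendsto_inverse_0)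
  then have "((\<lambda>\<xi>::complex. csqrt (1 - inverse \<xi> * inverse \<xi>)) \<longlongrightarrow> csqrt (1 - 0 * 0)) at_infinity"
    by (rule isCont_tendsto_compose[rotated]) (simp add: continuous_at_csqrt)
  then have "((\<lambda>\<xi>. (- 1 / csqrt (1 - inverse \<xi> * inverse \<xi>)) *\<^sub>C (id_blinfun :: 'a \<Rightarrow>\<^sub>L 'a))
      \<longlongrightarrow> (- 1 / csqrt (1 - 0 * 0)) *\<^sub>C id_blinfun) at_infinity"
    by (intro tendsto_intros scaleC_op.tendsto) auto
  then have "((\<lambda>\<xi>. (- 1 / csqrt (1 - inverse \<xi> * inverse \<xi>)) *\<^sub>C (id_blinfun :: 'a \<Rightarrow>\<^sub>L 'a))
      \<longlongrightarrow> - id_blinfun) at_infinity"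
    by (simp add: scaleC_op.minus_left scaleC_op_one)
  moreover have "\<forall>\<^sub>F \<xi> in at_infinity. (- 1 / csqrt (1 - inverse \<xi> * inverse \<xi>)) *\<^sub>C (id_blinfun :: 'a \<Rightarrow>\<^sub>L 'a) = \<xi> *\<^sub>C M0 \<xi>"
    using eventually_cut_plane
  proof eventually_elim
    case (elim \<xi>)
    have "1 - inverse \<xi> * inverse \<xi> = 1 - 1 / \<xi>\<^sup>2"
      by (simp add: divide_inverse power2_eq_square)
    then show ?case
      using cut_nonzero[OF elim] elim
      by (intro blinfun_eqI) (simp add: M0_apply scaleC_scaleC sqrt_cut_def)
  qed
  ultimately show ?thesis
    by (rule Lim_transform_eventually)
qed

lemma M0_N0: "M0 \<in> N0"
proof -
  have "nevanlinna (M0 :: _ \<Rightarrow> 'a \<Rightarrow>\<^sub>L 'a)"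
    unfolding nevanlinna_iff
  proof (intro conjI allI impI)
    show "op_holomorphic_on (M0 :: _ \<Rightarrow> 'a \<Rightarrow>\<^sub>L 'a) (- \<real>)"
      by (rule op_holomorphic_subset[OF M0_holomorphic nonreal_subset_cut])
    fix z f and g :: 'a
    show "clinear_op (M0 z :: 'a \<Rightarrow>\<^sub>L 'a)" if "Im z \<noteq> 0"
      using that by (intro M0_clinear) (simp add: cut_plane_iff)
    show "cinner (M0 z f) g = cinner f (M0 (cnj z) g)" if "Im z \<noteq> 0"
      using that by (simp add: cut_plane_iff M0_apply cinner_scaleC_left cinner_scaleC_right sqrt_cut_cnj)
    show "0 \<le> Im (cinner (M0 z f) f)" if z: "0 < Im z"
    proof -
      define w where "w = - 1 / sqrt_cut z"
      have "Im w = Im (sqrt_cut z) / (cmod (sqrt_cut z))\<^sup>2"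
        using Im_one_divide[of "sqrt_cut z"] by (simp add: w_def del: Im_divide)
      then have "0 \<le> Im w"
        using sqrt_cut_Im[OF z] by (simp del: Im_divide)
      moreover have "M0 z f = w *\<^sub>C f"
        using z by (simp add: M0_apply cut_plane_iff w_def)
      ultimately show ?thesis
        by (simp add: cinner_scaleC_left cinner_self flip: of_real_power)
    qed
  qed
  moreover have "(M0 :: _ \<Rightarrow> 'a \<Rightarrow>\<^sub>L 'a) \<in> extensional cut_plane"
    by (simp add: M0_def)
  ultimately show ?thesis
    using M0_holomorphic M0_clinear M0_lim by (auto simp: N0_def)
qed

lemma Gam_M0: "Gam M0 = M0"
proof (rule extensionalityI[OF N0_extensional[OF Gam_N0[OF M0_N0]] N0_extensional[OF M0_N0]])
  fix \<xi> assume \<xi>: "\<xi> \<in> cut_plane"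
  define s where "s = sqrt_cut \<xi>"
  have s: "s \<noteq> 0" "\<xi>\<^sup>2 - 1 = s * s"
    using sqrt_cut_nz[OF \<xi>] sqrt_cut_square[OF \<xi>] by (auto simp: s_def power2_eq_square)
  show "Gam M0 \<xi> = (M0 \<xi> :: 'a \<Rightarrow>\<^sub>L 'a)"
  proof (rule blinfun_eqI)
    fix f :: 'a
    have "f = M0 \<xi> (- s *\<^sub>C f)"
      using s(1) by (simp add: M0_apply[OF \<xi>] scaleC_scaleC scaleC_one flip: s_def)
    then have "Gam M0 \<xi> f = (1 / (\<xi>\<^sup>2 - 1)) *\<^sub>C (- s *\<^sub>C f)"
      using Gam_apply[OF M0_N0 \<xi>] by metis
    also have "\<dots> = M0 \<xi> f"
      using s(1) by (simp add: M0_apply[OF \<xi>] scaleC_scaleC s(2) flip: s_def)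
    finally show "Gam M0 \<xi> f = M0 \<xi> f" .
  qed
qed

text \<open>Here \<open>(1 - s M) (1 + s M) = 0\<close>, and \<open>1 - s M\<close> is coercive with
  constant 1 because the form of \<open>- s M\<close> has nonnegative real part.\<close>

lemma Gam_fixed_point_unique:
  assumes N0: "M \<in> N0" and fixed: "Gam M = M"
  shows "M = M0"
proof (rule extensionalityI[OF N0_extensional[OF N0] N0_extensional[OF M0_N0]])
  fix \<xi> assume \<xi>: "\<xi> \<in> cut_plane"
  define s where "s = sqrt_cut \<xi>"
  have s: "s \<noteq> 0" "\<xi>\<^sup>2 - 1 = s * s"
    using sqrt_cut_nz[OF \<xi>] sqrt_cut_square[OF \<xi>] by (auto simp: s_def power2_eq_square)
  note cl = clinear_opD[OF N0_clinear[OF N0 \<xi>]]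
  obtain c where c: "0 < c" "\<And>g. c * (norm g)\<^sup>2 \<le> Re (- s * cinner (M \<xi> g) g)"
    unfolding s_def using N0_coercive[OF N0 \<xi>] by blast
  have inv: "op_invertible (id_blinfun - s *\<^sub>C M \<xi>)"
  proof (rule coercive_invertible)
    fix g
    have "0 \<le> Re (- s * cinner (M \<xi> g) g)"
      using c(1) by (intro order_trans[OF _ c(2)]) simp
    then show "1 * (norm g)\<^sup>2 \<le> inner ((id_blinfun - s *\<^sub>C M \<xi>) g) g"
      by (simp add: inner_eq_Re_cinner blinfun.diff_left cinner.diff_left cinner_scaleC_left cinner_self
          flip: of_real_power)
  qed simp
  have MM: "M \<xi> (M \<xi> g) = (1 / (s * s)) *\<^sub>C g" for g
    using Gam_apply[OF N0 \<xi>, of g] unfolding fixed s(2) .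
  show "M \<xi> = M0 \<xi>"
  proof (rule blinfun_eqI)
    fix f
    define k where "k = f + s *\<^sub>C M \<xi> f"
    have "(id_blinfun - s *\<^sub>C M \<xi>) k = 0"
      using s(1)
      by (simp add: k_def blinfun.diff_left blinfun.add_right cl MM scaleC_add_right scaleC_scaleC scaleC_one)
    then have "k = 0"
      by (metis apply_op_inv_left[OF inv] blinfun.zero_right)
    then have "s *\<^sub>C M \<xi> f = - f"
      by (simp add: k_def add_eq_0_iff)
    then have "(1 / s) *\<^sub>C (s *\<^sub>C M \<xi> f) = (1 / s) *\<^sub>C (- f)"
      by simp
    then show "M \<xi> f = M0 \<xi> f"
      using s(1) by (simp add: scaleC_scaleC scaleC_one M0_apply[OF \<xi>] scaleC.minus_right scaleC.minus_left flip: s_def)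
  qed
qed

lemma M0_i: "M0 \<i> = (\<i> / of_real (sqrt 2)) *\<^sub>C id_blinfun"
proof -
  have "- 1 / (\<i> * c) = \<i> / c" for c
    by (cases "c = 0") (simp_all add: field_simps)
  from this[of "of_real (sqrt 2)"] show ?thesis
    by (intro blinfun_eqI) (simp add: M0_apply cut_plane_iff sqrt_cut_i)
qed

section \<open>Integrals with respect to the arcsine law\<close>

lemma measurable_mu0_iff: "f \<in> borel_measurable mu0 \<longleftrightarrow> f \<in> borel_measurable (restrict_space lborel {-1..1})"
  by (simp add: mu0_def)

lemma borel_measurable_mu0: "f \<in> borel_measurable borel \<Longrightarrow> f \<in> borel_measurable mu0"
  unfolding measurable_mu0_iff by (intro measurable_restrict_space1) simp

lemma AE_rho0_nonneg: "AE t in restrict_space lborel {-1..1}. 0 \<le> rho0 t"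
  by (intro AE_I2 rho0_nonneg) (simp add: space_restrict_space)

lemma rho0_measurable_restrict: "rho0 \<in> borel_measurable (restrict_space lborel {-1..1})"
  by (intro measurable_restrict_space1) simp

lemma
  fixes f :: "real \<Rightarrow> 'b::{banach,second_countable_topology}"
  assumes "f \<in> borel_measurable mu0"
  shows integral_mu0: "(LINT t|mu0. f t) = (LINT t|lborel. indicator {-1..1} t *\<^sub>R rho0 t *\<^sub>R f t)"
    and integrable_mu0: "integrable mu0 f \<longleftrightarrow> integrable lborel (\<lambda>t. indicator {-1..1} t *\<^sub>R rho0 t *\<^sub>R f t)"
proof -
  note f = assms[unfolded measurable_mu0_iff]
  show "(LINT t|mu0. f t) = (LINT t|lborel. indicator {-1..1} t *\<^sub>R rho0 t *\<^sub>R f t)"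
    unfolding mu0_def
    by (subst integral_density[OF f rho0_measurable_restrict AE_rho0_nonneg])
      (subst integral_restrict_space, simp_all add: set_lebesgue_integral_def)
  show "integrable mu0 f \<longleftrightarrow> integrable lborel (\<lambda>t. indicator {-1..1} t *\<^sub>R rho0 t *\<^sub>R f t)"
    unfolding mu0_def
    by (subst integrable_density[OF f rho0_measurable_restrict AE_rho0_nonneg])
      (subst integrable_restrict_space, simp_all add: set_integrable_def)
qed

lemma rho0_endpoints: "rho0 1 = 0" "rho0 (-1) = 0"
  by (simp_all add: rho0_def)

text \<open>Division by zero makes \<open>rho0\<close> vanish at the end points, so the closed and
  the open interval agree pointwise and not just almost everywhere.\<close>

lemma indicator_rho0: "indicator {-1..1} t * rho0 t = indicator {-1<..<1} t * rho0 t"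
  by (cases "t = 1 \<or> t = -1") (auto simp: rho0_endpoints indicator_def)

text \<open>The density is unbounded at both ends, so the improper form of the fundamental theorem
  is used, with \<open>K * rho0\<close> as integrable majorant. Continuity of \<open>f\<close> on
  the whole line supplies Borel measurability.\<close>

lemma integral_mu0_FTC:
  fixes f F :: "real \<Rightarrow> complex"
  assumes f: "continuous_on UNIV f" and F: "continuous_on {-1..1} F"
    and D: "\<And>t. -1 < t \<Longrightarrow> t < 1 \<Longrightarrow> (F has_vector_derivative rho0 t *\<^sub>R f t) (at t)"
  shows "(LINT t|mu0. f t) = F 1 - F (-1)"
proof -
  have fm [measurable]: "f \<in> borel_measurable borel"
    by (rule borel_measurable_continuous_onI[OF f])
  have "\<exists>K. \<forall>t\<in>{-1..1}. cmod (f t) \<le> K"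
    using compact_imp_bounded[OF compact_continuous_image[OF continuous_on_subset[OF f] compact_Icc], of "-1" 1]
    unfolding bounded_iff by auto
  then obtain K where K: "\<And>t. t \<in> {-1..1} \<Longrightarrow> cmod (f t) \<le> K"
    by blast
  have ei: "einterval (ereal (-1)) (ereal 1) = {-1<..<1}"
    by (auto simp: einterval_def)
  have int: "set_integrable lborel {-1<..<1} (\<lambda>t. rho0 t *\<^sub>R f t)"
    unfolding set_integrable_def
  proof (rule Bochner_Integration.integrable_bound)
    show "integrable lborel (\<lambda>t. K * (indicator {-1<..<1} t *\<^sub>R rho0 t))"
      using rho0_integral(1) unfolding set_integrable_def by (rule integrable_mult_right)
    show "AE t in lborel. norm (indicator {-1<..<1} t *\<^sub>R rho0 t *\<^sub>R f t) \<le> norm (K * (indicator {-1<..<1} t *\<^sub>R rho0 t))"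
    proof (intro AE_I2)
      fix t
      show "norm (indicator {-1<..<1} t *\<^sub>R rho0 t *\<^sub>R f t) \<le> norm (K * (indicator {-1<..<1} t *\<^sub>R rho0 t))"
        using K[of t] mult_right_mono[of "cmod (f t)" "\<bar>K\<bar>" "\<bar>rho0 t\<bar>"]
        by (auto simp: indicator_def abs_mult mult.commute)
    qed
  qed measurable
  have lims: "(F \<longlongrightarrow> F (-1)) (at_right (-1))" "(F \<longlongrightarrow> F 1) (at_left 1)"
  proof -
    have "(F \<longlongrightarrow> F (-1)) (at (-1) within {-1..1})" "(F \<longlongrightarrow> F 1) (at 1 within {-1..1})"
      using F by (simp_all add: continuous_on_def)
    then show "(F \<longlongrightarrow> F (-1)) (at_right (-1))" "(F \<longlongrightarrow> F 1) (at_left 1)"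
      by (simp_all add: at_within_Icc_at_right at_within_Icc_at_left)
  qed
  have "(LBINT t=ereal (-1)..ereal 1. rho0 t *\<^sub>R f t) = F 1 - F (-1)"
  proof (rule interval_integral_FTC_integrable)
    show "set_integrable lborel (einterval (ereal (-1)) (ereal 1)) (\<lambda>t. rho0 t *\<^sub>R f t)"
      unfolding ei by (rule int)
    show "((F \<circ> real_of_ereal) \<longlongrightarrow> F (-1)) (at_right (ereal (-1)))"
      unfolding ereal_tendsto_simps using lims(1) by (simp add: comp_def)
    show "((F \<circ> real_of_ereal) \<longlongrightarrow> F 1) (at_left (ereal 1))"
      unfolding ereal_tendsto_simps using lims(2) by (simp add: comp_def)
    fix t :: real assume t: "ereal (-1) < ereal t" "ereal t < ereal 1"
    show "(F has_vector_derivative rho0 t *\<^sub>R f t) (at t)"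
      using t by (intro D) auto
    have "t\<^sup>2 < 1"
      using t by (simp add: abs_square_less_1)
    then have "isCont rho0 t"
      unfolding rho0_def[abs_def] by (intro continuous_intros) auto
    moreover have "isCont f t"
      using f by (simp add: continuous_on_eq_continuous_at)
    ultimately show "isCont (\<lambda>t. rho0 t *\<^sub>R f t) t"
      by (intro continuous_intros)
  qed simp
  then have "(LBINT t:{-1<..<1}. rho0 t *\<^sub>R f t) = F 1 - F (-1)"
    using ei by (simp add: interval_lebesgue_integral_def)
  moreover have "(LINT t|mu0. f t) = (LINT t|lborel. (indicator {-1..1} t * rho0 t) *\<^sub>R f t)"
    by (subst integral_mu0) (auto intro: borel_measurable_mu0)
  ultimately show ?thesis
    unfolding indicator_rho0 set_lebesgue_integral_def by simp
qed

text \<open>The block \<open>op_D tau0\<close> vanishes by this; it decides the transfer function at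
  \<open>z = 0\<close>.\<close>

lemma integral_mu0_id: "(LINT t|mu0. complex_of_real t) = 0"
proof -
  have "(LINT t|mu0. complex_of_real t) = - complex_of_real (sqrt (1 - 1\<^sup>2) / pi) - (- complex_of_real (sqrt (1 - (-1)\<^sup>2) / pi))"
  proof (rule integral_mu0_FTC)
    show "continuous_on {-1..1} (\<lambda>t. - complex_of_real (sqrt (1 - t\<^sup>2) / pi))"
      by (intro continuous_intros) auto
    fix t :: real assume "-1 < t" "t < 1"
    then have "t\<^sup>2 < 1"
      by (simp add: abs_square_less_1)
    then have "((\<lambda>t. - (sqrt (1 - t\<^sup>2) / pi)) has_real_derivative rho0 t * t) (at t)"
      by (auto intro!: derivative_eq_intros simp: rho0_def field_simps)
    from has_vector_derivative_of_real[where 'a = complex, OF this]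
    show "((\<lambda>t. - complex_of_real (sqrt (1 - t\<^sup>2) / pi)) has_vector_derivative rho0 t *\<^sub>R complex_of_real t) (at t)"
      by (simp add: scaleR_conv_of_real)
  qed (intro continuous_intros)
  then show ?thesis
    by simp
qed

text \<open>
  With \<open>\<xi> = (u + 1/u) / 2\<close>, \<open>s = (1/u - u) / 2\<close> and \<open>e = t + \<i> sqrt (1 - t\<^sup>2)\<close>, the Poisson kernel identity
  \<open>s / (\<xi> - t) = 1 + u e / (1 - u e) + u / (e - u)\<close> gives an explicit primitive of \<open>rho0 t / (t - \<xi>)\<close>.
\<close>

lemma integral_mu0_resolvent:
  assumes "\<xi> \<in> cut_plane"
  shows "(LINT t|mu0. 1 / (complex_of_real t - \<xi>)) = - 1 / sqrt_cut \<xi>"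
proof -
  obtain u where u: "u \<noteq> 0" "cmod u < 1" and \<xi>: "\<xi> = (u + 1 / u) / 2" "sqrt_cut \<xi> = (1 / u - u) / 2"
    using cut_plane_param[OF assms] .
  define s where "s = sqrt_cut \<xi>"
  have s0: "s \<noteq> 0"
    unfolding s_def by (rule sqrt_cut_nz[OF assms])
  have nz: "complex_of_real t - \<xi> \<noteq> 0" if "t \<in> {-1..1}" for t
    using assms that by (auto simp: cut_plane_def)
  define e where "e t = complex_of_real t + \<i> * of_real (sqrt (1 - t\<^sup>2))" for t
  define e' where "e' t = complex_of_real t - \<i> * of_real (sqrt (1 - t\<^sup>2))" for t
  have ee': "e t * e' t = 1" "e t + e' t = 2 * of_real t" if "t \<in> {-1..1}" for t
  proof -
    have "0 \<le> 1 - t\<^sup>2"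
      using that by (auto simp: abs_square_le_1 abs_le_iff)
    then show "e t * e' t = 1" "e t + e' t = 2 * of_real t"
      by (simp_all add: e_def e'_def complex_eq_iff power2_eq_square)
  qed
  have norm_e: "cmod (e t) = 1" "cmod (e' t) = 1" if "t \<in> {-1..1}" for t
  proof -
    have "0 \<le> 1 - t\<^sup>2"
      using that by (auto simp: abs_square_le_1 abs_le_iff)
    then show "cmod (e t) = 1" "cmod (e' t) = 1"
      by (simp_all add: e_def e'_def cmod_def)
  qed
  have pos: "1 - u * a \<notin> \<real>\<^sub>\<le>\<^sub>0" if "cmod a = 1" for a
  proof -
    have "Re (u * a) < 1"
      using complex_Re_le_cmod[of "u * a"] u(2) that by (simp add: norm_mult)
    then show ?thesis
      by (auto simp: complex_nonpos_Reals_iff)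
  qed
  \<comment> \<open>The derivatives of \<open>e\<close> and \<open>e'\<close> are multiples of
    themselves, so each logarithm integrates one fraction of the Poisson kernel and
    \<open>arcsin\<close> the constant term. At the end points \<open>e\<close> and
    \<open>e'\<close> coincide, the logarithms cancel, and only the total increase pi of
    \<open>arcsin\<close> remains.\<close>
  define F where "F t = - 1 / (s * of_real pi) * (of_real (arcsin t) - \<i> * (Ln (1 - u * e t) - Ln (1 - u * e' t)))" for t
  \<comment> \<open>Clamping \<open>t\<close> to [-1,1] makes the integrand continuous on the whole
    line without changing it on the support.\<close>
  define f where "f t = 1 / (complex_of_real (max (-1) (min 1 t)) - \<xi>)" for t
  have "(LINT t|mu0. 1 / (complex_of_real t - \<xi>)) = (LINT t|mu0. f t)"
    by (intro Bochner_Integration.integral_cong refl) (auto simp: space_mu0 f_def)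
  also have "\<dots> = F 1 - F (-1)"
  proof (rule integral_mu0_FTC)
    show "continuous_on UNIV f"
      unfolding f_def[abs_def] using nz by (intro continuous_intros) auto
    have "continuous_on {-1..1} e" "continuous_on {-1..1} e'"
      unfolding e_def[abs_def] e'_def[abs_def] by (intro continuous_intros; auto)+
    then show "continuous_on {-1..1} F"
      unfolding F_def[abs_def] using pos norm_e s0
      by (intro continuous_intros continuous_on_Ln' continuous_on_arcsin') auto
    fix t :: real assume t: "-1 < t" "t < 1"
    then have tI: "t \<in> {-1..1}" and sq: "t\<^sup>2 < 1"
      by (auto simp: abs_square_less_1)
    define w where "w = sqrt (1 - t\<^sup>2)"
    have w: "0 < w"
      using sq by (simp add: w_def)
    have "((\<lambda>t. sqrt (1 - t\<^sup>2)) has_real_derivative - t / w) (at t)"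
      using sq by (auto intro!: derivative_eq_intros simp: w_def field_simps)
    then have dw: "((\<lambda>t. complex_of_real (sqrt (1 - t\<^sup>2))) has_vector_derivative of_real (- t / w)) (at t)"
      by (rule has_vector_derivative_of_real)
    have dt: "(complex_of_real has_vector_derivative 1) (at t)"
      using has_vector_derivative_of_real[OF DERIV_ident, of "at t"] by simp
    have "(e has_vector_derivative 1 + \<i> * of_real (- t / w)) (at t)"
      unfolding e_def[abs_def] by (intro derivative_intros dt dw)
    also have "1 + \<i> * of_real (- t / w) = - \<i> * e t / of_real w"
      using w by (simp add: e_def w_def[symmetric] field_simps)
    finally have de: "(e has_vector_derivative - \<i> * e t / of_real w) (at t)" .
    have "(e' has_vector_derivative 1 - \<i> * of_real (- t / w)) (at t)"
      unfolding e'_def[abs_def] by (intro derivative_intros dt dw)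
    also have "1 - \<i> * of_real (- t / w) = \<i> * e' t / of_real w"
      using w by (simp add: e'_def w_def[symmetric] field_simps)
    finally have de': "(e' has_vector_derivative \<i> * e' t / of_real w) (at t)" .
    have dLn: "((\<lambda>t. Ln (1 - u * a t)) has_vector_derivative - u * d / (1 - u * a t)) (at t)"
      if "(a has_vector_derivative d) (at t)" "cmod (a t) = 1" for a d
    proof -
      have "((\<lambda>t. 1 - u * a t) has_vector_derivative 0 - u * d) (at t)"
        by (intro derivative_intros that)
      moreover have "(Ln has_field_derivative inverse (1 - u * a t)) (at (1 - u * a t))"
        by (rule has_field_derivative_Ln[OF pos[OF that(2)]])
      ultimately have "(Ln \<circ> (\<lambda>t. 1 - u * a t) has_vector_derivative (0 - u * d) * inverse (1 - u * a t)) (at t)"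
        by (rule field_vector_diff_chain_at)
      then show ?thesis
        by (simp add: o_def divide_inverse)
    qed
    have "((\<lambda>t. arcsin t) has_real_derivative 1 / w) (at t)"
      using DERIV_arcsin[OF t] by (simp add: w_def inverse_eq_divide)
    then have dA: "((\<lambda>t. complex_of_real (arcsin t)) has_vector_derivative of_real (1 / w)) (at t)"
      by (rule has_vector_derivative_of_real)
    define Q where "Q = - u * (- \<i> * e t / of_real w) / (1 - u * e t) - - u * (\<i> * e' t / of_real w) / (1 - u * e' t)"
    have DF: "(F has_vector_derivative - 1 / (s * of_real pi) * (of_real (1 / w) - \<i> * Q)) (at t)"
      unfolding F_def[abs_def] Q_def
      by (intro derivative_intros dA dLn de de' norm_e tI)
    define x where "x = u * e t"
    define y where "y = u * e' t"
    have xy: "1 - x \<noteq> 0" "1 - y \<noteq> 0"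
      using pos[OF norm_e(1)[OF tI]] pos[OF norm_e(2)[OF tI]] by (auto simp: x_def y_def)
    have p: "(1 - x) * (1 - y) = 2 * u * (\<xi> - of_real t)"
    proof -
      have "(1 - x) * (1 - y) = 1 - u * (e t + e' t) + u * u * (e t * e' t)"
        by (simp add: x_def y_def algebra_simps)
      also have "\<dots> = 2 * u * (\<xi> - of_real t)"
        unfolding ee'[OF tI] \<xi>(1) using u(1) by (simp add: field_simps)
      finally show ?thesis .
    qed
    have q: "1 - x * y = 2 * u * s"
    proof -
      have "x * y = u * u * (e t * e' t)"
        by (simp add: x_def y_def)
      then show ?thesis
        unfolding ee'[OF tI] s_def \<xi>(2) using u(1) by (simp add: field_simps)
    qed
    define A where "A = x / (1 - x) + y / (1 - y)"
    have "Q = \<i> * A / of_real w"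
      by (simp add: Q_def A_def x_def y_def distrib_left add_divide_distrib mult_ac)
    then have "of_real (1 / w) - \<i> * Q = (1 + x / (1 - x) + y / (1 - y)) / of_real w"
      by (simp add: A_def[symmetric] add.assoc add_divide_distrib)
    also have "1 + x / (1 - x) + y / (1 - y) = (1 - x * y) / ((1 - x) * (1 - y))"
      using xy by (simp add: field_simps)
    also have "\<dots> = s / (\<xi> - of_real t)"
      unfolding p q using u(1) by simp
    finally have eq: "of_real (1 / w) - \<i> * Q = s / (\<xi> - of_real t) / of_real w" .
    define d where "d = \<xi> - of_real t"
    have d: "of_real t - \<xi> = - d"
      by (simp add: d_def)
    have "- 1 / (s * of_real pi) * (of_real (1 / w) - \<i> * Q) = rho0 t *\<^sub>R (1 / (of_real t - \<xi>))"
      unfolding eq d d_def[symmetric] using s0 by (simp add: rho0_def w_def[symmetric] scaleR_conv_of_real)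
    then show "(F has_vector_derivative rho0 t *\<^sub>R f t) (at t)"
      using DF t by (simp add: f_def)
  qed
  also have "\<dots> = - 1 / s"
    using s0 by (simp add: F_def e_def e'_def field_simps)
  finally show ?thesis
    by (simp add: s_def)
qed

section \<open>Completeness of polynomials\<close>

text \<open>The integral against \<open>g\<close> vanishes for polynomials, hence for continuous
  functions by Stone-Weierstrass, for indicators of closed sets as dominated limits, and for Borel
  sets because closed sets are an intersection-stable generator. So \<open>g\<close> and 0 are
  densities of the same signed measure.\<close>

lemma moments_zero_imp_AE_zero:
  fixes g :: "real \<Rightarrow> real"
  assumes int: "integrable lborel g" and supp: "\<And>t. t \<notin> {-1..1} \<Longrightarrow> g t = 0"
    and moments: "\<And>n. (LINT t|lborel. t ^ n * g t) = 0"
  shows "AE t in lborel. g t = 0"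
proof -
  have gm [measurable]: "g \<in> borel_measurable borel"
    using int by auto
  have bint: "integrable lborel (\<lambda>t. c t * g t)"
    if "c \<in> borel_measurable borel" "\<And>t. t \<in> {-1..1} \<Longrightarrow> \<bar>c t\<bar> \<le> B" for c B
  proof (rule Bochner_Integration.integrable_bound)
    show "integrable lborel (\<lambda>t. B * g t)"
      using int by (rule integrable_mult_right)
    show "(\<lambda>t. c t * g t) \<in> borel_measurable lborel"
      using that(1) by measurable
    show "AE t in lborel. norm (c t * g t) \<le> norm (B * g t)"
    proof (intro AE_I2)
      fix t
      show "norm (c t * g t) \<le> norm (B * g t)"
        using that(2)[of t] supp[of t] by (cases "t \<in> {-1..1}") (auto simp: abs_mult intro!: mult_right_mono)
    qed
  qed
  have poly: "(LINT t|lborel. p t * g t) = 0" if "real_polynomial_function p" for p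
  proof -
    have "\<exists>a n. \<forall>t. p t = (\<Sum>i\<le>n. a i * t ^ i)"
      using that unfolding real_polynomial_function_iff_sum by metis
    then obtain a n where p: "\<And>t. p t = (\<Sum>i\<le>n. a i * t ^ i)"
      by blast
    have pint: "integrable lborel (\<lambda>t. t ^ i * g t)" for i
      by (rule bint[of _ 1]) (auto simp: power_abs intro!: power_le_one)
    have "(LINT t|lborel. p t * g t) = (LINT t|lborel. (\<Sum>i\<le>n. a i * (t ^ i * g t)))"
      by (simp add: p sum_distrib_right mult.assoc)
    also have "\<dots> = (\<Sum>i\<le>n. (LINT t|lborel. a i * (t ^ i * g t)))"
      using pint by (intro Bochner_Integration.integral_sum) auto
    finally show ?thesis
      by (simp add: moments)
  qed
  have cont: "(LINT t|lborel. c t * g t) = 0" if c: "continuous_on UNIV c" for c :: "real \<Rightarrow> real"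
  proof -
    define N where "N = (LINT t|lborel. \<bar>g t\<bar>)"
    have N: "0 \<le> N"
      by (simp add: N_def)
    have bd: "\<exists>B. \<forall>t\<in>{-1..1}. \<bar>h t\<bar> \<le> B" if "continuous_on UNIV h" for h :: "real \<Rightarrow> real"
      using compact_imp_bounded[OF compact_continuous_image[OF continuous_on_subset[OF that] compact_Icc], of "-1" 1]
      unfolding bounded_iff by auto
    have cint: "integrable lborel (\<lambda>t. h t * g t)" if "continuous_on UNIV h" for h
      using bd[OF that] bint[OF borel_measurable_continuous_onI[OF that]] by blast
    have "\<bar>LINT t|lborel. c t * g t\<bar> \<le> 0 + e" if e: "0 < e" for e
    proof -
      have e': "0 < e / (N + 1)"
        using e N by simp
      obtain p where p: "real_polynomial_function p" "\<And>t. t \<in> {-1..1} \<Longrightarrow> \<bar>c t - p t\<bar> < e / (N + 1)"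
        using Stone_Weierstrass_real_polynomial_function[OF compact_Icc continuous_on_subset[OF c] e', of "-1" 1]
        by auto
      have cp: "continuous_on UNIV p"
        using continuous_on_polymonial_function[of p UNIV] p(1) real_polynomial_function_eq by blast
      have "(LINT t|lborel. c t * g t) = (LINT t|lborel. (c t - p t) * g t)"
        unfolding left_diff_distrib
        by (subst Bochner_Integration.integral_diff[OF cint[OF c] cint[OF cp]]) (simp add: poly p)
      also have "\<bar>\<dots>\<bar> \<le> (LINT t|lborel. (e / (N + 1)) * \<bar>g t\<bar>)"
      proof (rule order_trans[OF integral_abs_bound integral_mono])
        show "integrable lborel (\<lambda>t. \<bar>(c t - p t) * g t\<bar>)"
          unfolding left_diff_distrib using cint[OF c] cint[OF cp] by auto
        show "integrable lborel (\<lambda>t. (e / (N + 1)) * \<bar>g t\<bar>)"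
          using int by auto
        fix t
        show "\<bar>(c t - p t) * g t\<bar> \<le> (e / (N + 1)) * \<bar>g t\<bar>"
        proof (cases "t \<in> {-1..1}")
          case True
          then show ?thesis
            unfolding abs_mult using p(2)[OF True] by (intro mult_right_mono) auto
        qed (simp add: supp)
      qed
      also have "\<dots> = e * (N / (N + 1))"
        by (simp add: N_def)
      also have "\<dots> \<le> e"
        using e N by (intro mult_left_le) (auto simp: divide_le_eq_1)
      finally show ?thesis
        by simp
    qed
    then have "\<bar>LINT t|lborel. c t * g t\<bar> \<le> 0"
      by (rule field_le_epsilon)
    then show ?thesis
      by simp
  qed
  have closed: "(LINT t|lborel. indicator C t * g t) = 0" if C: "closed C" for C
  proof (cases "C = {}")
    case False
    define h where "h n t = max 0 (1 - real n * infdist t C)" for n t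
    have hcont: "continuous_on UNIV (h n)" for n
      unfolding h_def[abs_def] by (intro continuous_intros)
    have hlim: "(\<lambda>n. h n t) \<longlonglongrightarrow> indicator C t" for t
    proof (cases "t \<in> C")
      case True
      then show ?thesis
        by (simp add: h_def)
    next
      case notin: False
      then have d: "0 < infdist t C"
        using in_closed_iff_infdist_zero[OF C False, of t] infdist_nonneg[of t C] by linarith
      then obtain N where N: "1 < real N * infdist t C"
        using reals_Archimedean3 by blast
      have "h n t = 0" if "n \<ge> N" for n
      proof -
        have "real N * infdist t C \<le> real n * infdist t C"
          using that d by (intro mult_right_mono) auto
        then show ?thesis
          using N by (simp add: h_def)
      qed
      then have "\<forall>\<^sub>F n in sequentially. h n t = indicator C t"
        using notin by (auto simp: eventually_sequentially)
      then show ?thesis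
        by (rule tendsto_eventually)
    qed
    have "(\<lambda>n. LINT t|lborel. h n t * g t) \<longlonglongrightarrow> (LINT t|lborel. indicator C t * g t)"
    proof (rule integral_dominated_convergence)
      show "integrable lborel (\<lambda>t. \<bar>g t\<bar>)"
        using int by simp
      show "(\<lambda>t. indicator C t * g t) \<in> borel_measurable lborel"
        using gm borel_closed[OF C] by simp
      show "(\<lambda>t. h n t * g t) \<in> borel_measurable lborel" for n
        using borel_measurable_continuous_onI[OF hcont] by measurable
      show "AE t in lborel. (\<lambda>n. h n t * g t) \<longlonglongrightarrow> indicator C t * g t"
        by (intro AE_I2 tendsto_intros hlim)
      show "AE t in lborel. norm (h n t * g t) \<le> \<bar>g t\<bar>" for n
        by (intro AE_I2) (auto simp: h_def abs_mult infdist_nonneg intro!: mult_left_le_one_le)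
    qed
    then show ?thesis
      by (simp add: cont[OF hcont] LIMSEQ_const_iff)
  qed simp
  have borel: "(LINT t|lborel. indicator A t * g t) = 0" if "A \<in> sets borel" for A
  proof -
    have iint: "integrable lborel (\<lambda>t. indicator A t * g t)" if "A \<in> sets borel" for A
      using that by (intro bint[of _ 1]) (auto simp: indicator_def)
    have "Int_stable (Collect closed :: real set set)" "Collect closed \<subseteq> Pow (UNIV :: real set)"
      "A \<in> sigma_sets UNIV (Collect closed)"
      using that by (auto simp: borel_eq_closed Int_stable_def)
    then show ?thesis
    proof (induction rule: sigma_sets_induct_disjoint)
      case (basic A)
      then show ?case
        by (simp add: closed)
    next
      case (compl A)
      then have A: "A \<in> sets borel"
        by (simp add: borel_eq_closed)
      have "(LINT t|lborel. indicator (UNIV - A) t * g t) = (LINT t|lborel. g t - indicator A t * g t)"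
        by (intro Bochner_Integration.integral_cong) (auto simp: indicator_def)
      also have "\<dots> = (LINT t|lborel. g t) - (LINT t|lborel. indicator A t * g t)"
        by (intro Bochner_Integration.integral_diff int iint A)
      also have "\<dots> = 0"
        using compl moments[of 0] by simp
      finally show ?case .
    next
      case (union A)
      then have A: "A i \<in> sets borel" for i
        by (auto simp: borel_eq_closed)
      have "(LINT t:(\<Union>i. A i)|lborel. g t) = (\<Sum>i. LINT t:A i|lborel. g t)"
      proof (rule lebesgue_integral_countable_add)
        show "A i \<in> sets lborel" for i
          using A by simp
        show "A i \<inter> A j = {}" if "i \<noteq> j" for i j
          using union(1) that by (auto simp: disjoint_family_on_def)
        show "set_integrable lborel (\<Union>i. A i) g"
          unfolding set_integrable_def using iint[of "\<Union>i. A i"] A by simp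
      qed
      then show ?case
        using union by (simp add: set_lebesgue_integral_def)
    qed simp
  qed
  show ?thesis
  proof (rule density_unique_real[OF int integrable_zero])
    show "(LINT t:A|lborel. g t) = (LINT t:A|lborel. 0)" if "A \<in> sets lborel" for A
      using borel[of A] that by (simp add: set_lebesgue_integral_def)
  qed
qed

text \<open>Applied to the real and imaginary part of \<open>rho0 t *\<^sub>R f t\<close>. Where
  \<open>rho0\<close> vanishes nothing has to be shown, since that set is null for
  \<open>mu0\<close>.\<close>

lemma mu0_moments_zero:
  fixes f :: "real \<Rightarrow> complex"
  assumes int: "integrable mu0 f" and moments: "\<And>n. (LINT t|mu0. of_real t ^ n * f t) = 0"
  shows "AE t in mu0. f t = 0"
proof -
  have fm: "f \<in> borel_measurable mu0"
    using int by auto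
  define g where "g t = indicator {-1..1} t *\<^sub>R rho0 t *\<^sub>R f t" for t
  have gint: "integrable lborel g"
    using int unfolding integrable_mu0[OF fm] g_def .
  have ReIm: "t ^ n * Re (g t) = Re (of_real t ^ n * g t)" "t ^ n * Im (g t) = Im (of_real t ^ n * g t)" for t n
    by (simp_all flip: of_real_power)
  have "(LINT t|lborel. of_real t ^ n * g t) = 0" for n
  proof -
    have "(\<lambda>t. complex_of_real t ^ n * f t) \<in> borel_measurable mu0"
      using fm borel_measurable_mu0[of "\<lambda>t. complex_of_real t ^ n"] by (intro borel_measurable_times) auto
    from integral_mu0[OF this] show ?thesis
      by (simp add: moments g_def mult.left_commute scaleR_conv_of_real)
  qed
  moreover have "integrable lborel (\<lambda>t. of_real t ^ n * g t)" for n
  proof (rule Bochner_Integration.integrable_bound[OF gint])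
    show "(\<lambda>t. complex_of_real t ^ n * g t) \<in> borel_measurable lborel"
      using gint by (intro borel_measurable_times) auto
    show "AE t in lborel. norm (of_real t ^ n * g t) \<le> norm (g t)"
    proof (intro AE_I2)
      fix t
      show "norm (of_real t ^ n * g t) \<le> norm (g t)"
        by (cases "t \<in> {-1..1}")
          (auto simp: g_def norm_mult norm_power power_abs abs_le_iff intro!: mult_left_mono mult_left_le_one_le power_le_one)
    qed
  qed
  ultimately have "(LINT t|lborel. t ^ n * Re (g t)) = 0" "(LINT t|lborel. t ^ n * Im (g t)) = 0" for n
    unfolding ReIm by (simp_all only: integral_Re integral_Im zero_complex.sel)
  moreover have "g t = 0" if "t \<notin> {-1..1}" for t
    using that by (simp add: g_def)
  ultimately have "AE t in lborel. Re (g t) = 0" "AE t in lborel. Im (g t) = 0"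
    using gint by (intro moments_zero_imp_AE_zero; simp)+
  then have "AE t in lborel. g t = 0"
    by eventually_elim (simp add: complex_eq_iff)
  then have "AE t in lborel. t \<in> {-1..1} \<longrightarrow> 0 < ennreal (rho0 t) \<longrightarrow> f t = 0"
    by eventually_elim (auto simp: g_def)
  then show ?thesis
    unfolding mu0_def using rho0_measurable_restrict
    by (subst AE_density) (auto simp: AE_restrict_space_iff)
qed

section \<open>Resolvents and transfer functions of selfadjoint contractions\<close>

lemma inverse_slit_cut: "z \<in> \<E> \<Longrightarrow> z \<noteq> 0 \<Longrightarrow> 1 / z \<in> cut_plane"
proof -
  assume z: "z \<in> \<E>" "z \<noteq> 0"
  show ?thesis
  proof (rule ccontr)
    assume "1 / z \<notin> cut_plane"
    then obtain t where t: "1 / z = of_real t" "-1 \<le> t" "t \<le> 1"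
      by (auto simp: cut_plane_def)
    have "t \<noteq> 0"
      using t(1) z(2) by auto
    have "z * of_real t = 1"
      using z(2) by (simp flip: t(1))
    then have "z = of_real (1 / t)"
      using \<open>t \<noteq> 0\<close> by (simp add: field_simps)
    moreover have "1 \<le> \<bar>1 / t\<bar>"
      using \<open>t \<noteq> 0\<close> t(2,3) by (simp add: abs_le_iff)
    ultimately show False
      using z(1) by (auto simp: slit_plane_iff)
  qed
qed

context
  fixes A :: "'a::chilbert_space \<Rightarrow>\<^sub>L 'a"
  assumes sym: "\<And>x y. cinner (A x) y = cinner x (A y)" and contr: "\<And>x. norm (A x) \<le> norm x"
begin

lemma selfadjoint_resolvent_invertible:
  assumes "\<xi> \<in> cut_plane"
  shows "op_invertible (A - \<xi> *\<^sub>C id_blinfun)"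
proof (rule op_invertible_scaleC[of "-1"])
  have neg: "(-1) *\<^sub>C (A - \<xi> *\<^sub>C id_blinfun) = \<xi> *\<^sub>C id_blinfun - A"
    by (simp add: scaleC_op.diff_right scaleC_op.minus_left scaleC_op_one)
  have "op_invertible (\<xi> *\<^sub>C id_blinfun - A)"
  proof (cases "Im \<xi> = 0")
    case False
    have "Im (cinner (A x) x) = 0" for x
      using sym[of x x] cinner_commute[of x "A x"] by (simp add: complex_eq_iff)
    then show ?thesis
      using False by (intro Im_shift_invertible[of "- Im \<xi>"]) (auto simp flip: power2_eq_square)
  next
    case True
    show ?thesis
    proof (cases "1 < Re \<xi>")
      case True
      then show ?thesis
        using contr by (intro contraction_shift_invertible[of _ 1]) auto
    next
      case False
      then have "1 < Re (- \<xi>)"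
        using assms \<open>Im \<xi> = 0\<close> by (simp add: cut_plane_iff)
      then have "op_invertible ((- \<xi>) *\<^sub>C id_blinfun - (- A))"
        using contr by (intro contraction_shift_invertible[of _ 1]) (auto simp: blinfun.minus_left)
      moreover have "(- \<xi>) *\<^sub>C id_blinfun - (- A) = (-1) *\<^sub>C (\<xi> *\<^sub>C id_blinfun - A)"
        by (simp add: scaleC_op.diff_right scaleC_op.minus_left scaleC_op_one)
      ultimately show ?thesis
        using op_invertible_scaleC[of "-1" "\<xi> *\<^sub>C id_blinfun - A"] by simp
    qed
  qed
  then show "op_invertible ((-1) *\<^sub>C (A - \<xi> *\<^sub>C id_blinfun))"
    unfolding neg .
qed simp

lemma selfadjoint_slit_invertible:
  assumes "z \<in> \<E>"
  shows "op_invertible (id_blinfun - z *\<^sub>C A)"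
proof (cases "z = 0")
  case True
  have "id_blinfun o\<^sub>L id_blinfun = (id_blinfun :: 'a \<Rightarrow>\<^sub>L 'a)"
    by (rule blinfun_eqI) simp
  then show ?thesis
    using True by (auto simp: op_invertible_def scaleC_op.zero_left)
next
  case False
  have eq: "(- 1 / z) *\<^sub>C (id_blinfun - z *\<^sub>C A) = A - (1 / z) *\<^sub>C id_blinfun"
    using False by (simp add: scaleC_op.diff_right scaleC_op.minus_left scaleC_op_scaleC scaleC_op_one)
  show ?thesis
  proof (rule op_invertible_scaleC)
    show "- 1 / z \<noteq> 0"
      using False by simp
    show "op_invertible ((- 1 / z) *\<^sub>C (id_blinfun - z *\<^sub>C A))"
      unfolding eq by (rule selfadjoint_resolvent_invertible[OF inverse_slit_cut[OF assms False]])
  qed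
qed

end

section \<open>Blocks of a passive selfadjoint operator\<close>

lemma op_apply:
  "op_D T x = fst (T (x, 0))" "op_C T k = fst (T (0, k))" "op_F T k = snd (T (0, k))"
  by (simp_all add: op_D_def op_C_def op_F_def fst_blinfun.rep_eq snd_blinfun.rep_eq
      inl_blinfun.rep_eq inr_blinfun.rep_eq)

context
  fixes T :: "('m::chilbert_space \<times> 'k::chilbert_space) \<Rightarrow>\<^sub>L ('m \<times> 'k)"
  assumes T: "passive_selfadjoint T"
begin

lemma passive_selfadjoint_sym: "cinner (T p) q = cinner p (T q)"
  using T cinner_cadjoint[of T p q] by (simp add: passive_selfadjoint_def)

lemma passive_selfadjoint_contr: "norm (T p) \<le> norm p"
  using T norm_blinfun[of T p] mult_right_mono[of "norm T" 1 "norm p"]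
  by (simp add: passive_selfadjoint_def)

lemma op_F_sym: "cinner (op_F T x) y = cinner x (op_F T y)"
  using passive_selfadjoint_sym[of "(0, x)" "(0, y)"]
  by (simp add: op_apply cinner_prod_def cinner.zero_left cinner.zero_right)

lemma op_F_contr: "norm (op_F T x) \<le> norm x"
proof -
  have "norm (snd (T (0, x))) \<le> norm (T (0, x))"
    by (metis norm_snd_le prod.collapse)
  then show ?thesis
    using passive_selfadjoint_contr[of "(0, x)"] by (simp add: op_apply)
qed

lemma op_F_slit_invertible: "z \<in> \<E> \<Longrightarrow> op_invertible (id_blinfun - z *\<^sub>C op_F T)"
  by (rule selfadjoint_slit_invertible[OF op_F_sym op_F_contr])

lemma cadjoint_op_C: "cadjoint (op_C T) f = snd (T (f, 0))"
proof -
  have "cadjoint (op_C T) = snd_blinfun o\<^sub>L T o\<^sub>L inl_blinfun"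
  proof (rule cadjoint_eqI)
    fix k f
    show "cinner (op_C T k) f = cinner k ((snd_blinfun o\<^sub>L T o\<^sub>L inl_blinfun) f)"
      using passive_selfadjoint_sym[of "(0, k)" "(f, 0)"]
      by (simp add: op_apply cinner_prod_def cinner.zero_left cinner.zero_right snd_blinfun.rep_eq
          inl_blinfun.rep_eq)
  qed
  then show ?thesis
    by (simp add: snd_blinfun.rep_eq inl_blinfun.rep_eq)
qed

lemma T_split: "T (a, b) = T (a, 0) + T (0, b)"
  by (metis add.left_neutral add.right_neutral add_Pair blinfun.add_right)

lemma clinear_T: "clinear_op T"
  using T by (simp add: passive_selfadjoint_def)

lemma clinear_op_F: "clinear_op (op_F T)"
  unfolding clinear_op_def
proof (intro allI)
  fix a and x :: 'k
  have "(0, a *\<^sub>C x) = a *\<^sub>C (0 :: 'm, x)"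
    by (simp add: scaleC_prod_def scaleC.zero_right)
  then show "op_F T (a *\<^sub>C x) = a *\<^sub>C op_F T x"
    by (simp add: op_apply clinear_opD[OF clinear_T]) (simp add: scaleC_prod_def)
qed

lemma transfer_function_0: "transfer_function T 0 f = fst (T (f, 0))"
  by (simp add: transfer_function_def slit_plane_iff scaleC_op.zero_left op_apply)

text \<open>The Schur complement: \<open>(a, b) = (T - 1/z)\<^sup>-\<^sup>1 (f, 0)\<close> eliminates to \<open>(\<Omega>(z) - 1/z) a = f\<close>.\<close>

lemma transfer_function_resolvent:
  assumes z: "z \<in> \<E>" "z \<noteq> 0" and ab: "T (a, b) - (1 / z) *\<^sub>C (a, b) = (f, 0)"
  shows "transfer_function T z a = f + (1 / z) *\<^sub>C a"
proof -
  have 1: "fst (T (a, 0)) + fst (T (0, b)) - (1 / z) *\<^sub>C a = f"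
    and 2: "snd (T (a, 0)) + snd (T (0, b)) - (1 / z) *\<^sub>C b = 0"
    using ab unfolding T_split[of a b] by (auto simp: prod_eq_iff scaleC_prod_def)
  from 2 have "z *\<^sub>C (snd (T (a, 0)) + snd (T (0, b)) - (1 / z) *\<^sub>C b) = 0"
    by (simp add: scaleC.zero_right)
  then have "b - z *\<^sub>C op_F T b = z *\<^sub>C cadjoint (op_C T) a"
    using z(2) by (simp add: scaleC.diff_right scaleC_add_right scaleC_scaleC scaleC_one op_apply
        cadjoint_op_C algebra_simps)
  then have "op_inv (id_blinfun - z *\<^sub>C op_F T) (z *\<^sub>C cadjoint (op_C T) a) = b"
    using apply_op_inv_left[OF op_F_slit_invertible[OF z(1)], of b] by (simp add: blinfun.diff_left)
  moreover have "clinear_op (op_inv (id_blinfun - z *\<^sub>C op_F T))"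
    by (intro clinear_op_inv op_F_slit_invertible z clinear_intros clinear_op_F)
  ultimately have b: "z *\<^sub>C op_inv (id_blinfun - z *\<^sub>C op_F T) (cadjoint (op_C T) a) = b"
    by (simp add: clinear_opD)
  have "op_C T (z *\<^sub>C k) = z *\<^sub>C op_C T k" for k
  proof -
    have "(0, z *\<^sub>C k) = z *\<^sub>C (0 :: 'm, k)"
      by (simp add: scaleC_prod_def scaleC.zero_right)
    then show ?thesis
      by (simp add: op_apply clinear_opD[OF clinear_T]) (simp add: scaleC_prod_def)
  qed
  then have "transfer_function T z a = op_D T a + op_C T b"
    using z(1) b by (simp add: transfer_function_def blinfun.add_left) metis
  then show ?thesis
    using 1 by (simp add: op_apply algebra_simps)
qed

end

section \<open>The model system\<close>

lemma T0_apply: "T0 f = mult_H0 f"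
  by (simp add: T0.rep_eq)

lemma T0_sym: "cinner (T0 f) g = cinner f (T0 g)"
  unfolding T0_apply by transfer (simp add: cinner_scaleR_left cinner_scaleR_right)

lemma T0_contr: "norm (T0 f) \<le> norm f"
  unfolding T0_apply by (rule norm_mult_H0)

lemma T0_clinear: "T0 (a *\<^sub>C f) = a *\<^sub>C T0 f"
  unfolding T0_apply
proof (transfer, intro conjI impI)
  fix a and f :: "real \<Rightarrow> 'a" assume "L2_fun f \<and> L2_fun f \<and> (AE t in mu0. f t = f t)"
  then show "L2_fun (\<lambda>t. t *\<^sub>R a *\<^sub>C f t)" "L2_fun (\<lambda>t. a *\<^sub>C t *\<^sub>R f t)"
    by (simp_all add: bounded_linear_mult_H0_aux L2_fun_scaleC)
  show "AE t in mu0. t *\<^sub>R a *\<^sub>C f t = a *\<^sub>C t *\<^sub>R f t"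
    by (simp add: scaleR_scaleC scaleC_scaleC mult.commute)
qed

lemma const_H0_scaleC: "const_H0 (a *\<^sub>C f) = a *\<^sub>C const_H0 f"
  by transfer (simp add: L2_fun_const)

lemma T0_abs: "L2_fun f \<Longrightarrow> T0 (abs_H0 f) = abs_H0 (\<lambda>t. t *\<^sub>R f t)"
  unfolding T0_apply by (rule mult_H0.abs_eq) simp

lemma L2_fun_bounded_scaleC:
  fixes c :: "real \<Rightarrow> complex" and f :: "'m::separable_chilbert_space"
  assumes "c \<in> borel_measurable borel" "\<And>t. t \<in> {-1..1} \<Longrightarrow> cmod (c t) \<le> K"
  shows "L2_fun (\<lambda>t. c t *\<^sub>C f)"
proof (rule L2_funI)
  have [measurable]: "c \<in> borel_measurable mu0"
    by (rule borel_measurable_mu0[OF assms(1)])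
  show "(\<lambda>t. c t *\<^sub>C f) \<in> borel_measurable mu0"
    by (rule borel_measurable_continuous_on[where f = "\<lambda>a. a *\<^sub>C f"])
      (auto intro!: scaleC.continuous_on continuous_intros)
  show "integrable mu0 (\<lambda>t. K\<^sup>2 * (norm f)\<^sup>2)"
    by simp
  show "AE t in mu0. (norm (c t *\<^sub>C f))\<^sup>2 \<le> K\<^sup>2 * (norm f)\<^sup>2"
    by (intro AE_I2) (auto simp: space_mu0 norm_scaleC power_mult_distrib intro!: mult_right_mono power_mono assms(2))
qed

lemma T0_resolvent_invertible: "\<xi> \<in> cut_plane \<Longrightarrow> op_invertible (T0 - \<xi> *\<^sub>C id_blinfun)"
  by (rule selfadjoint_resolvent_invertible[OF T0_sym T0_contr])

text \<open>On constants the resolvent is multiplication by 1 / (t - \<xi>), verified by applying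
  \<open>T0 - \<xi> *\<^sub>C id_blinfun\<close> to the candidate \<open>R\<close>. The form is then
  the scalar integral computed above.\<close>

lemma cinner_T0_resolvent:
  assumes \<xi>: "\<xi> \<in> cut_plane"
  shows "cinner (op_inv (T0 - \<xi> *\<^sub>C id_blinfun) (const_H0 f)) (const_H0 h) = - 1 / sqrt_cut \<xi> * cinner f h"
proof -
  have nz: "complex_of_real t - \<xi> \<noteq> 0" if "t \<in> {-1..1}" for t
    using \<xi> that by (auto simp: cut_plane_def)
  define c where "c t = 1 / (complex_of_real t - \<xi>)" for t
  have cm: "c \<in> borel_measurable borel"
    unfolding c_def[abs_def] by measurable
  have "continuous_on {-1..1} c"
    unfolding c_def[abs_def] using nz by (intro continuous_intros) auto
  then have "bounded (c ` {-1..1})"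
    by (rule compact_imp_bounded[OF compact_continuous_image[OF _ compact_Icc]])
  then have "\<exists>K. \<forall>t\<in>{-1..1}. cmod (c t) \<le> K"
    by (simp add: bounded_iff)
  then obtain K where K: "\<And>t. t \<in> {-1..1} \<Longrightarrow> cmod (c t) \<le> K"
    by blast
  have L2: "L2_fun (\<lambda>t. c t *\<^sub>C f)"
    by (rule L2_fun_bounded_scaleC[OF cm K])
  define R where "R = abs_H0 (\<lambda>t. c t *\<^sub>C f)"
  have "T0 R - \<xi> *\<^sub>C R = abs_H0 (\<lambda>t. t *\<^sub>R c t *\<^sub>C f - \<xi> *\<^sub>C c t *\<^sub>C f)"
    unfolding R_def T0_abs[OF L2]
    by (simp add: scaleC_H0.abs_eq L2 abs_H0_diff bounded_linear_mult_H0_aux L2_fun_scaleC)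
  also have "\<dots> = const_H0 f"
    unfolding const_H0.abs_eq
  proof (rule Quotient_rel_abs[OF Quotient_H0], intro conjI)
    show "L2_fun (\<lambda>t. t *\<^sub>R c t *\<^sub>C f - \<xi> *\<^sub>C c t *\<^sub>C f)"
      by (intro L2_fun_diff bounded_linear_mult_H0_aux L2_fun_scaleC L2)
    show "AE t in mu0. t *\<^sub>R c t *\<^sub>C f - \<xi> *\<^sub>C c t *\<^sub>C f = f"
    proof (intro AE_I2)
      fix t assume "t \<in> space mu0"
      then have "(of_real t - \<xi>) * c t = 1"
        using nz[of t] by (simp add: c_def space_mu0)
      moreover have "t *\<^sub>R c t *\<^sub>C f - \<xi> *\<^sub>C c t *\<^sub>C f = ((of_real t - \<xi>) * c t) *\<^sub>C f"
        by (simp add: scaleR_scaleC scaleC_scaleC scaleC.diff_left left_diff_distrib)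
      ultimately show "t *\<^sub>R c t *\<^sub>C f - \<xi> *\<^sub>C c t *\<^sub>C f = f"
        by (simp add: scaleC_one)
    qed
  qed (rule L2_fun_const)
  finally have "op_inv (T0 - \<xi> *\<^sub>C id_blinfun) (const_H0 f) = R"
    using apply_op_inv_left[OF T0_resolvent_invertible[OF \<xi>], of R] by (simp add: blinfun.diff_left)
  then have "cinner (op_inv (T0 - \<xi> *\<^sub>C id_blinfun) (const_H0 f)) (const_H0 h) = (LINT t|mu0. c t * cinner f h)"
    by (simp add: R_def const_H0.abs_eq cinner_H0.abs_eq L2 L2_fun_const cinner_scaleC_left)
  also have "\<dots> = (LINT t|mu0. c t) * cinner f h"
    by simp
  finally show ?thesis
    unfolding c_def integral_mu0_resolvent[OF \<xi>] .
qed

lemma ortho_proj_const_H0: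
  assumes "\<And>h. cinner x (const_H0 h) = cinner f h"
  shows "ortho_proj (range const_H0) x = const_H0 f"
  unfolding ortho_proj_def
proof (rule the_equality)
  show "const_H0 f \<in> range const_H0 \<and> (\<forall>v\<in>range const_H0. cinner (x - const_H0 f) v = 0)"
    by (auto simp: cinner.diff_left assms cinner_const_H0)
  fix y assume "y \<in> range const_H0 \<and> (\<forall>v\<in>range const_H0. cinner (x - y) v = 0)"
  then obtain g where g: "y = const_H0 g" "\<And>h. cinner (x - y) (const_H0 h) = 0"
    by blast
  have "cinner (f - g) h = 0" for h
    using g(2)[of h] unfolding g(1) by (simp add: cinner.diff_left assms cinner_const_H0)
  from this[of "f - g"] show "y = const_H0 f"
    by (simp add: g(1) cinner_self)
qed

lemma M0_compressed_resolvent: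
  assumes \<xi>: "\<xi> \<in> cut_plane"
  shows "const_H0 (M0 \<xi> f) = ortho_proj (range const_H0) (op_inv (T0 - \<xi> *\<^sub>C id_blinfun) (const_H0 f))"
  by (rule ortho_proj_const_H0[symmetric])
    (simp add: cinner_T0_resolvent[OF \<xi>] M0_apply[OF \<xi>] cinner_scaleC_left)

lemma join_tau0: "join_H0 (tau0 p) = T0 (join_H0 p)"
  by (simp add: tau0.rep_eq surj_f_inv_f[OF bij_is_surj[OF bij_join_H0]])

lemma join_H0_scaleC: "join_H0 (a *\<^sub>C p) = a *\<^sub>C join_H0 p"
  by (simp add: join_H0_def scaleC_prod_def const_H0_scaleC scaleC_K0.rep_eq scaleC_add_right)

lemma join_H0_diff: "join_H0 (p - q) = join_H0 p - join_H0 q"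
  by (rule linear_diff[OF bounded_linear.linear[OF bounded_linear_join_H0]])

lemma tau0_passive_selfadjoint: "passive_selfadjoint tau0"
  unfolding passive_selfadjoint_def
proof (intro conjI)
  show "clinear_op (tau0 :: ('a \<times> 'a K0) \<Rightarrow>\<^sub>L ('a \<times> 'a K0))"
    unfolding clinear_op_def
  proof (intro allI)
    fix a and p :: "'a \<times> 'a K0"
    have "join_H0 (tau0 (a *\<^sub>C p)) = join_H0 (a *\<^sub>C tau0 p)"
      by (simp add: join_tau0 join_H0_scaleC T0_clinear)
    then show "tau0 (a *\<^sub>C p) = a *\<^sub>C tau0 p"
      by (rule injD[OF bij_is_inj[OF bij_join_H0]])
  qed
  show "cadjoint tau0 = (tau0 :: ('a \<times> 'a K0) \<Rightarrow>\<^sub>L ('a \<times> 'a K0))"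
  proof (rule cadjoint_eqI)
    fix p q :: "'a \<times> 'a K0"
    show "cinner (tau0 p) q = cinner p (tau0 q)"
      unfolding cinner_join_H0[symmetric] join_tau0 by (rule T0_sym)
  qed
  show "norm (tau0 :: ('a \<times> 'a K0) \<Rightarrow>\<^sub>L ('a \<times> 'a K0)) \<le> 1"
  proof (rule norm_blinfun_bound)
    fix p :: "'a \<times> 'a K0"
    show "norm (tau0 p) \<le> 1 * norm p"
      unfolding norm_join_H0[symmetric] join_tau0 using T0_contr by simp
  qed simp
qed

lemma cinner_join_const: "cinner (join_H0 (a, b)) (const_H0 h) = cinner a h"
  by (simp add: join_H0_def cinner_add_left cinner_const_H0 of_K0_orth)

lemma join_H0_const: "join_H0 (f, 0) = const_H0 f"
  by (simp add: join_H0_def zero_K0.rep_eq)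

text \<open>For \<open>z \<noteq> 0\<close> the compressed resolvent at \<open>1 / z\<close> is
  known, and the Schur complement relation is read backwards from it. That relation divides by
  \<open>z\<close>, so \<open>z = 0\<close> is separate and reduces to the vanishing first
  moment.\<close>

lemma transfer_function_tau0: "transfer_function tau0 = Omega0"
proof (rule extensionalityI[of _ \<E>])
  show "transfer_function tau0 \<in> extensional \<E>" "Omega0 \<in> extensional \<E>"
    by (simp_all add: transfer_function_def Omega0_def)
  fix z assume z: "z \<in> \<E>"
  show "transfer_function tau0 z = (Omega0 z :: 'a \<Rightarrow>\<^sub>L 'a)"
  proof (rule blinfun_eqI)
    fix a :: 'a
    show "transfer_function tau0 z a = Omega0 z a"
    proof (cases "z = 0")
      case True
      have "fst (tau0 (a, 0)) = 0"
      proof (rule cinner_eqI)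
        fix h
        have "cinner h (fst (tau0 (a, 0))) = cnj (cinner (join_H0 (tau0 (a, 0))) (const_H0 h))"
          by (metis cinner_commute cinner_join_const prod.collapse)
        also have "cinner (join_H0 (tau0 (a, 0))) (const_H0 h) = (LINT t|mu0. of_real t * cinner a h)"
          unfolding join_tau0 join_H0_const
          by (simp add: const_H0.abs_eq T0_abs cinner_H0.abs_eq L2_fun_const bounded_linear_mult_H0_aux cinner_scaleR_left)
        also have "\<dots> = 0"
          using integral_mu0_id by simp
        finally show "cinner h (fst (tau0 (a, 0))) = cinner h 0"
          by (simp add: cinner.zero_right)
      qed
      then show ?thesis
        using True z by (simp add: transfer_function_0[OF tau0_passive_selfadjoint] Omega0_def scaleC.zero_left)
    next
      case False
      define s where "s = sqrt_cut (1 / z)"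
      have cut: "1 / z \<in> cut_plane"
        by (rule inverse_slit_cut[OF z False])
      have s0: "s \<noteq> 0"
        unfolding s_def by (rule sqrt_cut_nz[OF cut])
      have s: "s = sqrt_slit z / z"
        by (simp add: s_def sqrt_cut_def sqrt_slit_def power_divide)
      \<comment> \<open>The compressed resolvent multiplies by \<open>- 1 / s\<close>, so this
        right-hand side produces the prescribed first component \<open>a\<close>.\<close>
      define f where "f = (- s) *\<^sub>C a"
      define R where "R = op_inv (T0 - (1 / z) *\<^sub>C id_blinfun) (const_H0 f)"
      obtain p where p: "join_H0 p = R"
        using surj_join_H0 by blast
      have "cinner (fst p) h = cinner a h" for h
      proof -
        have "cinner (fst p) h = cinner R (const_H0 h)"
          by (metis cinner_join_const p prod.collapse)
        also have "\<dots> = - 1 / s * cinner f h"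
          by (simp add: R_def cinner_T0_resolvent[OF cut] s_def)
        finally show ?thesis
          using s0 by (simp add: f_def cinner_scaleC_left)
      qed
      then have "cinner h (fst p) = cinner h a" for h
        by (metis cinner_commute)
      then have pa: "fst p = a"
        by (rule cinner_eqI)
      have "join_H0 (tau0 p - (1 / z) *\<^sub>C p) = T0 R - (1 / z) *\<^sub>C R"
        by (simp add: join_H0_diff join_tau0 join_H0_scaleC p)
      also have "\<dots> = join_H0 (f, 0)"
        using apply_op_inv_right[OF T0_resolvent_invertible[OF cut], of "const_H0 f"]
        by (simp add: R_def join_H0_const blinfun.diff_left)
      finally have "tau0 p - (1 / z) *\<^sub>C p = (f, 0)"
        by (rule injD[OF bij_is_inj[OF bij_join_H0]])
      then have "tau0 (a, snd p) - (1 / z) *\<^sub>C (a, snd p) = (f, 0)"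
        using pa by (metis prod.collapse)
      then have "transfer_function tau0 z a = f + (1 / z) *\<^sub>C a"
        by (rule transfer_function_resolvent[OF tau0_passive_selfadjoint z False])
      also have "\<dots> = (1 / z - s) *\<^sub>C a"
        by (simp add: f_def scaleC.diff_left scaleC.minus_left)
      also have "1 / z - s = z / (1 + sqrt_slit z)"
      proof -
        have "(1 - sqrt_slit z) * (1 + sqrt_slit z) = z * z"
          using sqrt_slit_square[of z] by (simp add: power2_eq_square algebra_simps)
        then have "(1 - sqrt_slit z) / z = z / (1 + sqrt_slit z)"
          using False one_plus_sqrt_slit_nz[OF z] by (simp add: frac_eq_eq)
        then show ?thesis
          by (simp add: s diff_divide_distrib)
      qed
      finally show ?thesis
        using z by (simp add: Omega0_def)
    qed
  qed
qed

section \<open>Density of subspaces, and simplicity of the model\<close>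

lemma csubspace_csubspace_hull: "csubspace (csubspace hull S)"
  by (rule hull_in) (auto simp: csubspace_def intro!: subspace_Inter)

lemma csubspace_closure:
  assumes "csubspace V"
  shows "csubspace (closure V)"
proof -
  have V: "0 \<in> V" "\<And>x y. x \<in> V \<Longrightarrow> y \<in> V \<Longrightarrow> x + y \<in> V" "\<And>a x. x \<in> V \<Longrightarrow> a *\<^sub>C x \<in> V"
    using assms by (auto simp: csubspace_def subspace_0 subspace_add)
  have C: "a *\<^sub>C x \<in> closure V" if "x \<in> closure V" for a x
  proof -
    obtain X where X: "\<And>n. X n \<in> V" "X \<longlonglongrightarrow> x"
      using \<open>x \<in> closure V\<close> by (auto simp: closure_sequential)
    have "(\<lambda>n. a *\<^sub>C X n) \<longlonglongrightarrow> a *\<^sub>C x"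
      by (intro scaleC.tendsto tendsto_const X)
    then show ?thesis
      unfolding closure_sequential using X(1) V(3) by (intro exI[of _ "\<lambda>n. a *\<^sub>C X n"]) auto
  qed
  have "subspace (closure V)"
  proof (rule subspaceI)
    show "0 \<in> closure V"
      using V(1) closure_subset by blast
    show "r *\<^sub>R x \<in> closure V" if "x \<in> closure V" for r x
      using C[OF that] by (simp add: scaleR_scaleC)
    fix x y assume "x \<in> closure V" "y \<in> closure V"
    then obtain X Y where X: "\<And>n. X n \<in> V" "X \<longlonglongrightarrow> x" and Y: "\<And>n. Y n \<in> V" "Y \<longlonglongrightarrow> y"
      by (auto simp: closure_sequential)
    show "x + y \<in> closure V"
      unfolding closure_sequential using X(1) Y(1) V(2) tendsto_add[OF X(2) Y(2)]
      by (intro exI[of _ "\<lambda>n. X n + Y n"]) auto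
  qed
  with C show ?thesis
    by (simp add: csubspace_def)
qed

text \<open>Riesz on the closed subspace \<open>closure V\<close> represents the functional of
  \<open>x\<close> by a vector \<open>y\<close>, the orthogonal projection of \<open>x\<close>.
  Testing with \<open>\<i> *\<^sub>C v\<close> upgrades real to complex orthogonality of
  \<open>x - y\<close>.\<close>

lemma csubspace_dense_if_orthogonal_trivial:
  fixes V :: "'a::chilbert_space set"
  assumes V: "csubspace V" and trivial: "\<And>k. (\<And>v. v \<in> V \<Longrightarrow> cinner v k = 0) \<Longrightarrow> k = 0"
  shows "closure V = UNIV"
proof (intro equalityI subset_UNIV subsetI)
  fix x :: 'a
  have cV: "csubspace (closure V)"
    by (rule csubspace_closure[OF V])
  have "\<exists>y\<in>closure V. \<forall>v\<in>closure V. inner v x = inner v y"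
    using cV by (intro riesz_representation_on bounded_linear_inner_left) (auto simp: csubspace_def)
  then obtain y where y: "y \<in> closure V" "\<And>v. v \<in> closure V \<Longrightarrow> inner v (x - y) = 0"
    by (auto simp: inner_diff_right)
  have "x - y = 0"
  proof (rule trivial)
    fix v assume v: "v \<in> V"
    then have "v \<in> closure V" "\<i> *\<^sub>C v \<in> closure V"
      using cV closure_subset by (auto simp: csubspace_def)
    from y(2)[OF this(1)] y(2)[OF this(2)] show "cinner v (x - y) = 0"
      by (simp add: inner_eq_Re_cinner cinner_scaleC_left complex_eq_iff)
  qed
  then show "x \<in> closure V"
    using y(1) by simp
qed

text \<open>For each \<open>f\<close> the scalar function \<open>cinner f (g t)\<close> has
  vanishing moments, but its null set depends on \<open>f\<close>. Separability leaves countably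
  many \<open>f\<close> to test, hence one common null set.\<close>

lemma H0_eq_0_if_moments_zero:
  fixes G :: "'m::separable_chilbert_space H0"
  assumes "\<And>n f. cinner ((blinfun_apply T0 ^^ n) (const_H0 f)) G = 0"
  shows "G = 0"
proof -
  define g where "g = rep_H0 G"
  have L2g: "L2_fun g" and G: "G = abs_H0 g"
    by (simp_all add: g_def L2_fun_rep abs_rep_H0)
  have L2n: "L2_fun (\<lambda>t. t ^ n *\<^sub>R f)" for n and f :: 'm
  proof -
    have "L2_fun (\<lambda>t. of_real (t ^ n) *\<^sub>C f)"
      by (rule L2_fun_bounded_scaleC[of _ 1])
        (auto simp: norm_power power_abs abs_le_iff intro!: power_le_one)
    then show ?thesis
      by (simp add: scaleR_scaleC)
  qed
  have pow: "(blinfun_apply T0 ^^ n) (const_H0 f) = abs_H0 (\<lambda>t. t ^ n *\<^sub>R f)" for n and f :: 'm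
    by (induction n) (simp_all add: const_H0.abs_eq T0_abs L2n)
  have zero: "AE t in mu0. cinner f (g t) = 0" for f
  proof (rule mu0_moments_zero)
    show "integrable mu0 (\<lambda>t. cinner f (g t))"
      by (rule L2_fun_cinner[OF L2_fun_const L2g])
    show "(LINT t|mu0. of_real t ^ n * cinner f (g t)) = 0" for n
      using assms[of n f] unfolding pow G
      by (simp add: cinner_H0.abs_eq L2n L2g cinner_scaleR_left)
  qed
  obtain D :: "'m set" where D: "countable D" "\<And>X. open X \<Longrightarrow> X \<noteq> {} \<Longrightarrow> \<exists>d\<in>D. d \<in> X"
    using countable_dense_exists[where 'a = 'm] by auto
  have "AE t in mu0. \<forall>f\<in>D. cinner f (g t) = 0"
    using zero D(1) by (simp add: AE_ball_countable)
  then have "AE t in mu0. g t = 0"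
  proof (rule AE_mp, intro AE_I2 impI)
    fix t assume t: "\<forall>f\<in>D. cinner f (g t) = 0"
    show "g t = 0"
    proof (rule ccontr)
      assume "g t \<noteq> 0"
      then have "g t \<in> {x. cinner x (g t) \<noteq> 0}"
        by (simp add: cinner_self)
      then have "{x. cinner x (g t) \<noteq> 0} \<noteq> {}"
        by blast
      moreover have "open {x. cinner x (g t) \<noteq> 0}"
        by (intro open_Collect_neq cinner.continuous_on continuous_intros)
      ultimately show False
        using D(2) t by blast
    qed
  qed
  then show ?thesis
    unfolding G zero_H0_def using L2g L2_fun_const
    by (intro Quotient_rel_abs[OF Quotient_H0]) auto
qed

text \<open>The span \<open>W\<close> contains the range of the lower left block and is invariant
  under \<open>op_F\<close>, so 'm together with \<open>W\<close> is invariant under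
  \<open>T0\<close> and contains all polynomials with vector coefficients. A vector of
  \<open>K0\<close> orthogonal to \<open>W\<close> is orthogonal to these.\<close>

lemma tau0_simple:
  "simple_system (tau0 :: ('m::separable_chilbert_space \<times> 'm K0) \<Rightarrow>\<^sub>L ('m \<times> 'm K0))"
  unfolding simple_system_def
proof (rule csubspace_dense_if_orthogonal_trivial[OF csubspace_csubspace_hull])
  let ?T = "tau0 :: ('m \<times> 'm K0) \<Rightarrow>\<^sub>L ('m \<times> 'm K0)"
  define S where "S = (\<Union>n. range (\<lambda>f. (blinfun_apply (op_F ?T) ^^ n) (cadjoint (op_C ?T) f)))"
  define W where "W = csubspace hull S"
  note T = tau0_passive_selfadjoint[where 'a = 'm]
  fix k :: "'m K0"
  assume "\<And>v. v \<in> csubspace hull (\<Union>n. range (\<lambda>f. (blinfun_apply (op_F ?T) ^^ n) (cadjoint (op_C ?T) f))) \<Longrightarrow> cinner v k = 0"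
  then have orth: "cinner v k = 0" if "v \<in> W" for v
    using that by (simp add: W_def S_def)
  have Wsub: "csubspace W"
    unfolding W_def by (rule csubspace_csubspace_hull)
  have SW: "S \<subseteq> W"
    unfolding W_def by (rule hull_subset)
  have SF: "op_F ?T v \<in> S" if v: "v \<in> S" for v
  proof -
    obtain n f where "v = (blinfun_apply (op_F ?T) ^^ n) (cadjoint (op_C ?T) f)"
      using v by (auto simp: S_def)
    then have "op_F ?T v = (blinfun_apply (op_F ?T) ^^ Suc n) (cadjoint (op_C ?T) f)"
      by simp
    then show ?thesis
      unfolding S_def by blast
  qed
  have "W \<subseteq> {v. op_F ?T v \<in> W}"
    unfolding W_def
  proof (rule hull_minimal)
    show "S \<subseteq> {v. op_F ?T v \<in> csubspace hull S}"
      using SF SW by (auto simp: W_def)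
    show "csubspace {v. op_F ?T v \<in> csubspace hull S}"
      using Wsub unfolding W_def csubspace_def subspace_def
      by (auto simp: blinfun.zero_right blinfun.add_right blinfun.scaleR_right clinear_opD[OF clinear_op_F[OF T]])
  qed
  then have WF: "op_F ?T v \<in> W" if "v \<in> W" for v
    using that by blast
  have WC: "cadjoint (op_C ?T) f \<in> W" for f
    using SW unfolding S_def by (force intro: exI[of _ 0])
  \<comment> \<open>The components in 'm need no control: they are orthogonal to \<open>K0\<close>
    anyway.\<close>
  have inv: "\<exists>m v. v \<in> W \<and> (blinfun_apply T0 ^^ n) (const_H0 f) = join_H0 (m, v)" for n and f :: 'm
  proof (induction n)
    case 0
    have "0 \<in> W"
      using Wsub by (simp add: csubspace_def subspace_0)
    then show ?case
      by (metis funpow_0 join_H0_const)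
  next
    case (Suc n)
    then obtain m v where v: "v \<in> W" "(blinfun_apply T0 ^^ n) (const_H0 f) = join_H0 (m, v)"
      by blast
    have "snd (?T (m, v)) = cadjoint (op_C ?T) m + op_F ?T v"
      by (subst T_split[OF T]) (simp add: cadjoint_op_C[OF T] op_apply)
    then have "snd (?T (m, v)) \<in> W"
      using Wsub WC[of m] WF[OF v(1)] by (simp add: csubspace_def subspace_add)
    moreover have "(blinfun_apply T0 ^^ Suc n) (const_H0 f) = join_H0 (fst (?T (m, v)), snd (?T (m, v)))"
      by (simp add: v(2) join_tau0)
    ultimately show ?case
      by blast
  qed
  have "of_K0 k = 0"
  proof (rule H0_eq_0_if_moments_zero)
    fix n and f :: 'm
    obtain m v where v: "v \<in> W" "(blinfun_apply T0 ^^ n) (const_H0 f) = join_H0 (m, v)"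
      using inv by blast
    have "of_K0 k = join_H0 (0, k)"
      using const_H0_scaleR[of 0 0] by (simp add: join_H0_def)
    then show "cinner ((blinfun_apply T0 ^^ n) (const_H0 f)) (of_K0 k) = 0"
      by (simp add: v(2) cinner_join_H0 cinner_prod_def orth[OF v(1)] cinner.zero_right)
  qed
  then show "k = 0"
    by (metis of_K0_inject zero_K0.rep_eq)
qed

theorem proposition6p6:
  shows
    "((\<forall>\<Omega> :: complex \<Rightarrow> 'm::separable_chilbert_space \<Rightarrow>\<^sub>L 'm. \<Omega> \<in> RS \<longrightarrow>
        (\<forall>z\<in>\<E>. op_invertible (id_blinfun - z *\<^sub>C \<Omega> z))) \<and>
      (Phi :: (complex \<Rightarrow> 'm \<Rightarrow>\<^sub>L 'm) \<Rightarrow> complex \<Rightarrow> 'm \<Rightarrow>\<^sub>L 'm) \<in> RS \<rightarrow> RS \<and>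
      {\<Omega> :: complex \<Rightarrow> 'm \<Rightarrow>\<^sub>L 'm. \<Omega> \<in> RS \<and> Phi \<Omega> = \<Omega>} = {Omega0} \<and>
      (Omega0 \<i> :: 'm \<Rightarrow>\<^sub>L 'm) = (\<i> / complex_of_real (1 + sqrt 2)) *\<^sub>C id_blinfun)
     \<and>
     ((\<forall>M :: complex \<Rightarrow> 'm \<Rightarrow>\<^sub>L 'm. M \<in> N0 \<longrightarrow> (\<forall>\<xi>\<in>cut_plane. op_invertible (M \<xi>))) \<and>
      (Gam :: (complex \<Rightarrow> 'm \<Rightarrow>\<^sub>L 'm) \<Rightarrow> complex \<Rightarrow> 'm \<Rightarrow>\<^sub>L 'm) \<in> N0 \<rightarrow> N0 \<and>
      {M :: complex \<Rightarrow> 'm \<Rightarrow>\<^sub>L 'm. M \<in> N0 \<and> Gam M = M} = {M0} \<and>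
      (M0 \<i> :: 'm \<Rightarrow>\<^sub>L 'm) = (\<i> / complex_of_real (sqrt 2)) *\<^sub>C id_blinfun)
     \<and>
     (passive_selfadjoint (tau0 :: ('m \<times> 'm K0) \<Rightarrow>\<^sub>L ('m \<times> 'm K0)) \<and>
      simple_system (tau0 :: ('m \<times> 'm K0) \<Rightarrow>\<^sub>L ('m \<times> 'm K0)) \<and>
      (\<forall>z\<in>\<E>. op_invertible
        (id_blinfun - z *\<^sub>C op_F (tau0 :: ('m \<times> 'm K0) \<Rightarrow>\<^sub>L ('m \<times> 'm K0)))) \<and>
      Omega0 = transfer_function (tau0 :: ('m \<times> 'm K0) \<Rightarrow>\<^sub>L ('m \<times> 'm K0)) \<and>
      (\<forall>\<xi>\<in>cut_plane. op_invertible ((T0 :: 'm H0 \<Rightarrow>\<^sub>L 'm H0) - \<xi> *\<^sub>C id_blinfun) \<and>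
        (\<forall>f :: 'm. const_H0 (M0 \<xi> f) =
          ortho_proj (range const_H0) (op_inv (T0 - \<xi> *\<^sub>C id_blinfun) (const_H0 f)))))"
proof (intro conjI allI impI ballI)
  show "Phi \<in> RS \<rightarrow> (RS :: (complex \<Rightarrow> 'm \<Rightarrow>\<^sub>L 'm) set)"
    using Phi_RS by blast
  show "{\<Omega> :: complex \<Rightarrow> 'm \<Rightarrow>\<^sub>L 'm. \<Omega> \<in> RS \<and> Phi \<Omega> = \<Omega>} = {Omega0}"
    using Phi_fixed_point_unique Omega0_RS Phi_Omega0 by blast
  show "Gam \<in> N0 \<rightarrow> (N0 :: (complex \<Rightarrow> 'm \<Rightarrow>\<^sub>L 'm) set)"
    using Gam_N0 by blast
  show "{M :: complex \<Rightarrow> 'm \<Rightarrow>\<^sub>L 'm. M \<in> N0 \<and> Gam M = M} = {M0}"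
    using Gam_fixed_point_unique M0_N0 Gam_M0 by blast
  show "Omega0 = transfer_function (tau0 :: ('m \<times> 'm K0) \<Rightarrow>\<^sub>L ('m \<times> 'm K0))"
    by (rule transfer_function_tau0[symmetric])
qed (simp_all only: RS_resolvent_invertible Omega0_i N0_invertible M0_i tau0_passive_selfadjoint
    tau0_simple op_F_slit_invertible[OF tau0_passive_selfadjoint] T0_resolvent_invertible
    M0_compressed_resolvent)

end
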